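(* Let $\Omega_2\subset\mathbb{R}^{d-1}$ be a subset of finite positive $(d-1)$-dimensional Lebesgue measure. The symmetric operator $\frac1i\frac{\partial}{\partial x_1}$ in $L^2((0,1)\times\Omega_2)$ with dense domain $\mathcal{D}$ consisting of $\varphi\in L^2((0,1)\times\Omega_2)$ such that $\varphi(\cdot,y)\in C_c^\infty((0,1))$ for all $y\in\Omega_2$, has self-adjoint extensions indexed by unitary operators $V$ in $L^2(\Omega_2)$ in such a way that the (unique) extension $H_V$ is determined by its core domain being of the form $$\mathcal{D}_V=\{\varphi(x_1,y)+e^{x_1}h(y)+e^{1-x_1}(Vh)(y):\ \varphi\in\mathcal{D},\ h\in L^2(\Omega_2)\}$$ and $$iH_V(\varphi+e^{x_1}h+e^{1-x_1}Vh)=\frac{\partial\varphi}{\partial x_1}+e^{x_1}h-e^{1-x_1}Vh,\qquad \varphi\in\mathcal{D},\ h\in L^2(\Omega_2).$$ The implicit boundary condition dictating the extension $H_V$ is interpreted as $$f(1,\cdot)=U_V(f(0,\cdot)),\qquad f\in\mathcal{D}_V,$$ where the partial isometry $U_V$ is given by $$W_V=(eI+V)(I+eV)^{-1},\qquad U_V=\exp W_V.$$ Conversely, $V$ may be calculated from $U_V$ by $$V=(I-eW_V)^{-1}(W_V-eI),$$ and in each case the fractional linear transform, and its inverse, are well defined.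
   Context: Points of $(0,1)\times\Omega_2$ are written $(x_1,y)$ with $0<x_1<1$ and $y=(x_2,\dots,x_d)\in\Omega_2$. In the formulas for $W_V$ and $V$, $e$ is the base of the natural logarithm and $I$ is the identity operator on $L^2(\Omega_2)$. A core of a self-adjoint operator is a subspace of its domain such that the operator is the closure of its restriction to that subspace.
   Formalization: U_V = exp W_V is replaced by U_V = W_V, since f(1,·) = W_V f(0,·) (for V = I, W_V = I but exp W_V = eI); and 𝒟 additionally requires ∂φ/∂x_1 ∈ L², without which the operator in L² is not defined on 𝒟. *)

theory Defs
  imports "HOL-Analysis.Analysis"
begin

section \<open>Complex square-integrable functions\<close>

definition sq_integrable :: "('a::euclidean_space \<Rightarrow> complex) \<Rightarrow> bool" where
  "sq_integrable f \<longleftrightarrow>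
     f \<in> borel_measurable lebesgue \<and> integrable lebesgue (\<lambda>x. (cmod (f x))\<^sup>2)"

lemma sq_integrable_cnj_mult:
  assumes "sq_integrable f" "sq_integrable g"
  shows "integrable lebesgue (\<lambda>x. cnj (f x) * g x)"
proof (rule Bochner_Integration.integrable_bound)
  show "integrable lebesgue (\<lambda>x. (cmod (f x))\<^sup>2 + (cmod (g x))\<^sup>2)"
    using assms by (simp add: sq_integrable_def)
  show "(\<lambda>x. cnj (f x) * g x) \<in> borel_measurable lebesgue"
  proof -
    have "(\<lambda>x. cnj (f x)) \<in> borel_measurable lebesgue"
      using assms(1) unfolding sq_integrable_def
      by (auto intro: borel_measurable_continuous_on[where f = cnj] continuous_intros)
    then show ?thesis using assms(2) unfolding sq_integrable_def by auto
  qed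
  show "AE x in lebesgue. norm (cnj (f x) * g x) \<le> norm ((cmod (f x))\<^sup>2 + (cmod (g x))\<^sup>2)"
  proof (intro AE_I2)
    fix x
    have "0 \<le> (cmod (f x) - cmod (g x))\<^sup>2" by simp
    then have "2 * (cmod (f x) * cmod (g x)) \<le> (cmod (f x))\<^sup>2 + (cmod (g x))\<^sup>2"
      by (simp add: power2_diff)
    moreover have "0 \<le> cmod (f x) * cmod (g x)" by simp
    ultimately show "norm (cnj (f x) * g x) \<le> norm ((cmod (f x))\<^sup>2 + (cmod (g x))\<^sup>2)"
      unfolding norm_mult complex_mod_cnj real_norm_def by linarith
  qed
qed

lemma sq_integrable_zero: "sq_integrable (\<lambda>x. 0)"
  by (simp add: sq_integrable_def)

lemma sq_integrable_cmult:
  assumes "sq_integrable f"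
  shows "sq_integrable (\<lambda>x. c * f x)"
  using assms by (auto simp: sq_integrable_def norm_mult power_mult_distrib)

lemma sq_integrable_add:
  assumes "sq_integrable f" "sq_integrable g"
  shows "sq_integrable (\<lambda>x. f x + g x)"
proof -
  have m: "(\<lambda>x. f x + g x) \<in> borel_measurable lebesgue"
    using assms by (auto simp: sq_integrable_def)
  moreover have "integrable lebesgue (\<lambda>x. (cmod (f x + g x))\<^sup>2)"
  proof (rule Bochner_Integration.integrable_bound)
    show "integrable lebesgue (\<lambda>x. 2 * (cmod (f x))\<^sup>2 + 2 * (cmod (g x))\<^sup>2)"
      using assms by (simp add: sq_integrable_def)
    show "(\<lambda>x. (cmod (f x + g x))\<^sup>2) \<in> borel_measurable lebesgue" using m by auto
    show "AE x in lebesgue. norm ((cmod (f x + g x))\<^sup>2)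
            \<le> norm (2 * (cmod (f x))\<^sup>2 + 2 * (cmod (g x))\<^sup>2)"
    proof (intro AE_I2)
      fix x
      have "(cmod (f x + g x))\<^sup>2 \<le> (cmod (f x) + cmod (g x))\<^sup>2"
        by (intro power_mono norm_triangle_ineq) simp
      also have "\<dots> \<le> 2 * (cmod (f x))\<^sup>2 + 2 * (cmod (g x))\<^sup>2"
        using zero_le_power2[of "cmod (f x) - cmod (g x)"]
        by (simp add: power2_diff power2_sum)
      finally show "norm ((cmod (f x + g x))\<^sup>2) \<le> norm (2 * (cmod (f x))\<^sup>2 + 2 * (cmod (g x))\<^sup>2)"
        by simp
    qed
  qed
  ultimately show ?thesis by (simp add: sq_integrable_def)
qed

section \<open>The space of classes modulo equality almost everywhere\<close>

definition l2_rel :: "('a::euclidean_space \<Rightarrow> complex) \<Rightarrow> ('a \<Rightarrow> complex) \<Rightarrow> bool" where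
  "l2_rel f g \<longleftrightarrow> sq_integrable f \<and> sq_integrable g \<and> (AE x in lebesgue. f x = g x)"

lemma l2_rel_part_equivp: "part_equivp l2_rel"
proof (rule part_equivpI)
  show "\<exists>f. l2_rel f f" by (rule exI[of _ "\<lambda>x. 0"]) (simp add: l2_rel_def sq_integrable_zero)
  show "symp l2_rel" by (auto intro!: sympI simp: l2_rel_def elim: eventually_mono)
  show "transp l2_rel"
  proof (rule transpI)
    fix f g h assume "l2_rel f g" "l2_rel g h"
    then show "l2_rel f h" unfolding l2_rel_def by (auto elim: AE_mp)
  qed
qed

quotient_type (overloaded) 'a l2 = "'a::euclidean_space \<Rightarrow> complex" / partial: l2_rel
  by (rule l2_rel_part_equivp)

lift_definition cinner :: "'a::euclidean_space l2 \<Rightarrow> 'a l2 \<Rightarrow> complex"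
  is "\<lambda>f g. \<integral>x. cnj (f x) * g x \<partial>lebesgue"
  unfolding l2_rel_def sq_integrable_def
  by (intro integral_cong_AE)
     (auto intro!: borel_measurable_times borel_measurable_continuous_on[where f = cnj]
        continuous_intros elim: AE_mp)

lift_definition scaleC :: "complex \<Rightarrow> 'a::euclidean_space l2 \<Rightarrow> 'a l2" (infixr "*\<^sub>C" 75)
  is "\<lambda>c f x. c * f x"
  by (auto simp: l2_rel_def sq_integrable_cmult)

instantiation l2 :: (euclidean_space) real_vector
begin

lift_definition zero_l2 :: "'a l2" is "\<lambda>x. 0"
  by (simp add: l2_rel_def sq_integrable_zero)

lift_definition plus_l2 :: "'a l2 \<Rightarrow> 'a l2 \<Rightarrow> 'a l2" is "\<lambda>f g x. f x + g x"
  by (auto simp: l2_rel_def sq_integrable_add elim: AE_mp)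

definition uminus_l2 :: "'a l2 \<Rightarrow> 'a l2" where "- f = (- 1) *\<^sub>C f"

definition minus_l2 :: "'a l2 \<Rightarrow> 'a l2 \<Rightarrow> 'a l2" where "f - g = f + - g" for f g :: "'a l2"

definition scaleR_l2 :: "real \<Rightarrow> 'a l2 \<Rightarrow> 'a l2" where "r *\<^sub>R f = complex_of_real r *\<^sub>C f"

instance
proof
  fix f g h :: "'a l2" and r s :: real
  show "f + g + h = f + (g + h)"
    by transfer (auto simp: l2_rel_def add.assoc intro!: sq_integrable_add)
  show "f + g = g + f"
    by transfer (auto simp: l2_rel_def add.commute intro!: sq_integrable_add)
  show "0 + f = f"
    by transfer (auto simp: l2_rel_def)
  show "- f + f = 0"
    unfolding uminus_l2_def
    by transfer (auto simp: l2_rel_def sq_integrable_zero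
         intro!: sq_integrable_add[of "\<lambda>x. - _ x", simplified] sq_integrable_cmult[of _ "-1", simplified])
  show "f - g = f + - g" by (simp add: minus_l2_def)
  show "r *\<^sub>R (f + g) = r *\<^sub>R f + r *\<^sub>R g"
    unfolding scaleR_l2_def
    by transfer (auto simp: l2_rel_def distrib_left
          intro!: sq_integrable_add sq_integrable_cmult)
  show "(r + s) *\<^sub>R f = r *\<^sub>R f + s *\<^sub>R f"
    unfolding scaleR_l2_def
    by transfer (auto simp: l2_rel_def distrib_right
          intro!: sq_integrable_add sq_integrable_cmult)
  show "r *\<^sub>R s *\<^sub>R f = (r * s) *\<^sub>R f"
    unfolding scaleR_l2_def
    by transfer (auto simp: l2_rel_def mult.assoc intro!: sq_integrable_cmult)
  show "1 *\<^sub>R f = f"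
    unfolding scaleR_l2_def by transfer (auto simp: l2_rel_def)
qed

end

instantiation l2 :: (euclidean_space) real_inner
begin

definition inner_l2 :: "'a l2 \<Rightarrow> 'a l2 \<Rightarrow> real" where "inner f g = Re (cinner f g)"

definition norm_l2 :: "'a l2 \<Rightarrow> real" where "norm f = sqrt (inner f f)" for f :: "'a l2"

definition sgn_l2 :: "'a l2 \<Rightarrow> 'a l2" where "sgn f = f /\<^sub>R norm f" for f :: "'a l2"

definition dist_l2 :: "'a l2 \<Rightarrow> 'a l2 \<Rightarrow> real" where "dist f g = norm (f - g)" for f g :: "'a l2"

definition uniformity_l2 :: "('a l2 \<times> 'a l2) filter" where
  "uniformity_l2 = (INF e\<in>{0<..}. principal {(f, g). dist f g < e})"

definition open_l2 :: "'a l2 set \<Rightarrow> bool" where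
  "open_l2 S = (\<forall>f\<in>S. \<forall>\<^sub>F (f', g) in uniformity. f' = f \<longrightarrow> g \<in> S)"

instance
proof
  fix f g :: "'a l2"
  show "dist f g = norm (f - g)" by (simp add: dist_l2_def)
  show "sgn f = f /\<^sub>R norm f" by (simp add: sgn_l2_def)
  show "uniformity = (INF e\<in>{0<..}. principal {(f::'a l2, g). dist f g < e})"
    by (simp add: uniformity_l2_def)
  fix S :: "'a l2 set"
  show "open S = (\<forall>f\<in>S. \<forall>\<^sub>F (f', g) in uniformity. f' = f \<longrightarrow> g \<in> S)"
    by (simp add: open_l2_def)
next
  fix f g h :: "'a l2" and r :: real
  show "inner f g = inner g f"
    unfolding inner_l2_def
  proof transfer
    fix f g :: "'a \<Rightarrow> complex"
    assume "l2_rel f f" "l2_rel g g"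
    then have "sq_integrable f" "sq_integrable g" by (auto simp: l2_rel_def)
    then have "integrable lebesgue (\<lambda>x. cnj (f x) * g x)" "integrable lebesgue (\<lambda>x. cnj (g x) * f x)"
      by (auto intro: sq_integrable_cnj_mult)
    then show "Re (\<integral>x. cnj (f x) * g x \<partial>lebesgue) = Re (\<integral>x. cnj (g x) * f x \<partial>lebesgue)"
      by (simp flip: integral_Re add: mult.commute)
  qed
  show "inner (f + g) h = inner f h + inner g h"
    unfolding inner_l2_def
    by transfer (auto simp: l2_rel_def distrib_right sq_integrable_cnj_mult)
  show "inner (r *\<^sub>R f) g = r * inner f g"
    unfolding inner_l2_def scaleR_l2_def
    by transfer (auto simp: l2_rel_def mult.assoc sq_integrable_cnj_mult)
  show "0 \<le> inner f f"
    unfolding inner_l2_def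
  proof transfer
    fix f :: "'a \<Rightarrow> complex"
    assume "l2_rel f f"
    then have "sq_integrable f" by (auto simp: l2_rel_def)
    then have "integrable lebesgue (\<lambda>x. cnj (f x) * f x)" by (auto intro: sq_integrable_cnj_mult)
    then show "0 \<le> Re (\<integral>x. cnj (f x) * f x \<partial>lebesgue)"
      by (simp flip: integral_Re)
  qed
  show "inner f f = 0 \<longleftrightarrow> f = 0"
    unfolding inner_l2_def
  proof transfer
    fix f :: "'a \<Rightarrow> complex"
    assume "l2_rel f f"
    then have f: "sq_integrable f" by (auto simp: l2_rel_def)
    then have i: "integrable lebesgue (\<lambda>x. cnj (f x) * f x)" by (auto intro: sq_integrable_cnj_mult)
    have eq: "Re (cnj (f x) * f x) = (cmod (f x))\<^sup>2" for x
      by (simp add: cmod_power2) (simp add: power2_eq_square)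
    have "Re (\<integral>x. cnj (f x) * f x \<partial>lebesgue) = (\<integral>x. (cmod (f x))\<^sup>2 \<partial>lebesgue)"
      using i by (simp only: eq flip: integral_Re)
    also have "\<dots> = 0 \<longleftrightarrow> (AE x in lebesgue. (cmod (f x))\<^sup>2 = 0)"
      using f by (intro integral_nonneg_eq_0_iff_AE) (auto simp: sq_integrable_def)
    finally show "Re (\<integral>x. cnj (f x) * f x \<partial>lebesgue) = 0 \<longleftrightarrow> l2_rel f (\<lambda>x. 0)"
      using f by (simp add: l2_rel_def sq_integrable_zero)
  qed
  show "norm f = sqrt (inner f f)" by (simp add: norm_l2_def)
qed

end

text \<open>\<open>L2 A\<close> is $L^2(A)$, its elements being extended by zero to the whole Euclidean space.\<close>

definition L2 :: "'a::euclidean_space set \<Rightarrow> 'a l2 set" where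
  "L2 A = {f. AE x in lebesgue. x \<notin> A \<longrightarrow> rep_l2 f x = 0}"

section \<open>Operators in a closed subspace \<open>K\<close> of \<open>'a l2\<close>\<close>

definition csubspace :: "'a::euclidean_space l2 set \<Rightarrow> bool" where
  "csubspace S \<longleftrightarrow>
     0 \<in> S \<and> (\<forall>f\<in>S. \<forall>g\<in>S. f + g \<in> S) \<and> (\<forall>c. \<forall>f\<in>S. c *\<^sub>C f \<in> S)"

text \<open>Everywhere defined operators are functions; only their values on \<open>K\<close> matter.\<close>

definition bounded_op :: "'a::euclidean_space l2 set \<Rightarrow> ('a l2 \<Rightarrow> 'a l2) \<Rightarrow> bool" where
  "bounded_op K T \<longleftrightarrow>
     (\<forall>f\<in>K. T f \<in> K) \<and>
     (\<forall>f\<in>K. \<forall>g\<in>K. T (f + g) = T f + T g) \<and>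
     (\<forall>c. \<forall>f\<in>K. T (c *\<^sub>C f) = c *\<^sub>C T f) \<and>
     (\<exists>B. \<forall>f\<in>K. norm (T f) \<le> B * norm f)"

definition invertible_op :: "'a::euclidean_space l2 set \<Rightarrow> ('a l2 \<Rightarrow> 'a l2) \<Rightarrow> bool" where
  "invertible_op K T \<longleftrightarrow>
     bounded_op K T \<and> bij_betw T K K \<and> bounded_op K (inv_into K T)"

definition unitary_op :: "'a::euclidean_space l2 set \<Rightarrow> ('a l2 \<Rightarrow> 'a l2) \<Rightarrow> bool" where
  "unitary_op K V \<longleftrightarrow>
     bounded_op K V \<and> V ` K = K \<and> (\<forall>f\<in>K. \<forall>g\<in>K. cinner (V f) (V g) = cinner f g)"

definition partial_isometry_op :: "'a::euclidean_space l2 set \<Rightarrow> ('a l2 \<Rightarrow> 'a l2) \<Rightarrow> bool" where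
  "partial_isometry_op K U \<longleftrightarrow>
     bounded_op K U \<and>
     (\<forall>f\<in>K. (\<forall>k\<in>K. U k = 0 \<longrightarrow> cinner k f = 0) \<longrightarrow> norm (U f) = norm f)"

text \<open>Unbounded operators are given by their graphs.\<close>

definition operator_graph :: "'a::euclidean_space l2 set \<Rightarrow> ('a l2 \<times> 'a l2) set \<Rightarrow> bool" where
  "operator_graph K G \<longleftrightarrow>
     G \<subseteq> K \<times> K \<and> single_valued G \<and> (0, 0) \<in> G \<and>
     (\<forall>(f, f')\<in>G. \<forall>(g, g')\<in>G. (f + g, f' + g') \<in> G) \<and>
     (\<forall>c. \<forall>(f, f')\<in>G. (c *\<^sub>C f, c *\<^sub>C f') \<in> G)"

definition densely_defined :: "'a::euclidean_space l2 set \<Rightarrow> ('a l2 \<times> 'a l2) set \<Rightarrow> bool" where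
  "densely_defined K G \<longleftrightarrow> K \<subseteq> closure (Domain G)"

definition adjoint_graph ::
    "'a::euclidean_space l2 set \<Rightarrow> ('a l2 \<times> 'a l2) set \<Rightarrow> ('a l2 \<times> 'a l2) set" where
  "adjoint_graph K G =
     {(g, g'). g \<in> K \<and> g' \<in> K \<and> (\<forall>(f, f')\<in>G. cinner g f' = cinner g' f)}"

definition symmetric_op :: "'a::euclidean_space l2 set \<Rightarrow> ('a l2 \<times> 'a l2) set \<Rightarrow> bool" where
  "symmetric_op K G \<longleftrightarrow>
     operator_graph K G \<and> densely_defined K G \<and> G \<subseteq> adjoint_graph K G"

definition self_adjoint_op :: "'a::euclidean_space l2 set \<Rightarrow> ('a l2 \<times> 'a l2) set \<Rightarrow> bool" where
  "self_adjoint_op K G \<longleftrightarrow>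
     operator_graph K G \<and> densely_defined K G \<and> G = adjoint_graph K G"

definition is_core :: "'a::euclidean_space l2 set \<Rightarrow> ('a l2 \<times> 'a l2) set \<Rightarrow> bool" where
  "is_core D G \<longleftrightarrow> csubspace D \<and> D \<subseteq> Domain G \<and> G = closure (G \<inter> D \<times> UNIV)"

section \<open>The operator of differentiation in the first variable\<close>

abbreviation cyl :: "'b set \<Rightarrow> (real \<times> 'b) set" where
  "cyl \<Omega> \<equiv> {0<..<1} \<times> \<Omega>"

text \<open>Elements of $C_c^\infty((0,1))$, extended by zero; the \<open>\<Psi> n\<close> are the iterated derivatives.\<close>

definition test_fun :: "(real \<Rightarrow> complex) \<Rightarrow> bool" where
  "test_fun \<psi> \<longleftrightarrow>
     (\<exists>\<Psi>. \<Psi> 0 = \<psi> \<and> (\<forall>n x. (\<Psi> n has_vector_derivative \<Psi> (Suc n) x) (at x))) \<and>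
     (\<exists>a b. 0 < a \<and> b < 1 \<and> (\<forall>x. x \<notin> {a..b} \<longrightarrow> \<psi> x = 0))"

definition d1 :: "(real \<times> 'b \<Rightarrow> complex) \<Rightarrow> real \<times> 'b \<Rightarrow> complex" where
  "d1 \<phi> = (\<lambda>(x, y). vector_derivative (\<lambda>t. \<phi> (t, y)) (at x))"

text \<open>
  The functions in $\mathcal D$, extended by zero. Smoothness of all the slices
  $\varphi(\cdot,y)$ does not give $\partial\varphi/\partial x_1\in L^2$ (the derivatives may grow
  with $y$), so the last condition is part of the domain of an operator in $L^2$.
\<close>

definition dom_fun :: "'b::euclidean_space set \<Rightarrow> (real \<times> 'b \<Rightarrow> complex) \<Rightarrow> bool" where
  "dom_fun \<Omega> \<phi> \<longleftrightarrow>
     sq_integrable \<phi> \<and> (\<forall>x y. y \<notin> \<Omega> \<longrightarrow> \<phi> (x, y) = 0) \<and>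
     (\<forall>y\<in>\<Omega>. test_fun (\<lambda>x. \<phi> (x, y))) \<and> sq_integrable (d1 \<phi>)"

text \<open>The graphs of $\partial/\partial x_1$ and of $\frac1i\,\partial/\partial x_1$ on $\mathcal D$.\<close>

definition D1 :: "'b::euclidean_space set \<Rightarrow> ((real \<times> 'b) l2 \<times> (real \<times> 'b) l2) set" where
  "D1 \<Omega> = {(abs_l2 \<phi>, abs_l2 (d1 \<phi>)) | \<phi>. dom_fun \<Omega> \<phi>}"

definition S_op :: "'b::euclidean_space set \<Rightarrow> ((real \<times> 'b) l2 \<times> (real \<times> 'b) l2) set" where
  "S_op \<Omega> = {(f, (1 / \<i>) *\<^sub>C f') | f f'. (f, f') \<in> D1 \<Omega>}"

section \<open>The extensions\<close>

text \<open>The class of $(x,y)\mapsto u(x)h(y)$ on $(0,1)\times\Omega$, for \<open>h \<in> L2 \<Omega>\<close>.\<close>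

definition tens :: "(real \<Rightarrow> real) \<Rightarrow> 'b::euclidean_space l2 \<Rightarrow> (real \<times> 'b) l2" where
  "tens u h = abs_l2 (\<lambda>(x, y). if x \<in> {0<..<1} then of_real (u x) * rep_l2 h y else 0)"

definition core_elem ::
    "('b::euclidean_space l2 \<Rightarrow> 'b l2) \<Rightarrow> (real \<times> 'b) l2 \<Rightarrow> 'b l2 \<Rightarrow> (real \<times> 'b) l2" where
  "core_elem V \<phi> h = \<phi> + tens exp h + tens (\<lambda>x. exp (1 - x)) (V h)"

definition core_dom :: "'b::euclidean_space set \<Rightarrow> ('b l2 \<Rightarrow> 'b l2) \<Rightarrow> (real \<times> 'b) l2 set" where
  "core_dom \<Omega> V = {core_elem V \<phi> h | \<phi> h. \<phi> \<in> Domain (D1 \<Omega>) \<and> h \<in> L2 \<Omega>}"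

definition is_extension ::
    "'b::euclidean_space set \<Rightarrow> ('b l2 \<Rightarrow> 'b l2) \<Rightarrow> ((real \<times> 'b) l2 \<times> (real \<times> 'b) l2) set \<Rightarrow> bool"
  where
  "is_extension \<Omega> V H \<longleftrightarrow>
     self_adjoint_op (L2 (cyl \<Omega>)) H \<and> S_op \<Omega> \<subseteq> H \<and> is_core (core_dom \<Omega> V) H \<and>
     (\<forall>(\<phi>, \<phi>')\<in>D1 \<Omega>. \<forall>h\<in>L2 \<Omega>. \<exists>g.
        (core_elem V \<phi> h, g) \<in> H \<and>
        \<i> *\<^sub>C g = \<phi>' + tens exp h - tens (\<lambda>x. exp (1 - x)) (V h))"

text \<open>
  \<open>has_trace \<Omega> f c g\<close>: $f(c,\cdot)=g$ for $c\in\{0,1\}$, the values being those of a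
  representative of $f$ that is continuous in $x_1\in[0,1]$ for almost every $y$.
\<close>

definition has_trace ::
    "'b::euclidean_space set \<Rightarrow> (real \<times> 'b) l2 \<Rightarrow> real \<Rightarrow> 'b l2 \<Rightarrow> bool" where
  "has_trace \<Omega> f c g \<longleftrightarrow> g \<in> L2 \<Omega> \<and>
     (\<exists>F. (AE z in lebesgue. z \<in> cyl \<Omega> \<longrightarrow> F z = rep_l2 f z) \<and>
          (AE y in lebesgue. y \<in> \<Omega> \<longrightarrow>
             continuous_on {0..1} (\<lambda>x. F (x, y)) \<and> F (c, y) = rep_l2 g y))"

definition boundary_condition ::
    "'b::euclidean_space set \<Rightarrow> ('b l2 \<Rightarrow> 'b l2) \<Rightarrow> (real \<times> 'b) l2 \<Rightarrow> bool" where
  "boundary_condition \<Omega> U f \<longleftrightarrow> (\<exists>g. has_trace \<Omega> f 0 g \<and> has_trace \<Omega> f 1 (U g))"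

text \<open>\<open>W_op \<Omega> V\<close> is $(eI+V)(I+eV)^{-1}$ and \<open>V_op \<Omega> W\<close> is $(I-eW)^{-1}(W-eI)$ on $L^2(\Omega)$.\<close>

definition W_op :: "'b::euclidean_space set \<Rightarrow> ('b l2 \<Rightarrow> 'b l2) \<Rightarrow> 'b l2 \<Rightarrow> 'b l2" where
  "W_op \<Omega> V = (\<lambda>h. exp 1 *\<^sub>R h + V h) \<circ> inv_into (L2 \<Omega>) (\<lambda>h. h + exp 1 *\<^sub>R V h)"

definition V_op :: "'b::euclidean_space set \<Rightarrow> ('b l2 \<Rightarrow> 'b l2) \<Rightarrow> 'b l2 \<Rightarrow> 'b l2" where
  "V_op \<Omega> W = inv_into (L2 \<Omega>) (\<lambda>h. h - exp 1 *\<^sub>R W h) \<circ> (\<lambda>h. W h - exp 1 *\<^sub>R h)"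

text \<open>
  The boundary operator. The printed formula is $U_V=\exp W_V$, which contradicts the boundary
  condition $f(1,\cdot)=U_V f(0,\cdot)$: an element $f=\varphi+e^{x_1}h+e^{1-x_1}Vh$ of the core has
  $f(0,\cdot)=(I+eV)h$ and $f(1,\cdot)=(eI+V)h$, so $f(1,\cdot)=W_V f(0,\cdot)$. (For $V=I$ one has
  $W_V=I$ and $f(0,\cdot)=f(1,\cdot)$, whereas $\exp W_V=eI$.) The exponential is therefore omitted.
\<close>

definition U_op :: "'b::euclidean_space set \<Rightarrow> ('b l2 \<Rightarrow> 'b l2) \<Rightarrow> 'b l2 \<Rightarrow> 'b l2" where
  "U_op \<Omega> V = W_op \<Omega> V"

end

theory Submission
  imports Defs
begin

text \<open>
  With $B=iH$, self-adjointness of $H$ becomes $B=-B^*$, and $-B^*$ is the annihilator of $B$ under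
  the form $\langle f,g'\rangle+\langle f',g\rangle$ on pairs $(f,f')$. The annihilator of the graph
  of $\partial/\partial x_1$ on $\mathcal D$ decomposes, by projection onto the closure of that graph in
  the direct sum of two copies of $L^2$, into this closure and the pairs
  $(e^{x_1}h+e^{1-x_1}k,\,e^{x_1}h-e^{1-x_1}k)$, because the solutions of $g'=\pm g$ in the weak sense
  are $e^{\pm x_1}h(y)$. The form vanishes on the closure and equals
  $(e^2-1)(\langle h,h'\rangle-\langle k,k'\rangle)$ on the remaining pairs. Hence the graphs equal to
  their own annihilator correspond to the maximal isometric relations between $h$ and $k$, which are
  the graphs of the unitary operators on $L^2(\Omega_2)$.
\<close>

section \<open>Algebra and continuity of the inner product\<close>

text \<open>The second exponential is normalised as \<open>exp (1 - x)\<close> so that its square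
  has the same integral (e^2 - 1)/2 over (0,1) as the square of \<open>exp\<close>; with equal
  weights the vanishing of the form is exactly the isometry condition between h and k. The main
  obstacle is the weak equation in two variables. Pairing with products u(x)k(y) reduces it to one
  variable, where the du Bois-Reymond argument applies: a test function of integral 0 is the
  derivative of a test function. Finiteness of the measure of \<Omega> puts the indicators of its
  measurable subsets into L^2, and this makes such products rich enough to detect 0. Projections
  need completeness of the quotient \<open>l2\<close>, that is, the Riesz-Fischer theorem. On pairs
  only the real inner product is at hand; testing also against i times a pair recovers complex
  orthogonality. The boundary operator comes from evaluating core elements at x = 0 and x = 1, where
  functions of D vanish. What remains is algebra with I + eV, which is invertible because V is
  unitary and e > 1.\<close>

lemma sq_integrable_rep: "sq_integrable (rep_l2 f)"
  using Quotient3_rep_reflp[OF Quotient3_l2, of f] by (simp add: l2_rel_def)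

lemma abs_rep_l2: "abs_l2 (rep_l2 f) = f"
  using Quotient3_abs_rep[OF Quotient3_l2] .

lemma abs_l2_eq_iff:
  assumes "sq_integrable f" "sq_integrable g"
  shows "abs_l2 f = abs_l2 g \<longleftrightarrow> (AE x in lebesgue. f x = g x)"
  using Quotient3_rel[OF Quotient3_l2, of f g] assms by (auto simp: l2_rel_def)

lemma rep_abs_l2_AE:
  assumes "sq_integrable f"
  shows "AE x in lebesgue. rep_l2 (abs_l2 f) x = f x"
  using abs_l2_eq_iff[OF sq_integrable_rep assms] abs_rep_l2 by blast

lemma l2_eqI:
  assumes "AE x in lebesgue. rep_l2 f x = rep_l2 g x"
  shows "f = g"
  using abs_l2_eq_iff[OF sq_integrable_rep sq_integrable_rep] abs_rep_l2 assms by metis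

lemma abs_l2_add:
  assumes "sq_integrable f" "sq_integrable g"
  shows "abs_l2 f + abs_l2 g = abs_l2 (\<lambda>x. f x + g x)"
  using assms by (simp add: plus_l2.abs_eq l2_rel_def)

lemma abs_l2_scaleC:
  assumes "sq_integrable f"
  shows "c *\<^sub>C abs_l2 f = abs_l2 (\<lambda>x. c * f x)"
  using assms by (simp add: scaleC.abs_eq l2_rel_def)

lemma cinner_abs_l2:
  assumes "sq_integrable f" "sq_integrable g"
  shows "cinner (abs_l2 f) (abs_l2 g) = (\<integral>x. cnj (f x) * g x \<partial>lebesgue)"
  using assms by (simp add: cinner.abs_eq l2_rel_def)

lemma abs_l2_zero: "abs_l2 (\<lambda>x. 0) = 0"
  by (simp add: zero_l2_def)

text \<open>Representatives are chosen arbitrarily, so algebraic laws hold for them only almost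
  everywhere. Identities in \<open>l2\<close> are proved later by combining facts of this kind
  pointwise and concluding with \<open>l2_eqI\<close>.\<close>

lemma rep_l2_add_AE: "AE x in lebesgue. rep_l2 (f + g) x = rep_l2 f x + rep_l2 g x"
  using rep_abs_l2_AE[OF sq_integrable_add[OF sq_integrable_rep[of f] sq_integrable_rep[of g]]]
  by (simp add: abs_l2_add[symmetric] sq_integrable_rep abs_rep_l2)

lemma rep_l2_scaleC_AE: "AE x in lebesgue. rep_l2 (c *\<^sub>C f) x = c * rep_l2 f x"
  using rep_abs_l2_AE[OF sq_integrable_cmult[OF sq_integrable_rep[of f]]]
  by (simp add: abs_l2_scaleC[symmetric] sq_integrable_rep abs_rep_l2)

lemma rep_l2_zero_AE: "AE x in lebesgue. rep_l2 0 x = 0"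
  using rep_abs_l2_AE[OF sq_integrable_zero] by (simp add: abs_l2_zero)

lemma scaleC_add_right: "c *\<^sub>C (f + g) = c *\<^sub>C f + c *\<^sub>C g"
  by transfer (auto simp: l2_rel_def distrib_left intro!: sq_integrable_add sq_integrable_cmult)

lemma scaleC_add_left: "(c + d) *\<^sub>C f = c *\<^sub>C f + d *\<^sub>C f"
  by transfer (auto simp: l2_rel_def distrib_right intro!: sq_integrable_add sq_integrable_cmult)

lemma scaleC_scaleC [simp]: "c *\<^sub>C d *\<^sub>C f = (c * d) *\<^sub>C f"
  by transfer (auto simp: l2_rel_def mult.assoc intro!: sq_integrable_cmult)

lemma scaleC_one [simp]: "1 *\<^sub>C f = f"
  by transfer (auto simp: l2_rel_def)

lemma scaleC_minus_one: "(- 1) *\<^sub>C f = - f"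
  by (simp add: uminus_l2_def)

lemma scaleC_zero_right [simp]: "c *\<^sub>C 0 = 0"
  using scaleC_add_right[of c 0 0] by simp

lemma scaleC_minus_right: "c *\<^sub>C (- f) = - (c *\<^sub>C f)"
  by (simp add: uminus_l2_def mult.commute)

lemma scaleC_diff_right: "c *\<^sub>C (f - g) = c *\<^sub>C f - c *\<^sub>C g"
  using scaleC_add_right[of c f "- g"] by (simp add: scaleC_minus_right)

lemma cinner_commute: "cinner f g = cnj (cinner g f)"
proof transfer
  fix f g :: "'a \<Rightarrow> complex"
  show "(\<integral>x. cnj (f x) * g x \<partial>lebesgue) = cnj (\<integral>x. cnj (g x) * f x \<partial>lebesgue)"
    unfolding Bochner_Integration.integral_cnj[symmetric] by (simp add: mult.commute)
qed

lemma cinner_add_left: "cinner (f + g) h = cinner f h + cinner g h"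
  by transfer (auto simp: l2_rel_def distrib_right sq_integrable_cnj_mult)

lemma cinner_scaleC_left: "cinner (c *\<^sub>C f) g = cnj c * cinner f g"
  by transfer (auto simp: l2_rel_def mult.assoc sq_integrable_cnj_mult)

lemma cinner_add_right: "cinner h (f + g) = cinner h f + cinner h g"
  using cinner_add_left[of f g h] by (metis cinner_commute complex_cnj_add)

lemma cinner_scaleC_right: "cinner g (c *\<^sub>C f) = c * cinner g f"
  using cinner_scaleC_left[of c f g] by (metis cinner_commute complex_cnj_mult complex_cnj_cnj)

lemma cinner_minus_left: "cinner (- f) g = - cinner f g"
  using cinner_scaleC_left[of "- 1" f g] by (simp add: scaleC_minus_one)

lemma cinner_minus_right: "cinner g (- f) = - cinner g f"
  using cinner_scaleC_right[of g "- 1" f] by (simp add: scaleC_minus_one)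

lemma cinner_diff_left: "cinner (f - g) h = cinner f h - cinner g h"
  using cinner_add_left[of f "- g" h] by (simp add: cinner_minus_left)

lemma cinner_diff_right: "cinner h (f - g) = cinner h f - cinner h g"
  using cinner_add_right[of h f "- g"] by (simp add: cinner_minus_right)

lemma cinner_zero_left [simp]: "cinner 0 f = 0"
  using cinner_add_left[of 0 0 f] by simp

lemma cinner_zero_right [simp]: "cinner f 0 = 0"
  using cinner_add_right[of f 0 0] by simp

lemmas cinner_simps = cinner_add_left cinner_add_right cinner_scaleC_left cinner_scaleC_right
  cinner_minus_left cinner_minus_right cinner_diff_left cinner_diff_right

text \<open>Reduces continuity of the complex inner product to that of the real one: multiplying the
  first argument by i moves the imaginary part into the real part.\<close>

lemma cinner_eq_inner: "cinner f g = Complex (inner f g) (inner (\<i> *\<^sub>C f) g)"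
  by (simp add: inner_l2_def cinner_scaleC_left complex_eq_iff)

lemma cinner_self: "cinner f f = complex_of_real ((norm f)\<^sup>2)"
proof -
  have "Im (cinner f f) = 0"
    using cinner_commute[of f f] by (simp add: complex_eq_iff)
  moreover have "Re (cinner f f) = (norm f)\<^sup>2"
    by (simp add: power2_norm_eq_inner inner_l2_def)
  ultimately show ?thesis by (simp add: complex_eq_iff)
qed

lemma cinner_self_eq_0 [simp]: "cinner f f = 0 \<longleftrightarrow> f = 0"
  by (simp add: cinner_self)

lemma scaleR_eq_scaleC: "r *\<^sub>R f = complex_of_real r *\<^sub>C f" for f :: "'a::euclidean_space l2"
  by (simp add: scaleR_l2_def)

lemma norm_scaleC: "norm (c *\<^sub>C f) = cmod c * norm f"
proof -
  have "complex_of_real ((norm (c *\<^sub>C f))\<^sup>2) = cinner (c *\<^sub>C f) (c *\<^sub>C f)"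
    by (rule cinner_self[symmetric])
  also have "\<dots> = (cnj c * c) * cinner f f"
    by (simp add: cinner_simps)
  also have "\<dots> = complex_of_real ((cmod c * norm f)\<^sup>2)"
    unfolding cinner_self
    by (simp only: mult.commute[of "cnj c"] complex_norm_square[symmetric] power_mult_distrib of_real_mult)
  finally have "(norm (c *\<^sub>C f))\<^sup>2 = (cmod c * norm f)\<^sup>2"
    using of_real_eq_iff by blast
  then show ?thesis by (simp add: power2_eq_iff_nonneg)
qed

lemma tendsto_scaleC [tendsto_intros]:
  assumes "(f \<longlongrightarrow> a) F"
  shows "((\<lambda>x. c *\<^sub>C f x) \<longlongrightarrow> c *\<^sub>C a) F"
proof -
  have "((\<lambda>x. cmod c * norm (f x - a)) \<longlongrightarrow> cmod c * 0) F"
    using assms by (intro tendsto_mult tendsto_const) (simp add: tendsto_norm_zero_iff LIM_zero_iff)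
  then have "((\<lambda>x. norm (c *\<^sub>C f x - c *\<^sub>C a)) \<longlongrightarrow> 0) F"
    by (simp add: norm_scaleC flip: scaleC_diff_right)
  then show ?thesis
    by (simp add: tendsto_norm_zero_iff LIM_zero_iff)
qed

lemma continuous_on_scaleC [continuous_intros]:
  "continuous_on S f \<Longrightarrow> continuous_on S (\<lambda>x. c *\<^sub>C f x)"
  unfolding continuous_on_def by (auto intro: tendsto_scaleC)

lemma tendsto_cinner [tendsto_intros]:
  assumes "(f \<longlongrightarrow> a) F" "(g \<longlongrightarrow> b) F"
  shows "((\<lambda>x. cinner (f x) (g x)) \<longlongrightarrow> cinner a b) F"
  unfolding cinner_eq_inner using assms by (intro tendsto_intros)

lemma continuous_on_cinner [continuous_intros]:
  "continuous_on S f \<Longrightarrow> continuous_on S g \<Longrightarrow> continuous_on S (\<lambda>x. cinner (f x) (g x))"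
  unfolding continuous_on_def by (auto intro: tendsto_cinner)

lemma norm_abs_l2:
  assumes "sq_integrable f"
  shows "(norm (abs_l2 f))\<^sup>2 = (\<integral>x. (cmod (f x))\<^sup>2 \<partial>lebesgue)"
proof -
  have eq: "cnj (f x) * f x = complex_of_real ((cmod (f x))\<^sup>2)" for x
    by (simp only: mult.commute[of "cnj _"] complex_norm_square)
  have "complex_of_real ((norm (abs_l2 f))\<^sup>2) = complex_of_real (\<integral>x. (cmod (f x))\<^sup>2 \<partial>lebesgue)"
    unfolding cinner_self[symmetric] cinner_abs_l2[OF assms assms] eq integral_complex_of_real ..
  then show ?thesis using of_real_eq_iff by blast
qed

lemma csubspace_diff: "csubspace S \<Longrightarrow> f \<in> S \<Longrightarrow> g \<in> S \<Longrightarrow> f - g \<in> S"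
  unfolding csubspace_def by (metis diff_conv_add_uminus uminus_l2_def)

lemma csubspace_imp_subspace: "csubspace S \<Longrightarrow> subspace S"
  by (auto simp: csubspace_def subspace_def scaleR_eq_scaleC)

section \<open>Completeness and orthogonal projection\<close>

lemma nn_integral_abs_l2:
  assumes "sq_integrable f"
  shows "(\<integral>\<^sup>+x. ennreal ((cmod (f x))\<^sup>2) \<partial>lebesgue) = ennreal ((norm (abs_l2 f))\<^sup>2)"
  using assms unfolding norm_abs_l2[OF assms]
  by (intro nn_integral_eq_integral) (auto simp: sq_integrable_def)

lemma sq_integrable_nn_integralI:
  assumes "f \<in> borel_measurable lebesgue" "(\<integral>\<^sup>+x. ennreal ((cmod (f x))\<^sup>2) \<partial>lebesgue) \<noteq> \<infinity>"
  shows "sq_integrable f"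
  unfolding sq_integrable_def integrable_iff_bounded
  using assms by (auto simp: less_top)

lemma sq_integrable_diff:
  assumes "sq_integrable f" "sq_integrable g"
  shows "sq_integrable (\<lambda>x. f x - g x)"
  using sq_integrable_add[OF assms(1) sq_integrable_cmult[OF assms(2), of "- 1"]] by simp

lemma abs_l2_diff:
  assumes "sq_integrable f" "sq_integrable g"
  shows "abs_l2 f - abs_l2 g = abs_l2 (\<lambda>x. f x - g x)"
  using abs_l2_add[OF assms(1) sq_integrable_cmult[OF assms(2), of "- 1"]]
  by (simp add: minus_l2_def uminus_l2_def abs_l2_scaleC assms)

lemma half_power_sq: "((1/2::real) ^ n)\<^sup>2 = (1/4) ^ n"
proof -
  have "((1/2::real) ^ n)\<^sup>2 = ((1/2)\<^sup>2) ^ n"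
    by (simp only: power_mult[symmetric] mult.commute[of n])
  moreover have "(1/2::real)\<^sup>2 = 1/4" by (simp add: power2_eq_square)
  ultimately show ?thesis by (simp only:)
qed

lemma Cauchy_fast_subseq:
  fixes X :: "nat \<Rightarrow> 'a::metric_space" and e :: "nat \<Rightarrow> real"
  assumes "Cauchy X" and "\<And>n. e n > 0"
  obtains r where "strict_mono r" "\<And>n m k. r n \<le> m \<Longrightarrow> r n \<le> k \<Longrightarrow> dist (X m) (X k) < e n"
proof -
  have "\<forall>n. \<exists>M. \<forall>m\<ge>M. \<forall>k\<ge>M. dist (X m) (X k) < e n"
    using assms unfolding Cauchy_def by blast
  then obtain N where N: "\<And>n m k. N n \<le> m \<Longrightarrow> N n \<le> k \<Longrightarrow> dist (X m) (X k) < e n"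
    by metis
  \<comment> \<open>The sum dominates \<open>N n\<close>, and the added \<open>n\<close> makes the
    indices strictly increasing.\<close>
  define r where "r n = (\<Sum>i\<le>n. N i) + n" for n
  have "strict_mono r" by (rule strict_monoI_Suc) (simp add: r_def)
  moreover have "N n \<le> r n" for n
    unfolding r_def by (cases n) simp_all
  ultimately show thesis using that N by (meson le_trans)
qed

text \<open>Riesz-Fischer: along a fast subsequence the increments are absolutely summable almost
  everywhere, Fatou's lemma turns the pointwise limit into an L^2 limit, and a Cauchy sequence
  follows its convergent subsequence.\<close>

lemma l2_Cauchy_convergent:
  fixes X :: "nat \<Rightarrow> 'a::euclidean_space l2"
  assumes "Cauchy X"
  shows "convergent X"
proof -
  have "\<And>n::nat. (0::real) < (1/2) ^ n" by simp
  then obtain r where r: "strict_mono r"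
    and rX: "\<And>n m k. r n \<le> m \<Longrightarrow> r n \<le> k \<Longrightarrow> dist (X m) (X k) < (1/2) ^ n"
    using Cauchy_fast_subseq[OF assms, of "\<lambda>n. (1/2) ^ n"] by metis
  define f where "f n = rep_l2 (X (r n))" for n
  have f: "sq_integrable (f n)" "abs_l2 (f n) = X (r n)" for n
    by (simp_all add: f_def sq_integrable_rep abs_rep_l2)
  have fm [measurable]: "f n \<in> borel_measurable lebesgue" for n
    using f(1) by (simp add: sq_integrable_def)
  have mono: "r n \<le> r m" if "n \<le> m" for n m
    using r that by (simp add: strict_mono_less_eq)
  have nn: "(\<integral>\<^sup>+x. ennreal ((cmod (f n x - f m x))\<^sup>2) \<partial>lebesgue) \<le> ennreal ((1/4) ^ n)"
    if "n \<le> m" for n m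
  proof -
    have "(norm (X (r n) - X (r m)))\<^sup>2 \<le> ((1/2) ^ n)\<^sup>2"
      using rX[of n "r n" "r m"] mono[OF that] by (intro power_mono) (auto simp: dist_norm)
    also have "((1/2) ^ n)\<^sup>2 = (1/4::real) ^ n"
      by (rule half_power_sq)
    finally show ?thesis
      by (simp add: nn_integral_abs_l2 sq_integrable_diff f flip: abs_l2_diff)
  qed
  define d where "d n x = f (Suc n) x - f n x" for n x
  \<comment> \<open>The weights \<open>2 ^ n\<close> make pointwise summability of \<open>d n\<close> follow from finiteness of one
    integral, since $|d_n| \le 2^{-n} + 2^n |d_n|^2$.\<close>
  have "(\<integral>\<^sup>+x. (\<Sum>n. ennreal (2 ^ n * (cmod (d n x))\<^sup>2)) \<partial>lebesgue)
      = (\<Sum>n. \<integral>\<^sup>+x. ennreal (2 ^ n * (cmod (d n x))\<^sup>2) \<partial>lebesgue)"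
    unfolding d_def by (rule nn_integral_suminf) measurable
  also have "\<dots> = (\<Sum>n. ennreal (2 ^ n) * (\<integral>\<^sup>+x. ennreal ((cmod (f n x - f (Suc n) x))\<^sup>2) \<partial>lebesgue))"
    unfolding d_def
    by (subst nn_integral_cmult[symmetric]) (auto simp: ennreal_mult norm_minus_commute)
  also have "\<dots> \<le> (\<Sum>n. ennreal (2 ^ n) * ennreal ((1/4) ^ n))"
    by (intro suminf_le mult_left_mono nn) auto
  also have "\<dots> = (\<Sum>n. ennreal ((1/2) ^ n))"
    by (simp flip: ennreal_mult power_mult_distrib)
  also have "\<dots> < \<infinity>"
    by (subst suminf_ennreal_eq[OF _ geometric_sums]) auto
  finally have "AE x in lebesgue. (\<Sum>n. ennreal (2 ^ n * (cmod (d n x))\<^sup>2)) \<noteq> \<infinity>"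
    by (intro nn_integral_PInf_AE) (auto simp: d_def)
  then have lim: "AE x in lebesgue. (\<lambda>n. f n x) \<longlonglongrightarrow> lim (\<lambda>n. f n x)"
  proof eventually_elim
    case (elim x)
    then have s: "summable (\<lambda>n. 2 ^ n * (cmod (d n x))\<^sup>2)"
      by (intro summable_suminf_not_top) auto
    have "summable (\<lambda>n. (1/2) ^ n + 2 ^ n * (cmod (d n x))\<^sup>2)"
      by (intro summable_add s summable_geometric) auto
    moreover have "cmod (d n x) \<le> (1/2) ^ n + 2 ^ n * (cmod (d n x))\<^sup>2" for n
    proof (cases "cmod (d n x) \<le> (1/2) ^ n")
      case True
      then show ?thesis by (simp add: add_increasing2)
    next
      case False
      then have "1 \<le> 2 ^ n * cmod (d n x)" by (simp add: power_divide field_simps)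
      then have "cmod (d n x) * 1 \<le> cmod (d n x) * (2 ^ n * cmod (d n x))"
        by (intro mult_left_mono) auto
      then show ?thesis
        by (simp add: power2_eq_square mult_ac add_increasing)
    qed
    ultimately have "summable (\<lambda>n. d n x)"
      by (intro summable_comparison_test[of "\<lambda>n. d n x"]) auto
    then obtain l where "(\<lambda>n. \<Sum>i<n. d i x) \<longlonglongrightarrow> l"
      unfolding summable_def sums_def by blast
    then have "(\<lambda>n. f n x - f 0 x) \<longlonglongrightarrow> l"
      by (simp add: d_def sum_lessThan_telescope[of "\<lambda>i. f i x"])
    then have "(\<lambda>n. f n x - f 0 x + f 0 x) \<longlonglongrightarrow> l + f 0 x"
      by (intro tendsto_intros)
    then show ?case by (simp add: convergentI convergent_LIMSEQ_iff[symmetric])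
  qed
  \<comment> \<open>Where the sequence diverges \<open>lim\<close> has an unspecified value, but
    this happens only on a null set.\<close>
  define g where "g x = lim (\<lambda>n. f n x)" for x
  have gm [measurable]: "g \<in> borel_measurable lebesgue"
    unfolding g_def by measurable
  have fg: "(\<integral>\<^sup>+x. ennreal ((cmod (f n x - g x))\<^sup>2) \<partial>lebesgue) \<le> ennreal ((1/4) ^ n)" for n
  proof -
    have "(\<integral>\<^sup>+x. ennreal ((cmod (f n x - g x))\<^sup>2) \<partial>lebesgue)
        = (\<integral>\<^sup>+x. liminf (\<lambda>m. ennreal ((cmod (f n x - f m x))\<^sup>2)) \<partial>lebesgue)"
      using lim
    proof (intro nn_integral_cong_AE, eventually_elim)
      case (elim x)
      then have "(\<lambda>m. ennreal ((cmod (f n x - f m x))\<^sup>2)) \<longlonglongrightarrow> ennreal ((cmod (f n x - g x))\<^sup>2)"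
        unfolding g_def by (intro tendsto_intros)
      then show ?case using lim_imp_Liminf[OF sequentially_bot] by metis
    qed
    also have "\<dots> \<le> liminf (\<lambda>m. \<integral>\<^sup>+x. ennreal ((cmod (f n x - f m x))\<^sup>2) \<partial>lebesgue)"
      by (rule nn_integral_liminf) measurable
    also have "\<dots> \<le> limsup (\<lambda>m. \<integral>\<^sup>+x. ennreal ((cmod (f n x - f m x))\<^sup>2) \<partial>lebesgue)"
      by (rule Liminf_le_Limsup) simp
    also have "\<dots> \<le> ennreal ((1/4) ^ n)"
      by (rule Limsup_bounded) (auto simp: eventually_sequentially intro!: exI[of _ n] nn)
    finally show ?thesis .
  qed
  have sfg: "sq_integrable (\<lambda>x. f n x - g x)" for n
    by (rule sq_integrable_nn_integralI) (use fg[of n] in \<open>auto simp: top_unique\<close>)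
  have g: "sq_integrable g"
    using sq_integrable_diff[OF f(1)[of 0] sfg[of 0]] by simp
  have "(norm (X (r n) - abs_l2 g))\<^sup>2 \<le> ((1/2) ^ n)\<^sup>2" for n
  proof -
    have "ennreal ((norm (X (r n) - abs_l2 g))\<^sup>2) \<le> ennreal ((1/4) ^ n)"
      using fg[of n] nn_integral_abs_l2[OF sfg[of n]] abs_l2_diff[OF f(1)[of n] g] f(2)[of n] by simp
    then show ?thesis by (simp add: half_power_sq)
  qed
  then have le: "norm (X (r n) - abs_l2 g) \<le> (1/2) ^ n" for n
    by (rule power2_le_imp_le) simp
  have "(\<lambda>n. X (r n) - abs_l2 g) \<longlonglongrightarrow> 0"
  proof (rule Lim_null_comparison)
    show "\<forall>\<^sub>F n in sequentially. norm (X (r n) - abs_l2 g) \<le> (1/2) ^ n"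
      by (intro always_eventually allI le)
    show "(\<lambda>n. (1/2::real) ^ n) \<longlonglongrightarrow> 0"
      by (rule LIMSEQ_power_zero) simp
  qed
  then have "(X \<circ> r) \<longlonglongrightarrow> abs_l2 g"
    by (simp add: LIM_zero_iff o_def)
  then have "X \<longlonglongrightarrow> abs_l2 g"
    by (rule Cauchy_converges_subseq[OF assms r])
  then show ?thesis by (rule convergentI)
qed

instance l2 :: (euclidean_space) banach
  by standard (rule l2_Cauchy_convergent)

text \<open>The minimising-sequence proof of the projection theorem. It is stated for every real
  Hilbert space because it serves both \<open>l2\<close> and the product of two copies of
  \<open>l2\<close>.\<close>

lemma subspace_proj_exists:
  fixes S :: "'a::{real_inner, banach} set"
  assumes "subspace S" "closed S"
  obtains p where "p \<in> S" "\<And>s. s \<in> S \<Longrightarrow> inner (x - p) s = 0"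
proof -
  define \<delta> where "\<delta> = (INF s\<in>S. (norm (x - s))\<^sup>2)"
  have bdd: "bdd_below ((\<lambda>s. (norm (x - s))\<^sup>2) ` S)" by (rule bdd_belowI[of _ 0]) auto
  have S0: "0 \<in> S" using assms(1) by (rule subspace_0)
  have low: "\<delta> \<le> (norm (x - s))\<^sup>2" if "s \<in> S" for s
    unfolding \<delta>_def using bdd that by (rule cINF_lower)
  have "\<exists>s\<in>S. (norm (x - s))\<^sup>2 < \<delta> + 1 / real (Suc n)" for n
  proof -
    have "Inf ((\<lambda>s. (norm (x - s))\<^sup>2) ` S) < \<delta> + 1 / real (Suc n)"
      unfolding \<delta>_def by simp
    from cInf_lessD[OF _ this] S0 show ?thesis by auto
  qed
  then obtain s where s: "\<And>n. s n \<in> S" "\<And>n. (norm (x - s n))\<^sup>2 < \<delta> + 1 / real (Suc n)"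
    by metis
  \<comment> \<open>Parallelogram law: the midpoint of \<open>s m\<close> and \<open>s n\<close>
    lies in \<open>S\<close>, so its squared distance from \<open>x\<close> is at least
    \<open>\<delta>\<close>.\<close>
  have par: "(norm (s m - s n))\<^sup>2 \<le> 2 / real (Suc m) + 2 / real (Suc n)" for m n
  proof -
    have "(1/2) *\<^sub>R (s m + s n) \<in> S"
      by (intro subspace_mul[OF assms(1)] subspace_add[OF assms(1)] s)
    note low[OF this]
    moreover have "(norm (s m - s n))\<^sup>2 + 4 * (norm (x - (1/2) *\<^sub>R (s m + s n)))\<^sup>2
        = 2 * (norm (x - s m))\<^sup>2 + 2 * (norm (x - s n))\<^sup>2"
      by (simp add: power2_norm_eq_inner inner_diff_left inner_diff_right inner_add_left inner_add_right
          inner_commute algebra_simps)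
    ultimately show ?thesis using s(2)[of m] s(2)[of n] by simp
  qed
  have "Cauchy s"
  proof (rule metric_CauchyI)
    fix e :: real assume e: "0 < e"
    obtain N where N: "4 / e\<^sup>2 < real N" using reals_Archimedean2 by blast
    have "dist (s m) (s n) < e" if mn: "m \<ge> N" "n \<ge> N" for m n
    proof -
      have N0: "0 < real N" using N e by (smt (verit) divide_nonneg_nonneg zero_le_power2)
      have "2 / real (Suc m) \<le> 2 / real N" "2 / real (Suc n) \<le> 2 / real N"
        using mn N0 by (auto intro!: divide_left_mono)
      then have "(norm (s m - s n))\<^sup>2 \<le> 4 / real N" using par[of m n] by simp
      also have "\<dots> < e\<^sup>2" using N N0 e by (simp add: field_simps)
      finally show ?thesis using e by (simp add: dist_norm power2_less_imp_less)
    qed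
    then show "\<exists>M. \<forall>m\<ge>M. \<forall>n\<ge>M. dist (s m) (s n) < e" by blast
  qed
  then obtain p where p: "s \<longlonglongrightarrow> p" using Cauchy_convergent convergentD by blast
  have pS: "p \<in> S" using assms(2) s(1) p by (auto simp: closed_sequential_limits)
  have "(\<lambda>n. \<delta> + 1 / real (Suc n)) \<longlonglongrightarrow> \<delta> + 0"
    by (intro tendsto_intros LIMSEQ_Suc[OF lim_1_over_n])
  then have b: "(\<lambda>n. \<delta> + 1 / real (Suc n)) \<longlonglongrightarrow> \<delta>" by simp
  have a: "(\<lambda>n. (norm (x - s n))\<^sup>2) \<longlonglongrightarrow> (norm (x - p))\<^sup>2"
    by (intro tendsto_intros p)
  have pd: "(norm (x - p))\<^sup>2 \<le> \<delta>"
    by (rule LIMSEQ_le[OF a b]) (intro exI[of _ 0] allI impI less_imp_le[OF s(2)])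
  have sq: "(norm (z - c *\<^sub>R t))\<^sup>2 = (norm z)\<^sup>2 - 2 * c * inner z t + c * c * inner t t" for z t :: 'a and c
    unfolding power2_norm_eq_inner by (simp add: inner_diff_left inner_diff_right inner_commute[of t z] algebra_simps)
  have "inner (x - p) t = 0" if t: "t \<in> S" for t
  proof (rule ccontr)
    assume ne: "inner (x - p) t \<noteq> 0"
    then have t0: "inner t t > 0" by auto
    \<comment> \<open>The minimum of the quadratic polynomial
      \<open>c \<mapsto> (norm (x - p - c *\<^sub>R t))\<^sup>2\<close>; moving \<open>p\<close> by
      this multiple of \<open>t\<close> would bring it strictly closer to \<open>x\<close>.\<close>
    define c where "c = inner (x - p) t / inner t t"
    have "p + c *\<^sub>R t \<in> S"
      by (intro subspace_mul[OF assms(1)] subspace_add[OF assms(1)] pS t)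
    from low[OF this] pd have "(norm (x - p))\<^sup>2 \<le> (norm (x - (p + c *\<^sub>R t)))\<^sup>2"
      by (rule order_trans[rotated])
    also have "x - (p + c *\<^sub>R t) = (x - p) - c *\<^sub>R t" by simp
    also have "(norm ((x - p) - c *\<^sub>R t))\<^sup>2 = (norm (x - p))\<^sup>2 - 2 * c * inner (x - p) t + c * c * inner t t"
      by (rule sq)
    also have "c * c * inner t t = c * inner (x - p) t"
      using t0 by (simp add: c_def)
    finally have "c * inner (x - p) t \<le> 0" by simp
    moreover have "c * inner (x - p) t = (inner (x - p) t)\<^sup>2 / inner t t"
      by (simp add: c_def power2_eq_square)
    moreover have "(inner (x - p) t)\<^sup>2 / inner t t > 0" using ne t0 by simp
    ultimately show False by simp
  qed
  then show thesis using that pS by blast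
qed

text \<open>A complex subspace contains \<open>\<i> *\<^sub>C g\<close> along with \<open>g\<close>,
  and real orthogonality to it is the vanishing of the imaginary part.\<close>

lemma csubspace_cinner_eq_0:
  assumes "csubspace S" "\<And>s. s \<in> S \<Longrightarrow> inner f s = 0" "g \<in> S"
  shows "cinner f g = 0"
proof -
  have "Re (cinner f g) = 0" using assms(2,3) by (simp add: inner_l2_def)
  moreover have "Re (cinner f (\<i> *\<^sub>C g)) = 0"
    using assms by (simp add: inner_l2_def csubspace_def)
  ultimately show ?thesis by (simp add: cinner_simps complex_eq_iff)
qed

lemma csubspace_proj_exists:
  assumes "csubspace S" "closed S"
  obtains p where "p \<in> S" "\<And>s. s \<in> S \<Longrightarrow> cinner (f - p) s = 0"
proof -
  from subspace_proj_exists[OF csubspace_imp_subspace[OF assms(1)] assms(2)]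
  obtain p where "p \<in> S" "\<And>s. s \<in> S \<Longrightarrow> inner (f - p) s = 0" by blast
  then show thesis using that csubspace_cinner_eq_0[OF assms(1)] by blast
qed

lemma csubspace_closure:
  assumes "csubspace S"
  shows "csubspace (closure S)"
proof -
  have "f + g \<in> closure S" if fg: "f \<in> closure S" "g \<in> closure S" for f g
  proof -
    obtain a b where "\<And>n. a n \<in> S" "a \<longlonglongrightarrow> f" "\<And>n. b n \<in> S" "b \<longlonglongrightarrow> g"
      using fg unfolding closure_sequential by metis
    then show ?thesis unfolding closure_sequential
      using assms by (intro exI[of _ "\<lambda>n. a n + b n"]) (auto simp: csubspace_def intro: tendsto_add)
  qed
  moreover have "c *\<^sub>C f \<in> closure S" if f: "f \<in> closure S" for c f
  proof -
    obtain a where "\<And>n. a n \<in> S" "a \<longlonglongrightarrow> f"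
      using f unfolding closure_sequential by metis
    then show ?thesis unfolding closure_sequential
      using assms by (intro exI[of _ "\<lambda>n. c *\<^sub>C a n"]) (auto simp: csubspace_def intro: tendsto_scaleC)
  qed
  moreover have "0 \<in> closure S"
    using assms closure_subset unfolding csubspace_def by blast
  ultimately show ?thesis by (simp add: csubspace_def)
qed

section \<open>Lebesgue measure on products and elementary tensors\<close>

lemma AE_lebesgue_iff: "(AE x in lebesgue. P x) \<longleftrightarrow> (AE x in lborel. P x)"
  by (rule AE_completion_iff)

text \<open>Fubini is applied on \<open>lborel \<Otimes>\<^sub>M lborel\<close>, of which
  \<open>lebesgue\<close> on the product is the completion. Each integral over the product below is
  split after passing to a Borel version.\<close>

lemma lebesgue_ex_borel_complex:
  fixes f :: "'a::euclidean_space \<Rightarrow> complex"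
  assumes "f \<in> borel_measurable lebesgue"
  obtains g where "g \<in> borel_measurable borel" "AE x in lebesgue. f x = g x"
proof -
  have "(\<lambda>x. Re (f x)) \<in> borel_measurable lebesgue" "(\<lambda>x. Im (f x)) \<in> borel_measurable lebesgue"
    using assms by (auto intro!: borel_measurable_Re borel_measurable_Im)
  from this[THEN completion_ex_borel_measurable_real]
  obtain a b where [measurable]: "a \<in> borel_measurable lborel" "b \<in> borel_measurable lborel"
    and ab: "AE x in lborel. Re (f x) = a x" "AE x in lborel. Im (f x) = b x"
    by blast
  have "(\<lambda>x. Complex (a x) (b x)) \<in> borel_measurable borel"
    by (simp add: Complex_eq) measurable
  moreover have "AE x in lebesgue. f x = Complex (a x) (b x)"
    unfolding AE_lebesgue_iff using ab by eventually_elim (simp add: complex_eq_iff)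
  ultimately show thesis by (rule that)
qed

text \<open>Between completed measures continuity does not suffice: preimages of null sets must be
  null. Here the preimage of \<open>N\<close> is \<open>UNIV \<times> N\<close>, a null set of the
  product.\<close>

lemma snd_measurable_lebesgue:
  "snd \<in> (lebesgue :: ('a::euclidean_space \<times> 'b::euclidean_space) measure) \<rightarrow>\<^sub>M lebesgue"
proof (rule completion.measurable_completion2)
  show m: "snd \<in> (lebesgue :: ('a \<times> 'b) measure) \<rightarrow>\<^sub>M lborel"
    by (rule measurable_completion) (simp add: borel_measurable_continuous_onI continuous_on_snd)
  show "null_sets lborel \<subseteq> null_sets (distr (lebesgue :: ('a \<times> 'b) measure) lborel snd)"
  proof
    fix N :: "'b set" assume N: "N \<in> null_sets lborel"
    have "UNIV \<times> N \<in> null_sets (lborel \<Otimes>\<^sub>M lborel :: ('a \<times> 'b) measure)"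
      using N by (intro lborel.times_in_null_sets2) auto
    then have "snd -` N \<in> null_sets (lborel :: ('a \<times> 'b) measure)"
      by (simp add: lborel_prod vimage_snd)
    then show "N \<in> null_sets (distr (lebesgue :: ('a \<times> 'b) measure) lborel snd)"
      using N m by (auto simp: null_sets_def emeasure_distr)
  qed
qed

lemma AE_snd:
  assumes "AE y in lebesgue. P y"
  shows "AE z in (lebesgue :: ('a::euclidean_space \<times> 'b::euclidean_space) measure). P (snd z)"
proof -
  obtain N where N: "{y. \<not> P y} \<subseteq> N" "N \<in> null_sets lborel"
    using assms[unfolded AE_lebesgue_iff] unfolding eventually_ae_filter by auto
  have "UNIV \<times> N \<in> null_sets (lborel \<Otimes>\<^sub>M lborel :: ('a \<times> 'b) measure)"
    using N by (intro lborel.times_in_null_sets2) auto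
  then show ?thesis unfolding AE_lebesgue_iff lborel_prod
    by (rule AE_I') (use N in auto)
qed

lemma AE_slices:
  assumes "AE z in (lebesgue :: ('a::euclidean_space \<times> 'b::euclidean_space) measure). P z"
  shows "AE y in lebesgue. AE x in lebesgue. P (x, y)"
proof -
  obtain N where N: "{z. \<not> P z} \<subseteq> N" "N \<in> null_sets (lborel :: ('a \<times> 'b) measure)"
    using assms[unfolded AE_lebesgue_iff] unfolding eventually_ae_filter by auto
  have "AE z in (lborel \<Otimes>\<^sub>M lborel :: ('a \<times> 'b) measure). z \<notin> N"
    using N(2) by (simp add: lborel_prod AE_not_in)
  then have "AE x in lborel. AE y in lborel. (x, y) \<notin> N"
    by (rule lborel_pair.AE_pair)
  \<comment> \<open>Exchanging the two quantifiers requires a measurable set, which is why the Borel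
    null set \<open>N\<close> stands in for the exceptional set of \<open>P\<close>.\<close>
  moreover have "{z \<in> space (lborel \<Otimes>\<^sub>M lborel). (fst z, snd z) \<notin> N} \<in> sets (lborel \<Otimes>\<^sub>M lborel :: ('a \<times> 'b) measure)"
  proof -
    have "{z \<in> space (lborel \<Otimes>\<^sub>M lborel). (fst z, snd z) \<notin> N} = - N" by (auto simp: space_pair_measure)
    moreover have "- N \<in> sets (lborel :: ('a \<times> 'b) measure)" using N(2) by (auto simp: null_sets_def)
    ultimately show ?thesis unfolding lborel_prod by argo
  qed
  ultimately have n: "AE y in lborel. AE x in lborel. (x, y) \<notin> N"
    by (subst (asm) lborel_pair.AE_commute)
  have "P z" if "z \<notin> N" for z using that N(1) by blast
  then show ?thesis unfolding AE_lebesgue_iff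
    by (intro eventually_mono[OF n]) (auto elim!: eventually_mono)
qed

lemma borel_measurable_lebesgue_fst:
  fixes u :: "'a::euclidean_space \<Rightarrow> complex"
  assumes "u \<in> borel_measurable borel"
  shows "(\<lambda>z::'a \<times> 'b::euclidean_space. u (fst z)) \<in> borel_measurable lebesgue"
  by (intro measurable_completion measurable_compose[OF _ assms])
     (simp add: borel_measurable_continuous_onI continuous_on_fst)

lemma tensor_borel_measurable_lebesgue:
  fixes u :: "'a::euclidean_space \<Rightarrow> complex" and h :: "'b::euclidean_space \<Rightarrow> complex"
  assumes "u \<in> borel_measurable borel" "h \<in> borel_measurable lebesgue"
  shows "(\<lambda>(x, y). u x * h y) \<in> borel_measurable lebesgue"
proof -
  have "(\<lambda>z::'a \<times> 'b. h (snd z)) \<in> borel_measurable lebesgue"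
    using measurable_compose[OF snd_measurable_lebesgue assms(2)] by simp
  then show ?thesis
    unfolding case_prod_beta' by (intro borel_measurable_times borel_measurable_lebesgue_fst assms(1))
qed

text \<open>Since \<open>h\<close> is only Lebesgue measurable, Fubini is used with a Borel version
  \<open>g\<close>; the null set where \<open>h\<close> and \<open>g\<close> differ lifts to a null
  set of the product by \<open>AE_snd\<close>.\<close>

lemma tensor_integral:
  fixes u :: "'a::euclidean_space \<Rightarrow> complex" and h :: "'b::euclidean_space \<Rightarrow> complex"
  assumes u: "integrable lborel u" and h: "integrable lebesgue h"
  shows "integrable lebesgue (\<lambda>(x, y). u x * h y)"
    and "(\<integral>(x, y). u x * h y \<partial>lebesgue) = (\<integral>x. u x \<partial>lborel) * (\<integral>y. h y \<partial>lebesgue)"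
proof -
  have um [measurable]: "u \<in> borel_measurable borel" using u by auto
  have hm: "h \<in> borel_measurable lebesgue" using h by auto
  then obtain g where gm [measurable]: "g \<in> borel_measurable borel" and g: "AE y in lebesgue. h y = g y"
    by (rule lebesgue_ex_borel_complex)
  have gi: "integrable lebesgue g"
    using h integrable_cong_AE[OF hm _ g] gm by (simp add: measurable_completion)
  then have gi': "integrable lborel g" by (simp add: integrable_completion)
  have gint: "(\<integral>y. h y \<partial>lebesgue) = (\<integral>y. g y \<partial>lborel)"
    using integral_cong_AE[OF hm _ g] gm by (simp add: measurable_completion integral_completion)
  let ?G = "\<lambda>(x, y). u x * g y"
  have Gm: "?G \<in> borel_measurable (lborel :: ('a \<times> 'b) measure)"
    unfolding lborel_prod[symmetric] by measurable
  have Gi: "integrable (lborel \<Otimes>\<^sub>M lborel) ?G"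
  proof (rule lborel_pair.Fubini_integrable)
    show "?G \<in> borel_measurable (lborel \<Otimes>\<^sub>M lborel)" by measurable
    show "integrable lborel (\<lambda>x. \<integral>y. norm (?G (x, y)) \<partial>lborel)"
      using u by (simp add: norm_mult)
    show "AE x in lborel. integrable lborel (\<lambda>y. ?G (x, y))"
      using gi' by simp
  qed
  have ae: "AE z in lebesgue. (\<lambda>(x, y). u x * h y) z = ?G z"
    using AE_snd[OF g] by eventually_elim (simp add: case_prod_beta')
  note hm' = tensor_borel_measurable_lebesgue[OF um hm]
  show "integrable lebesgue (\<lambda>(x, y). u x * h y)"
    using integrable_cong_AE[OF hm' measurable_completion[OF Gm] ae] Gi
    by (simp add: lborel_prod integrable_completion[OF Gm])
  have "(\<integral>(x, y). u x * h y \<partial>lebesgue) = (\<integral>z. ?G z \<partial>lborel)"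
    using integral_cong_AE[OF hm' measurable_completion[OF Gm] ae]
    by (simp add: integral_completion[OF Gm])
  also have "\<dots> = (\<integral>x. (\<integral>y. u x * g y \<partial>lborel) \<partial>lborel)"
    using lborel_pair.integral_fst'[OF Gi] by (simp add: lborel_prod)
  also have "\<dots> = (\<integral>x. u x \<partial>lborel) * (\<integral>y. g y \<partial>lborel)"
    by simp
  finally show "(\<integral>(x, y). u x * h y \<partial>lebesgue) = (\<integral>x. u x \<partial>lborel) * (\<integral>y. h y \<partial>lebesgue)"
    by (simp add: gint)
qed

text \<open>Carries integration by parts on the single slices over to the cylinder. Fubini is
  applied to a Borel version \<open>G\<close>, whose slices agree with those of \<open>F\<close> for
  almost every y.\<close>

lemma integral_lebesgue_eq_0_slices:
  fixes F :: "'a::euclidean_space \<times> 'b::euclidean_space \<Rightarrow> complex"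
  assumes "integrable lebesgue F"
    and slices: "\<And>y. has_bochner_integral lborel (\<lambda>x. F (x, y)) 0"
  shows "(\<integral>z. F z \<partial>lebesgue) = 0"
proof -
  have Fm: "F \<in> borel_measurable lebesgue" using assms(1) by auto
  then obtain G where G: "G \<in> borel_measurable borel" "AE z in lebesgue. F z = G z"
    by (rule lebesgue_ex_borel_complex)
  have Gm [measurable]: "G \<in> borel_measurable (lborel \<Otimes>\<^sub>M lborel)" using G(1) by (simp add: lborel_prod)
  have Gm': "G \<in> borel_measurable lborel" using G(1) by simp
  have Gi: "integrable (lborel \<Otimes>\<^sub>M lborel) (case_prod (\<lambda>x y. G (x, y)))"
    using integrable_cong_AE[OF Fm measurable_completion[OF Gm'] G(2)] assms(1)
    by (simp add: lborel_prod integrable_completion[OF Gm'])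
  have "(\<integral>z. F z \<partial>lebesgue) = (\<integral>z. G z \<partial>lborel)"
    using integral_cong_AE[OF Fm measurable_completion[OF Gm'] G(2)]
    by (simp add: integral_completion[OF Gm'])
  also have "\<dots> = (\<integral>y. (\<integral>x. G (x, y) \<partial>lborel) \<partial>lborel)"
    using lborel_pair.integral_snd[OF Gi] by (simp add: lborel_prod)
  also have "\<dots> = (\<integral>y. 0 \<partial>(lborel :: 'b measure))"
  proof (rule integral_cong_AE)
    show "(\<lambda>y. \<integral>x. G (x, y) \<partial>lborel) \<in> borel_measurable lborel" by measurable
    show "AE y in lborel. (\<integral>x. G (x, y) \<partial>lborel) = 0"
      using AE_slices[OF G(2)] unfolding AE_lebesgue_iff
    proof eventually_elim
      case (elim y)
      have "(\<integral>x. F (x, y) \<partial>lborel) = (\<integral>x. G (x, y) \<partial>lborel)"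
        using elim slices[of y] by (intro integral_cong_AE) (auto simp: has_bochner_integral_iff)
      then show ?case using slices[of y] by (simp add: has_bochner_integral_iff)
    qed
  qed simp
  finally show ?thesis by simp
qed

section \<open>Elementary tensors u(x)h(y) cut off to the interval (0,1)\<close>

definition bounded_meas :: "(real \<Rightarrow> real) \<Rightarrow> bool" where
  "bounded_meas u \<longleftrightarrow> u \<in> borel_measurable borel \<and> (\<exists>B. \<forall>x\<in>{0<..<1}. \<bar>u x\<bar> \<le> B)"

lemma bounded_meas_mult:
  assumes "bounded_meas u" "bounded_meas v"
  shows "bounded_meas (\<lambda>x. u x * v x)"
proof -
  from assms obtain B C where "\<And>x. x \<in> {0<..<1} \<Longrightarrow> \<bar>u x\<bar> \<le> B" "\<And>x. x \<in> {0<..<1} \<Longrightarrow> \<bar>v x\<bar> \<le> C"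
    unfolding bounded_meas_def by blast
  then have "\<bar>u x * v x\<bar> \<le> \<bar>B\<bar> * \<bar>C\<bar>" if "x \<in> {0<..<1}" for x
    using that unfolding abs_mult by (intro mult_mono) (auto intro: order_trans[OF _ abs_ge_self])
  moreover have "(\<lambda>x. u x * v x) \<in> borel_measurable borel"
    using assms by (auto simp: bounded_meas_def)
  ultimately show ?thesis unfolding bounded_meas_def by blast
qed

lemma bounded_meas_continuous:
  assumes "continuous_on UNIV u"
  shows "bounded_meas u"
proof -
  have "bounded (u ` {0..1})"
    using assms by (intro compact_imp_bounded compact_continuous_image) (auto intro: continuous_on_subset)
  then obtain B where "\<forall>z\<in>u ` {0..1}. norm z \<le> B" unfolding bounded_iff by blast
  then have "\<forall>x\<in>{0<..<1}. \<bar>u x\<bar> \<le> B" by simp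
  then show ?thesis using assms unfolding bounded_meas_def by (blast intro: borel_measurable_continuous_onI)
qed

text \<open>The cutoff makes functions such as \<open>exp\<close>, unbounded on the line,
  integrable; accordingly \<open>bounded_meas\<close> asks for a bound on (0,1) only.\<close>

definition unit_cut :: "(real \<Rightarrow> real) \<Rightarrow> real \<Rightarrow> complex" where
  "unit_cut u x = (if x \<in> {0<..<1} then of_real (u x) else 0)"

lemma unit_cut_eq: "unit_cut u x = indicator {0<..<1} x *\<^sub>R complex_of_real (u x)"
  by (simp add: unit_cut_def indicator_def)

lemma unit_cut_measurable: "bounded_meas u \<Longrightarrow> unit_cut u \<in> borel_measurable borel"
  unfolding unit_cut_eq[abs_def] bounded_meas_def by auto

lemma unit_cut_integrable:
  assumes "bounded_meas u"
  shows "integrable lborel (unit_cut u)"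
proof -
  from assms obtain B where B: "\<And>x. x \<in> {0<..<1} \<Longrightarrow> \<bar>u x\<bar> \<le> B"
    unfolding bounded_meas_def by blast
  show ?thesis
  proof (rule Bochner_Integration.integrable_bound)
    show "integrable lborel (\<lambda>x::real. indicator {0<..<1} x * \<bar>B\<bar>)"
      by (auto intro!: integrable_mult_left integrable_real_indicator)
    show "unit_cut u \<in> borel_measurable lborel" using unit_cut_measurable[OF assms] by simp
    show "AE x in lborel. norm (unit_cut u x) \<le> norm (indicator {0<..<1} x * \<bar>B\<bar>)"
      using B by (auto simp: unit_cut_def intro!: AE_I2 intro: order_trans[OF _ abs_ge_self])
  qed
qed

lemma unit_cut_mult: "cnj (unit_cut u x) * unit_cut v x = unit_cut (\<lambda>x. u x * v x) x"
  by (simp add: unit_cut_def)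

lemma unit_cut_integral:
  "(\<integral>x. unit_cut u x \<partial>lborel) = complex_of_real (LINT x:{0<..<1}|lborel. u x)"
  unfolding unit_cut_eq set_lebesgue_integral_def by (simp flip: of_real_mult add: scaleR_conv_of_real)

lemma tens_eq: "tens u h = abs_l2 (\<lambda>(x, y). unit_cut u x * rep_l2 h y)"
  unfolding tens_def unit_cut_def by (rule arg_cong[where f = abs_l2]) auto

lemma sq_integrable_tens:
  assumes "bounded_meas u" "sq_integrable h"
  shows "sq_integrable (\<lambda>(x, y). unit_cut u x * h y)"
proof -
  \<comment> \<open>The squared modulus of a tensor is again a tensor, so
    \<open>tensor_integral\<close> gives its integrability.\<close>
  have e: "(\<lambda>(x, y). unit_cut (\<lambda>x. u x * u x) x * (cnj (h y) * h y))
      = (\<lambda>z. complex_of_real ((cmod (case z of (x, y) \<Rightarrow> unit_cut u x * h y))\<^sup>2))"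
    by (auto simp: fun_eq_iff complex_norm_square unit_cut_mult[symmetric] mult_ac simp del: of_real_power)
  have "integrable lebesgue (\<lambda>(x, y). unit_cut (\<lambda>x. u x * u x) x * (cnj (h y) * h y))"
    by (intro tensor_integral unit_cut_integrable bounded_meas_mult sq_integrable_cnj_mult assms)
  then have "integrable lebesgue (\<lambda>z. (cmod (case z of (x, y) \<Rightarrow> unit_cut u x * h y))\<^sup>2)"
    unfolding e using integrable_Re by fastforce
  then show ?thesis
    unfolding sq_integrable_def
    using tensor_borel_measurable_lebesgue[OF unit_cut_measurable[OF assms(1)], of h] assms(2)
    by (simp add: sq_integrable_def)
qed

lemmas sq_integrable_tens_rep = sq_integrable_tens[OF _ sq_integrable_rep]

lemma rep_tens_AE:
  assumes "bounded_meas u"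
  shows "AE z in lebesgue. rep_l2 (tens u h) z = unit_cut u (fst z) * rep_l2 h (snd z)"
  using rep_abs_l2_AE[OF sq_integrable_tens_rep[OF assms, of h]]
  unfolding tens_eq by (simp add: case_prod_beta')

lemma cinner_tens:
  assumes "bounded_meas u" "bounded_meas v"
  shows "cinner (tens u h) (tens v k) = complex_of_real (LINT x:{0<..<1}|lborel. u x * v x) * cinner h k"
proof -
  have "cinner (tens u h) (tens v k)
      = (\<integral>z. cnj (case z of (x, y) \<Rightarrow> unit_cut u x * rep_l2 h y) * (case z of (x, y) \<Rightarrow> unit_cut v x * rep_l2 k y) \<partial>lebesgue)"
    unfolding tens_eq by (intro cinner_abs_l2 sq_integrable_tens_rep assms)
  also have "\<dots> = (\<integral>(x, y). unit_cut (\<lambda>x. u x * v x) x * (cnj (rep_l2 h y) * rep_l2 k y) \<partial>lebesgue)"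
    by (intro Bochner_Integration.integral_cong) (auto simp: unit_cut_mult[symmetric] mult_ac)
  also have "\<dots> = (\<integral>x. unit_cut (\<lambda>x. u x * v x) x \<partial>lborel) * (\<integral>y. cnj (rep_l2 h y) * rep_l2 k y \<partial>lebesgue)"
    by (intro tensor_integral unit_cut_integrable bounded_meas_mult sq_integrable_cnj_mult sq_integrable_rep assms)
  also have "(\<integral>y. cnj (rep_l2 h y) * rep_l2 k y \<partial>lebesgue) = cinner h k"
    using cinner_abs_l2[OF sq_integrable_rep sq_integrable_rep, of h k] by (simp add: abs_rep_l2)
  finally show ?thesis by (simp add: unit_cut_integral)
qed

lemma tens_add:
  assumes "bounded_meas u"
  shows "tens u (h + k) = tens u h + tens u k"
proof (rule l2_eqI)
  show "AE z in lebesgue. rep_l2 (tens u (h + k)) z = rep_l2 (tens u h + tens u k) z"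
    using rep_tens_AE[OF assms, of "h + k"] rep_tens_AE[OF assms, of h] rep_tens_AE[OF assms, of k]
      rep_l2_add_AE[of "tens u h" "tens u k"] AE_snd[OF rep_l2_add_AE[of h k]]
    by eventually_elim (simp add: algebra_simps)
qed

lemma tens_scaleC:
  assumes "bounded_meas u"
  shows "tens u (c *\<^sub>C h) = c *\<^sub>C tens u h"
proof (rule l2_eqI)
  show "AE z in lebesgue. rep_l2 (tens u (c *\<^sub>C h)) z = rep_l2 (c *\<^sub>C tens u h) z"
    using rep_tens_AE[OF assms, of "c *\<^sub>C h"] rep_tens_AE[OF assms, of h]
      rep_l2_scaleC_AE[of c "tens u h"] AE_snd[OF rep_l2_scaleC_AE[of c h]]
    by eventually_elim simp
qed

lemma tens_zero [simp]: "bounded_meas u \<Longrightarrow> tens u 0 = 0"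
  using tens_add[of u 0 0] by simp

lemma tens_fun_add:
  assumes "bounded_meas u" "bounded_meas v" "bounded_meas (\<lambda>x. u x + v x)"
  shows "tens (\<lambda>x. u x + v x) h = tens u h + tens v h"
proof (rule l2_eqI)
  show "AE z in lebesgue. rep_l2 (tens (\<lambda>x. u x + v x) h) z = rep_l2 (tens u h + tens v h) z"
    using rep_tens_AE[OF assms(1), of h] rep_tens_AE[OF assms(2), of h] rep_tens_AE[OF assms(3), of h]
      rep_l2_add_AE[of "tens u h" "tens v h"]
    by eventually_elim (simp add: unit_cut_def algebra_simps)
qed

lemma norm_tens:
  assumes "bounded_meas u"
  shows "(norm (tens u h))\<^sup>2 = (LINT x:{0<..<1}|lborel. (u x)\<^sup>2) * (norm h)\<^sup>2"
proof -
  have "complex_of_real ((norm (tens u h))\<^sup>2)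
      = complex_of_real ((LINT x:{0<..<1}|lborel. (u x)\<^sup>2) * (norm h)\<^sup>2)"
    unfolding cinner_self[symmetric] cinner_tens[OF assms assms] of_real_mult
    by (simp add: power2_eq_square)
  then show ?thesis using of_real_eq_iff by blast
qed

lemma tens_in_L2:
  assumes "bounded_meas u" "h \<in> L2 \<Omega>"
  shows "tens u h \<in> L2 (cyl \<Omega>)"
proof -
  have "AE y in lebesgue. y \<notin> \<Omega> \<longrightarrow> rep_l2 h y = 0" using assms(2) by (simp add: L2_def)
  from AE_snd[OF this] rep_tens_AE[OF assms(1), of h]
  have "AE z in lebesgue. z \<notin> cyl \<Omega> \<longrightarrow> rep_l2 (tens u h) z = 0"
    by eventually_elim (auto simp: unit_cut_def)
  then show ?thesis by (simp add: L2_def)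
qed

section \<open>The subspaces of functions supported in a given set\<close>

lemma abs_l2_in_L2:
  assumes "sq_integrable f" "\<And>x. x \<notin> A \<Longrightarrow> f x = 0"
  shows "abs_l2 f \<in> L2 A"
  using rep_abs_l2_AE[OF assms(1)] assms(2) unfolding L2_def by (auto elim: eventually_mono)

lemma csubspace_L2: "csubspace (L2 A)"
  unfolding csubspace_def
proof (intro conjI ballI allI)
  show "0 \<in> L2 A"
    using rep_l2_zero_AE unfolding L2_def mem_Collect_eq by eventually_elim simp
next
  fix f g assume "f \<in> L2 A" "g \<in> L2 A"
  with rep_l2_add_AE[of f g] show "f + g \<in> L2 A"
    unfolding L2_def mem_Collect_eq by eventually_elim simp
next
  fix c f assume "f \<in> L2 A"
  with rep_l2_scaleC_AE[of c f] show "c *\<^sub>C f \<in> L2 A"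
    unfolding L2_def mem_Collect_eq by eventually_elim simp
qed

lemma sq_integrable_indicator:
  assumes "A \<in> sets lebesgue" "sq_integrable f"
  shows "sq_integrable (\<lambda>x. indicator A x * f x)"
proof -
  have m: "(\<lambda>x. indicator A x * f x) \<in> borel_measurable lebesgue"
    using assms by (auto simp: sq_integrable_def intro!: borel_measurable_times borel_measurable_indicator)
  moreover have "integrable lebesgue (\<lambda>x. (cmod (indicator A x * f x))\<^sup>2)"
  proof (rule Bochner_Integration.integrable_bound)
    show "integrable lebesgue (\<lambda>x. (cmod (f x))\<^sup>2)" using assms by (simp add: sq_integrable_def)
    show "(\<lambda>x. (cmod (indicator A x * f x))\<^sup>2) \<in> borel_measurable lebesgue" using m by measurable
  qed (auto intro!: AE_I2 simp: indicator_def)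
  ultimately show ?thesis by (simp add: sq_integrable_def)
qed

text \<open>An orthogonal complement is closed by continuity of \<open>cinner\<close>, which yields
  \<open>closed_L2\<close>. For the harder inclusion \<open>f\<close> is paired with its own
  restriction to \<open>- A\<close>, so that the pairing is the squared norm of that
  restriction.\<close>

lemma L2_eq_orthogonal:
  assumes A: "A \<in> sets lebesgue"
  shows "L2 A = {f. \<forall>g\<in>L2 (- A). cinner g f = 0}"
proof (intro equalityI subsetI)
  fix f assume f: "f \<in> L2 A"
  have "cinner g f = 0" if g: "g \<in> L2 (- A)" for g
  proof -
    have "AE x in lebesgue. cnj (rep_l2 g x) * rep_l2 f x = 0"
      using f g unfolding L2_def mem_Collect_eq by eventually_elim auto
    then have "(\<integral>x. cnj (rep_l2 g x) * rep_l2 f x \<partial>lebesgue) = 0"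
      by (rule integral_eq_zero_AE)
    then show ?thesis
      using cinner_abs_l2[OF sq_integrable_rep sq_integrable_rep, of g f] by (simp add: abs_rep_l2)
  qed
  then show "f \<in> {f. \<forall>g\<in>L2 (- A). cinner g f = 0}" by simp
next
  fix f assume "f \<in> {f. \<forall>g\<in>L2 (- A). cinner g f = 0}"
  then have f: "\<And>g. g \<in> L2 (- A) \<Longrightarrow> cinner g f = 0" by simp
  define F where "F x = indicator (- A) x * rep_l2 f x" for x
  have F: "sq_integrable F"
    unfolding F_def using sets.compl_sets[OF A]
    by (intro sq_integrable_indicator sq_integrable_rep) (simp add: Compl_eq_Diff_UNIV)
  have "abs_l2 F \<in> L2 (- A)"
    by (intro abs_l2_in_L2 F) (simp add: F_def)
  from f[OF this] have "cinner (abs_l2 F) (abs_l2 (rep_l2 f)) = 0" by (simp add: abs_rep_l2)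
  also have "cinner (abs_l2 F) (abs_l2 (rep_l2 f)) = (\<integral>x. cnj (F x) * rep_l2 f x \<partial>lebesgue)"
    by (rule cinner_abs_l2[OF F sq_integrable_rep])
  also have "\<dots> = (\<integral>x. cnj (F x) * F x \<partial>lebesgue)"
    by (intro Bochner_Integration.integral_cong) (auto simp: F_def indicator_def)
  also have "\<dots> = cinner (abs_l2 F) (abs_l2 F)"
    by (rule cinner_abs_l2[OF F F, symmetric])
  finally have "abs_l2 F = 0" by simp
  then have "AE x in lebesgue. F x = 0"
    using abs_l2_eq_iff[OF F sq_integrable_zero] by (simp add: abs_l2_zero)
  then show "f \<in> L2 A"
    unfolding L2_def mem_Collect_eq by eventually_elim (auto simp: F_def indicator_def)
qed

lemma closed_L2:
  assumes "A \<in> sets lebesgue"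
  shows "closed (L2 A)"
proof -
  have "closed {f. cinner g f = 0}" for g :: "'a l2"
    by (intro closed_Collect_eq continuous_intros)
  then show ?thesis
    unfolding L2_eq_orthogonal[OF assms] Collect_ball_eq by (intro closed_INT) auto
qed

lemma cyl_sets_lebesgue:
  assumes "\<Omega> \<in> sets lebesgue"
  shows "cyl \<Omega> \<in> sets lebesgue"
proof -
  have "snd -` \<Omega> \<in> sets (lebesgue :: (real \<times> 'a) measure)"
    using measurable_sets[OF snd_measurable_lebesgue assms] by simp
  moreover have "{0<..<1::real} \<times> (UNIV :: 'a set) \<in> sets lebesgue"
  proof -
    have "{0<..<1::real} \<times> (UNIV :: 'a set) \<in> sets borel" by (intro borel_open open_Times) auto
    then show ?thesis using sets_completionI_sets[of _ lborel] by simp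
  qed
  moreover have "cyl \<Omega> = snd -` \<Omega> \<inter> {0<..<1} \<times> UNIV" by auto
  ultimately show ?thesis by auto
qed

section \<open>Smooth bump functions\<close>

definition rsmooth :: "(real \<Rightarrow> real) \<Rightarrow> bool" where
  "rsmooth u \<longleftrightarrow> (\<exists>U. U 0 = u \<and> (\<forall>n x. (U n has_real_derivative U (Suc n) x) (at x)))"

text \<open>A class in which every member has a derivative in the same class consists of smooth
  functions, because the choice of a derivative can be iterated. This avoids closed formulas for the
  n-th derivatives of products and of \<open>flat\<close>.\<close>

lemma rsmooth_class:
  assumes "P u" and "\<And>v. P v \<Longrightarrow> \<exists>v'. P v' \<and> (\<forall>x. (v has_real_derivative v' x) (at x))"
  shows "rsmooth u"
proof -
  obtain D where D: "\<And>v. P v \<Longrightarrow> P (D v) \<and> (\<forall>x. (v has_real_derivative D v x) (at x))"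
    using assms(2) by metis
  define U where "U n = (D ^^ n) u" for n
  have P: "P (U n)" for n by (induction n) (use assms(1) D in \<open>auto simp: U_def\<close>)
  have "\<forall>n x. (U n has_real_derivative U (Suc n) x) (at x)"
    using D[OF P] by (simp add: U_def)
  moreover have "U 0 = u" by (simp add: U_def)
  ultimately show ?thesis unfolding rsmooth_def by blast
qed

lemma rsmooth_deriv:
  assumes "rsmooth u"
  obtains u' where "rsmooth u'" "\<And>x. (u has_real_derivative u' x) (at x)"
proof -
  from assms obtain U where U: "U 0 = u" "\<forall>n x. (U n has_real_derivative U (Suc n) x) (at x)"
    unfolding rsmooth_def by blast
  have "rsmooth (U 1)"
    unfolding rsmooth_def by (rule exI[of _ "\<lambda>n. U (Suc n)"]) (use U in auto)
  moreover have "(u has_real_derivative U 1 x) (at x)" for x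
    using U by (metis One_nat_def)
  ultimately show thesis by (rule that)
qed

lemma rsmooth_antideriv:
  assumes "rsmooth u'" "\<And>x. (u has_real_derivative u' x) (at x)"
  shows "rsmooth u"
proof -
  from assms obtain U where U: "U 0 = u'" "\<forall>n x. (U n has_real_derivative U (Suc n) x) (at x)"
    unfolding rsmooth_def by blast
  have "((case n of 0 \<Rightarrow> u | Suc m \<Rightarrow> U m) has_real_derivative U n x) (at x)" for n x
    by (cases n) (use U assms(2) in auto)
  then show ?thesis
    unfolding rsmooth_def by (intro exI[of _ "\<lambda>n. case n of 0 \<Rightarrow> u | Suc m \<Rightarrow> U m"]) auto
qed

lemma rsmooth_continuous:
  assumes "rsmooth u"
  shows "continuous_on A u"
proof -
  obtain u' where "\<And>x. (u has_real_derivative u' x) (at x)" using rsmooth_deriv[OF assms] by blast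
  then show ?thesis by (intro continuous_at_imp_continuous_on ballI DERIV_isCont)
qed

text \<open>Products of smooth functions are not visibly stable under Leibniz's rule, but their
  finite sums are; this is the class fed to \<open>rsmooth_class\<close>.\<close>

inductive prod_sum :: "(real \<Rightarrow> real) \<Rightarrow> bool" where
  mult: "rsmooth u \<Longrightarrow> rsmooth v \<Longrightarrow> prod_sum (\<lambda>x. u x * v x)"
| add: "prod_sum u \<Longrightarrow> prod_sum v \<Longrightarrow> prod_sum (\<lambda>x. u x + v x)"

lemma rsmooth_mult:
  assumes "rsmooth u" "rsmooth v"
  shows "rsmooth (\<lambda>x. u x * v x)"
proof (rule rsmooth_class[where P = prod_sum])
  show "prod_sum (\<lambda>x. u x * v x)" using assms by (rule prod_sum.mult)
  fix w assume "prod_sum w"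
  then show "\<exists>w'. prod_sum w' \<and> (\<forall>x. (w has_real_derivative w' x) (at x))"
  proof induction
    case (mult u v)
    obtain u' v' where d: "rsmooth u'" "\<And>x. (u has_real_derivative u' x) (at x)"
      "rsmooth v'" "\<And>x. (v has_real_derivative v' x) (at x)"
      using mult rsmooth_deriv by metis
    show ?case
    proof (intro exI conjI allI)
      show "prod_sum (\<lambda>x. u' x * v x + u x * v' x)"
        using mult d by (intro prod_sum.intros)
      show "((\<lambda>x. u x * v x) has_real_derivative u' x * v x + u x * v' x) (at x)" for x
        using DERIV_mult[OF d(2) d(4)] by (simp add: algebra_simps)
    qed
  next
    case (add u v)
    then obtain u' v' where d: "prod_sum u'" "\<And>x. (u has_real_derivative u' x) (at x)"
      "prod_sum v'" "\<And>x. (v has_real_derivative v' x) (at x)"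
      by blast
    show ?case
      by (rule exI[of _ "\<lambda>x. u' x + v' x"]) (use d in \<open>auto intro!: prod_sum.add DERIV_add\<close>)
  qed
qed

lemma rsmooth_add:
  assumes "rsmooth u" "rsmooth v"
  shows "rsmooth (\<lambda>x. u x + v x)"
proof -
  from assms obtain U V where "U 0 = u" "\<forall>n x. (U n has_real_derivative U (Suc n) x) (at x)"
     "V 0 = v" "\<forall>n x. (V n has_real_derivative V (Suc n) x) (at x)"
    unfolding rsmooth_def by blast
  then show ?thesis unfolding rsmooth_def
    by (intro exI[of _ "\<lambda>n x. U n x + V n x"]) (auto intro!: DERIV_add)
qed

lemma rsmooth_const: "rsmooth (\<lambda>x. c)"
  unfolding rsmooth_def by (rule exI[of _ "\<lambda>n x. if n = 0 then c else 0"]) auto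

lemma rsmooth_exp: "rsmooth (\<lambda>x. exp (c * x))"
  unfolding rsmooth_def
  by (rule exI[of _ "\<lambda>n x. c ^ n * exp (c * x)"]) (auto intro!: derivative_eq_intros)

lemma rsmooth_affine:
  assumes "rsmooth u"
  shows "rsmooth (\<lambda>x. u (s * x + t))"
proof -
  from assms obtain U where U: "U 0 = u" "\<And>n x. (U n has_real_derivative U (Suc n) x) (at x)"
    unfolding rsmooth_def by blast
  have "((\<lambda>x. s ^ n * U n (s * x + t)) has_real_derivative s ^ Suc n * U (Suc n) (s * x + t)) (at x)" for n x
    by (rule derivative_eq_intros DERIV_chain'[where g = "U n", OF _ U(2)] refl)+ simp
  then show ?thesis unfolding rsmooth_def
    by (intro exI[of _ "\<lambda>n x. s ^ n * U n (s * x + t)"]) (auto simp: U(1))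
qed

text \<open>The powers of 1/x accompany exp(-1/x) because differentiation produces them: the linear
  span of this family is stable under derivatives, also at 0.\<close>

definition flat :: "nat \<Rightarrow> real \<Rightarrow> real" where
  "flat n x = (if x > 0 then (1 / x) ^ n * exp (- 1 / x) else 0)"

lemma flat_tendsto_0: "(flat n \<longlongrightarrow> 0) (at_right 0)"
proof -
  have "((\<lambda>x::real. x ^ n / exp x) \<longlongrightarrow> 0) at_top" by (rule tendsto_power_div_exp_0)
  from filterlim_compose[OF this filterlim_inverse_at_top_right]
  have "((\<lambda>x::real. inverse x ^ n / exp (inverse x)) \<longlongrightarrow> 0) (at_right 0)" .
  then show ?thesis
  proof (rule Lim_transform_eventually)
    have "\<forall>\<^sub>F x::real in at_right 0. x > 0" by (rule eventually_at_right_less)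
    then show "\<forall>\<^sub>F x in at_right 0. inverse x ^ n / exp (inverse x) = flat n x"
      by eventually_elim (simp add: flat_def divide_inverse exp_minus)
  qed
qed

lemma flat_deriv:
  "(flat n has_real_derivative flat (n + 2) x - real n * flat (n + 1) x) (at x)"
proof -
  consider "x > 0" | "x = 0" | "x < 0" by linarith
  then show ?thesis
  proof cases
    case 1
    have "((\<lambda>x. (1 / x) ^ n * exp (- 1 / x)) has_real_derivative flat (n + 2) x - real n * flat (n + 1) x) (at x)"
    proof -
      have inv: "((\<lambda>x. 1 / x) has_real_derivative - ((1 / x)\<^sup>2)) (at x)"
        using 1 by (auto intro!: derivative_eq_intros simp: power2_eq_square)
      have pow: "((\<lambda>x. (1 / x) ^ n) has_real_derivative - real n * (1 / x) ^ (n + 1)) (at x)"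
      proof (cases n)
        case (Suc m)
        have "(1 + real m) * (- (t\<^sup>2) * t ^ m) = - real (Suc m) * t ^ (Suc m + 1)" for t :: real
          by (simp add: power2_eq_square algebra_simps)
        then show ?thesis using DERIV_power_Suc[OF inv, of m] unfolding Suc by simp
      qed simp
      have "((\<lambda>x. exp (- (1 / x))) has_real_derivative exp (- (1 / x)) * (1 / x)\<^sup>2) (at x)"
        using DERIV_chain2[OF DERIV_exp DERIV_minus[OF inv]] by simp
      from DERIV_mult[OF pow this] 1 show ?thesis
        by (simp add: flat_def power2_eq_square algebra_simps)
    qed
    then show ?thesis
      by (rule DERIV_cong_ev[OF refl _ refl, THEN iffD1, rotated])
         (use 1 in \<open>auto simp: flat_def eventually_nhds intro!: exI[of _ "{0<..}"]\<close>)
  next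
    case 3
    have "((\<lambda>x. 0) has_real_derivative flat (n + 2) x - real n * flat (n + 1) x) (at x)"
      using 3 by (simp add: flat_def)
    then show ?thesis
      by (rule DERIV_cong_ev[OF refl _ refl, THEN iffD1, rotated])
         (use 3 in \<open>auto simp: flat_def eventually_nhds intro!: exI[of _ "{..<0}"]\<close>)
  next
    case 2
    have "((\<lambda>h. flat (n + 1) h) \<longlongrightarrow> 0) (at 0)"
    proof (rule filterlim_split_at)
      show "(flat (n + 1) \<longlongrightarrow> 0) (at_right 0)" by (rule flat_tendsto_0)
      show "(flat (n + 1) \<longlongrightarrow> 0) (at_left 0)"
      proof (rule Lim_transform_eventually[OF tendsto_const])
        have "\<forall>\<^sub>F x::real in at_left 0. x < 0" by (simp add: eventually_at_filter)
        then show "\<forall>\<^sub>F x in at_left 0. 0 = flat (n + 1) x"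
          by eventually_elim (simp add: flat_def)
      qed
    qed
    \<comment> \<open>The difference quotient at 0 is the next member of the family, so its limit is
      already known. At \<open>h = 0\<close> both sides are 0, by division by zero.\<close>
    moreover have "flat (n + 1) h = (flat n (0 + h) - flat n 0) / h" for h
      by (simp add: flat_def)
    ultimately have "(flat n has_real_derivative 0) (at 0)"
      unfolding DERIV_def by simp
    then show ?thesis using 2 by (simp add: flat_def)
  qed
qed

inductive flat_sum :: "(real \<Rightarrow> real) \<Rightarrow> bool" where
  flat: "flat_sum (\<lambda>x. c * flat n x)"
| add: "flat_sum u \<Longrightarrow> flat_sum v \<Longrightarrow> flat_sum (\<lambda>x. u x + v x)"

lemma rsmooth_flat: "rsmooth (flat n)"
proof (rule rsmooth_class[where P = flat_sum])
  show "flat_sum (flat n)" using flat_sum.flat[of 1 n] by simp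
  fix w assume "flat_sum w"
  then show "\<exists>w'. flat_sum w' \<and> (\<forall>x. (w has_real_derivative w' x) (at x))"
  proof induction
    case (flat c n)
    show ?case
    proof (intro exI conjI allI)
      show "flat_sum (\<lambda>x. c * flat (n + 2) x + (- c * real n) * flat (n + 1) x)"
        by (intro flat_sum.intros)
      show "((\<lambda>x. c * flat n x) has_real_derivative c * flat (n + 2) x + (- c * real n) * flat (n + 1) x) (at x)" for x
        using DERIV_cmult[OF flat_deriv[of n x], of c] by (simp add: algebra_simps)
    qed
  next
    case (add u v)
    then obtain u' v' where d: "flat_sum u'" "\<And>x. (u has_real_derivative u' x) (at x)"
      "flat_sum v'" "\<And>x. (v has_real_derivative v' x) (at x)"
      by blast
    show ?case
      by (rule exI[of _ "\<lambda>x. u' x + v' x"]) (use d in \<open>auto intro!: flat_sum.add DERIV_add\<close>)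
  qed
qed

text \<open>The factor \<open>n\<close> steepens the edges: at a fixed point strictly between
  \<open>a\<close> and \<open>b\<close> both arguments tend to infinity, where \<open>flat 0\<close>
  tends to 1.\<close>

definition bump :: "nat \<Rightarrow> real \<Rightarrow> real \<Rightarrow> real \<Rightarrow> real" where
  "bump n a b x = flat 0 (real n * (x - a)) * flat 0 (real n * (b - x))"

lemma rsmooth_bump: "rsmooth (bump n a b)"
proof -
  have "rsmooth (\<lambda>x. flat 0 (real n * x + (- (real n * a))) * flat 0 ((- real n) * x + real n * b))"
    by (intro rsmooth_mult rsmooth_affine rsmooth_flat)
  then show ?thesis by (simp add: bump_def[abs_def] algebra_simps)
qed

lemma flat_0_bounds: "0 \<le> flat 0 x" "flat 0 x \<le> 1"
  by (auto simp: flat_def)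

lemma bump_bounds: "0 \<le> bump n a b x" "bump n a b x \<le> 1"
  using flat_0_bounds by (auto simp: bump_def intro: mult_le_one)

lemma bump_eq_0: "x \<notin> {a<..<b} \<Longrightarrow> bump n a b x = 0"
  by (auto simp: bump_def flat_def zero_less_mult_iff)

lemma flat_0_tendsto_1: "(flat 0 \<longlongrightarrow> 1) at_top"
proof (rule Lim_transform_eventually)
  have "((\<lambda>x::real. exp (- inverse x)) \<longlongrightarrow> exp (- 0)) at_top"
    by (intro tendsto_exp tendsto_minus tendsto_inverse_0_at_top filterlim_ident)
  then show "((\<lambda>x::real. exp (- inverse x)) \<longlongrightarrow> 1) at_top" by simp
  show "\<forall>\<^sub>F x in at_top. exp (- inverse x) = flat 0 x"
    using eventually_gt_at_top[of "0::real"] by eventually_elim (simp add: flat_def divide_inverse)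
qed

text \<open>The support is drawn 1/(n+2) inwards so that every member is a test function on (0,1).
  Multiplied by the steepness \<open>n\<close> this shift stays below 1, and therefore the limit on
  the open interval is still 1.\<close>

definition bump_seq :: "real \<Rightarrow> real \<Rightarrow> nat \<Rightarrow> real \<Rightarrow> real" where
  "bump_seq a b n = bump n (max a 0 + 1 / (real n + 2)) (min b 1 - 1 / (real n + 2))"

lemma bump_seq_tendsto:
  assumes "x \<in> {0<..<1}"
  shows "(\<lambda>n. bump_seq a b n x) \<longlonglongrightarrow> indicator {a<..<b} x"
proof (cases "x \<in> {a<..<b}")
  case True
  have flat: "(\<lambda>n. flat 0 (real n * (t - 1 / (real n + 2)))) \<longlonglongrightarrow> 1" if "t > 0" for t
  proof (rule filterlim_compose[OF flat_0_tendsto_1])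
    have "filterlim (\<lambda>n. - 1 + t * real n) at_top sequentially"
      using that by (intro filterlim_tendsto_add_at_top[OF tendsto_const]
          filterlim_tendsto_pos_mult_at_top[OF tendsto_const] filterlim_real_sequentially)
    then show "filterlim (\<lambda>n. real n * (t - 1 / (real n + 2))) at_top sequentially"
    proof (rule filterlim_at_top_mono)
      have "- 1 + t * real n \<le> real n * (t - 1 / (real n + 2))" for n
        by (simp add: field_simps)
      then show "\<forall>\<^sub>F n in sequentially. - 1 + t * real n \<le> real n * (t - 1 / (real n + 2))" by simp
    qed
  qed
  have "(\<lambda>n. bump_seq a b n x) \<longlonglongrightarrow> 1 * 1" unfolding bump_seq_def bump_def
    using tendsto_mult[OF flat[of "x - max a 0"] flat[of "min b 1 - x"]] True assms
    by (simp add: algebra_simps)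
  then show ?thesis using True by simp
next
  case False
  have "0 < 1 / (real n + 2)" for n by simp
  then have "bump_seq a b n x = 0" for n
    using False unfolding bump_seq_def by (intro bump_eq_0) (smt (verit) greaterThanLessThan_iff)
  then show ?thesis using False by simp
qed

section \<open>Test functions on the unit interval and their primitives\<close>

definition rtest :: "(real \<Rightarrow> real) \<Rightarrow> bool" where
  "rtest u \<longleftrightarrow> rsmooth u \<and> (\<exists>a b. 0 < a \<and> b < 1 \<and> (\<forall>x. x \<notin> {a..b} \<longrightarrow> u x = 0))"

lemma rtestI:
  assumes "rsmooth u" "0 < a" "b < 1" "\<And>x. x \<notin> {a..b} \<Longrightarrow> u x = 0"
  shows "rtest u"
  using assms unfolding rtest_def by blast

lemma rtest_bump_seq: "rtest (bump_seq a b n)"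
  unfolding bump_seq_def
proof (rule rtestI[OF rsmooth_bump])
  have "0 < 1 / (real n + 2)" by simp
  then show "0 < max a 0 + 1 / (real n + 2)" "min b 1 - 1 / (real n + 2) < 1" by linarith+
qed (auto simp: bump_eq_0)

lemma abs_bump_seq_le: "\<bar>bump_seq a b n x\<bar> \<le> 1"
  unfolding bump_seq_def using bump_bounds by simp

lemma rtest_mult:
  assumes "rsmooth v" "rtest u"
  shows "rtest (\<lambda>x. v x * u x)"
  using assms unfolding rtest_def by (auto intro: rsmooth_mult)

lemma rtest_add:
  assumes "rtest u" "rtest v"
  shows "rtest (\<lambda>x. u x + v x)"
proof -
  from assms obtain a b c d where "0 < a" "b < 1" "\<And>x. x \<notin> {a..b} \<Longrightarrow> u x = 0"
    "0 < c" "d < 1" "\<And>x. x \<notin> {c..d} \<Longrightarrow> v x = 0" "rsmooth u" "rsmooth v"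
    unfolding rtest_def by metis
  then show ?thesis
    by (intro rtestI[of _ "min a c" "max b d"] rsmooth_add) (auto simp: min_def max_def split: if_splits)
qed

lemma rtest_bounded_meas: "rtest u \<Longrightarrow> bounded_meas u"
  unfolding rtest_def by (auto intro: bounded_meas_continuous rsmooth_continuous)

lemma deriv_eq_0_outside:
  assumes "(u has_vector_derivative D) (at x)" "\<And>t. t \<notin> {a..b} \<Longrightarrow> u t = 0" "x \<notin> {a..b::real}"
  shows "D = 0"
proof -
  have "((\<lambda>_. 0) has_vector_derivative D) (at x)"
    by (rule has_vector_derivative_transform_within_open[OF assms(1), of "- {a..b}"])
       (use assms in auto)
  then show ?thesis
    using vector_derivative_unique_at has_vector_derivative_const by blast
qed

lemma rtest_deriv:
  assumes "rtest u"
  obtains u' where "rtest u'" "\<And>x. (u has_real_derivative u' x) (at x)"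
proof -
  from assms obtain a b where ab: "0 < a" "b < 1" "\<And>x. x \<notin> {a..b} \<Longrightarrow> u x = 0" and u: "rsmooth u"
    unfolding rtest_def by metis
  obtain u' where u': "rsmooth u'" "\<And>x. (u has_real_derivative u' x) (at x)"
    using rsmooth_deriv[OF u] by metis
  have "u' x = 0" if "x \<notin> {a..b}" for x
    using deriv_eq_0_outside[OF u'(2)[unfolded has_real_derivative_iff_has_vector_derivative] ab(3) that] .
  then have "rtest u'" using u' ab unfolding rtest_def by blast
  then show thesis using that u'(2) by blast
qed

text \<open>The primitive that vanishes at 0 is constant on either side of the support of
  \<open>w\<close>; the constant on the left is 0 by normalisation and the one on the right because
  it equals the integral of \<open>w\<close>.\<close>

lemma rtest_antideriv:
  assumes "rtest w" "(LINT x:{0<..<1}|lborel. w x) = 0"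
  obtains u where "rtest u" "\<And>x. (u has_real_derivative w x) (at x)"
proof -
  from assms obtain a b where ab: "0 < a" "b < 1" "\<And>x. x \<notin> {a..b} \<Longrightarrow> w x = 0" and w: "rsmooth w"
    unfolding rtest_def by metis
  have cont: "continuous_on A w" for A by (rule rsmooth_continuous[OF w])
  obtain u where u: "\<And>x. (u has_real_derivative w x) (at x)"
  proof -
    have "isCont w x" for x using cont[of UNIV] by (simp add: continuous_on_eq_continuous_at)
    then have "\<exists>F. \<forall>x. (F has_vector_derivative w x) (at x)"
      using einterval_antiderivative[of "-\<infinity>" "\<infinity>" w] by simp
    then show thesis using that by (auto simp: has_real_derivative_iff_has_vector_derivative)
  qed
  define v where "v x = u x - u 0" for x
  have v: "(v has_real_derivative w x) (at x)" for x
    unfolding v_def using DERIV_diff[OF u DERIV_const] by simp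
  have const: "v x = v y" if "x \<le> y" "\<And>t. x \<le> t \<Longrightarrow> t \<le> y \<Longrightarrow> w t = 0" for x y
  proof (cases "x = y")
    case False
    then have "x < y" using that by simp
    moreover have "continuous_on {x..y} v"
      by (intro continuous_at_imp_continuous_on ballI DERIV_isCont[OF v])
    ultimately show ?thesis
      using DERIV_isconst_end[of x y v] v that(2) by (metis less_imp_le)
  qed simp
  have v1: "v 1 = 0"
  proof -
    have "(LINT x:{0..1}|lborel. w x) = v 1 - v 0"
      unfolding set_lebesgue_integral_def
      by (rule integral_FTC_Icc)
         (use v cont in \<open>auto simp flip: has_real_derivative_iff_has_vector_derivative intro: has_field_derivative_at_within\<close>)
    moreover have "(LINT x:{0..1}|lborel. w x) = (LINT x:{0<..<1}|lborel. w x)"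
      unfolding set_lebesgue_integral_def
      by (intro Bochner_Integration.integral_cong) (use ab in \<open>auto simp: indicator_def\<close>)
    ultimately show ?thesis using assms(2) by (simp add: v_def)
  qed
  have "v x = 0" if x: "x \<notin> {min a (1/2)..max b (1/2)}" for x
  proof -
    have v0: "v 0 = 0" by (simp add: v_def)
    consider "x < a" "x \<le> 0" | "0 \<le> x" "x < a" | "b < x" "x \<le> 1" | "b < x" "1 \<le> x"
      using x ab by fastforce
    then show ?thesis
      by cases (use const[of x 0] const[of 0 x] const[of x 1] const[of 1 x] v0 v1 ab in force)+
  qed
  moreover have "0 < min a (1/2)" "max b (1/2) < 1" using ab by auto
  moreover have "rsmooth v" using rsmooth_antideriv[OF w v] .
  ultimately have "rtest v" unfolding rtest_def by blast
  then show thesis using that v by blast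
qed

lemma test_funI:
  assumes "\<And>n x. (\<Psi> n has_vector_derivative \<Psi> (Suc n) x) (at x)" "\<And>x. \<Psi> 0 x = \<psi> x"
    "0 < a" "b < 1" "\<And>x. x \<notin> {a..b} \<Longrightarrow> \<psi> x = 0"
  shows "test_fun \<psi>"
proof -
  have "\<Psi> 0 = \<psi>" using assms(2) by blast
  then show ?thesis using assms unfolding test_fun_def by blast
qed

lemma test_fun_rtest:
  assumes "rtest u"
  shows "test_fun (\<lambda>x. of_real (u x) * c)"
proof -
  from assms obtain U a b where U: "U 0 = u" "\<And>n x. (U n has_real_derivative U (Suc n) x) (at x)"
    and ab: "0 < a" "b < 1" "\<And>x. x \<notin> {a..b} \<Longrightarrow> u x = 0"
    unfolding rtest_def rsmooth_def by metis
  have "((\<lambda>x. of_real (U n x) * c) has_vector_derivative of_real (U (Suc n) x) * c) (at x)" for n x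
    by (intro has_vector_derivative_mult_left has_vector_derivative_of_real)
       (use U(2) in \<open>simp add: has_real_derivative_iff_has_vector_derivative\<close>)
  then show ?thesis
    using ab by (intro test_funI[of "\<lambda>n x. of_real (U n x) * c" _ a b]) (auto simp: U(1))
qed

lemma test_fun_deriv:
  assumes "test_fun \<psi>"
  obtains \<psi>' a b where "\<And>x. (\<psi> has_vector_derivative \<psi>' x) (at x)" "continuous_on UNIV \<psi>'"
    "0 < a" "a < b" "b < 1" "\<And>x. x \<notin> {a<..<b} \<Longrightarrow> \<psi> x = 0" "\<And>x. x \<notin> {a<..<b} \<Longrightarrow> \<psi>' x = 0"
proof -
  from assms obtain \<Psi> a b where U: "\<Psi> 0 = \<psi>" "\<And>n x. (\<Psi> n has_vector_derivative \<Psi> (Suc n) x) (at x)"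
    and ab: "0 < a" "b < 1" "\<And>x. x \<notin> {a..b} \<Longrightarrow> \<psi> x = 0"
    unfolding test_fun_def by metis
  have d: "(\<psi> has_vector_derivative \<Psi> 1 x) (at x)" for x using U(2)[of 0 x] U(1) by simp
  have c: "continuous_on UNIV (\<Psi> 1)"
    by (intro continuous_at_imp_continuous_on ballI has_vector_derivative_continuous[OF U(2)])
  have z: "\<Psi> 1 x = 0" if "x \<notin> {a..b}" for x
    using deriv_eq_0_outside[OF d ab(3) that] .
  \<comment> \<open>The support is enlarged to an open interval whose end points lie in (0,1), so
    that the function and its derivative vanish at those points as well. The \<open>1/2\<close>
    keeps the interval nonempty even when \<open>{a..b}\<close> is empty.\<close>
  have out: "x \<notin> {a..b}" if "x \<notin> {min a (1/2) / 2<..<(1 + max b (1/2)) / 2}" for x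
    using that ab(1,2) by (auto simp: min_def max_def split: if_splits)
  show thesis
    by (rule that[of "\<Psi> 1" "min a (1/2) / 2" "(1 + max b (1/2)) / 2", OF d c])
       (use z ab out in \<open>auto simp: min_def max_def simp del: greaterThanLessThan_iff atLeastAtMost_iff\<close>)
qed

lemma test_fun_add:
  assumes "test_fun \<phi>" "test_fun \<psi>"
  shows "test_fun (\<lambda>x. \<phi> x + \<psi> x)"
proof -
  from assms(1) obtain U a b where U: "U 0 = \<phi>" "\<And>n x. (U n has_vector_derivative U (Suc n) x) (at x)"
    and ab: "0 < a" "b < 1" "\<And>x. x \<notin> {a..b} \<Longrightarrow> \<phi> x = 0"
    unfolding test_fun_def by metis
  from assms(2) obtain V c d where V: "V 0 = \<psi>" "\<And>n x. (V n has_vector_derivative V (Suc n) x) (at x)"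
    and cd: "0 < c" "d < 1" "\<And>x. x \<notin> {c..d} \<Longrightarrow> \<psi> x = 0"
    unfolding test_fun_def by metis
  show ?thesis
    by (rule test_funI[of "\<lambda>n x. U n x + V n x" _ "min a c" "max b d"])
       (use U V ab cd in \<open>auto intro!: has_vector_derivative_add simp: min_def max_def split: if_splits\<close>)
qed

lemma test_fun_cmult:
  assumes "test_fun \<phi>"
  shows "test_fun (\<lambda>x. c * \<phi> x)"
proof -
  from assms(1) obtain U a b where U: "U 0 = \<phi>" "\<And>n x. (U n has_vector_derivative U (Suc n) x) (at x)"
    and ab: "0 < a" "b < 1" "\<And>x. x \<notin> {a..b} \<Longrightarrow> \<phi> x = 0"
    unfolding test_fun_def by metis
  show ?thesis
    by (rule test_funI[of "\<lambda>n x. c * U n x" _ a b])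
       (use U ab in \<open>auto intro!: has_vector_derivative_mult_right\<close>)
qed

section \<open>The differentiation operator and Green's formula\<close>

text \<open>\<open>rep_l2 k\<close> vanishes off \<Omega> only almost everywhere, whereas
  \<open>dom_fun\<close> demands this at every point off \<Omega>.\<close>

lemma L2_rep_vanishing:
  assumes "\<Omega> \<in> sets lebesgue" "k \<in> L2 \<Omega>"
  obtains k' where "sq_integrable k'" "abs_l2 k' = k" "\<And>y. y \<notin> \<Omega> \<Longrightarrow> k' y = 0"
proof -
  define k' where "k' y = indicator \<Omega> y * rep_l2 k y" for y
  have k': "sq_integrable k'"
    unfolding k'_def by (intro sq_integrable_indicator assms sq_integrable_rep)
  have "AE y in lebesgue. k' y = rep_l2 k y"
    using assms(2) unfolding L2_def mem_Collect_eq by eventually_elim (auto simp: k'_def indicator_def)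
  then have "abs_l2 k' = k"
    using abs_l2_eq_iff[OF k' sq_integrable_rep] by (simp add: abs_rep_l2)
  with k' show thesis by (rule that) (simp add: k'_def)
qed

lemma tens_abs_l2:
  assumes "bounded_meas u" "sq_integrable k"
  shows "tens u (abs_l2 k) = abs_l2 (\<lambda>(x, y). unit_cut u x * k y)"
proof -
  have "AE z in lebesgue. (\<lambda>(x, y). unit_cut u x * rep_l2 (abs_l2 k) y) z = (\<lambda>(x, y). unit_cut u x * k y) z"
    using AE_snd[OF rep_abs_l2_AE[OF assms(2)]] by eventually_elim (simp add: case_prod_beta')
  then show ?thesis
    unfolding tens_eq using abs_l2_eq_iff sq_integrable_tens assms sq_integrable_rep by blast
qed

lemma tens_fun_cmult:
  assumes "bounded_meas u"
  shows "tens (\<lambda>x. c * u x) h = of_real c *\<^sub>C tens u h"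
proof -
  have b: "bounded_meas (\<lambda>x. c * u x)"
    by (intro bounded_meas_mult assms bounded_meas_continuous continuous_intros)
  show ?thesis
  proof (rule l2_eqI)
    show "AE z in lebesgue. rep_l2 (tens (\<lambda>x. c * u x) h) z = rep_l2 (of_real c *\<^sub>C tens u h) z"
      using rep_tens_AE[OF assms, of h] rep_tens_AE[OF b, of h] rep_l2_scaleC_AE[of "of_real c" "tens u h"]
      by eventually_elim (simp add: unit_cut_def)
  qed
qed

section \<open>Slices and linear structure of the domain D\<close>

lemma dom_fun_deriv:
  assumes "dom_fun \<Omega> \<phi>"
  shows "((\<lambda>t. \<phi> (t, y)) has_vector_derivative d1 \<phi> (x, y)) (at x)"
proof (cases "y \<in> \<Omega>")
  case True
  then have "test_fun (\<lambda>t. \<phi> (t, y))" using assms by (simp add: dom_fun_def)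
  then obtain D where "((\<lambda>t. \<phi> (t, y)) has_vector_derivative D) (at x)"
    using test_fun_deriv by metis
  then show ?thesis unfolding d1_def
    by (simp add: vector_derivative_works[symmetric] differentiableI_vector)
next
  case False
  then have "(\<lambda>t. \<phi> (t, y)) = (\<lambda>t. 0)" using assms by (auto simp: dom_fun_def)
  then show ?thesis by (simp add: d1_def)
qed

lemma dom_fun_slice:
  assumes "dom_fun \<Omega> \<phi>"
  obtains a b where "0 < a" "a < b" "b < 1"
    "\<And>x. x \<notin> {a<..<b} \<Longrightarrow> \<phi> (x, y) = 0" "\<And>x. x \<notin> {a<..<b} \<Longrightarrow> d1 \<phi> (x, y) = 0"
    "continuous_on UNIV (\<lambda>x. d1 \<phi> (x, y))"
proof (cases "y \<in> \<Omega>")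
  case True
  then have "test_fun (\<lambda>t. \<phi> (t, y))" using assms by (simp add: dom_fun_def)
  then obtain D a b where D: "\<And>x. ((\<lambda>t. \<phi> (t, y)) has_vector_derivative D x) (at x)" "continuous_on UNIV D"
    "0 < a" "a < b" "b < 1" "\<And>x. x \<notin> {a<..<b} \<Longrightarrow> \<phi> (x, y) = 0" "\<And>x. x \<notin> {a<..<b} \<Longrightarrow> D x = 0"
    using test_fun_deriv by metis
  then have "D = (\<lambda>x. d1 \<phi> (x, y))"
    using vector_derivative_unique_at[OF D(1) dom_fun_deriv[OF assms]] by blast
  with D show thesis by (intro that) auto
next
  case False
  then have "\<phi> (x, y) = 0" for x using assms by (simp add: dom_fun_def)
  then show thesis by (intro that[of "1/3" "2/3"]) (auto simp: d1_def)
qed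

lemma dom_fun_add:
  assumes "dom_fun \<Omega> \<phi>" "dom_fun \<Omega> \<psi>"
  shows "dom_fun \<Omega> (\<lambda>z. \<phi> z + \<psi> z)" "d1 (\<lambda>z. \<phi> z + \<psi> z) = (\<lambda>z. d1 \<phi> z + d1 \<psi> z)"
proof -
  show d: "d1 (\<lambda>z. \<phi> z + \<psi> z) = (\<lambda>z. d1 \<phi> z + d1 \<psi> z)"
  proof
    fix z :: "real \<times> 'a"
    obtain x y where z: "z = (x, y)" by (cases z)
    have "((\<lambda>t. \<phi> (t, y) + \<psi> (t, y)) has_vector_derivative d1 \<phi> z + d1 \<psi> z) (at x)"
      unfolding z by (intro has_vector_derivative_add dom_fun_deriv[OF assms(1)] dom_fun_deriv[OF assms(2)])
    from vector_derivative_at[OF this] show "d1 (\<lambda>z. \<phi> z + \<psi> z) z = d1 \<phi> z + d1 \<psi> z"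
      by (simp add: z d1_def)
  qed
  show "dom_fun \<Omega> (\<lambda>z. \<phi> z + \<psi> z)"
    using assms unfolding dom_fun_def d by (auto intro: sq_integrable_add test_fun_add)
qed

lemma dom_fun_cmult:
  assumes "dom_fun \<Omega> \<phi>"
  shows "dom_fun \<Omega> (\<lambda>z. c * \<phi> z)" "d1 (\<lambda>z. c * \<phi> z) = (\<lambda>z. c * d1 \<phi> z)"
proof -
  show d: "d1 (\<lambda>z. c * \<phi> z) = (\<lambda>z. c * d1 \<phi> z)"
  proof
    fix z :: "real \<times> 'a"
    obtain x y where z: "z = (x, y)" by (cases z)
    have "((\<lambda>t. c * \<phi> (t, y)) has_vector_derivative c * d1 \<phi> z) (at x)"
      unfolding z by (intro has_vector_derivative_mult_right dom_fun_deriv[OF assms])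
    from vector_derivative_at[OF this] show "d1 (\<lambda>z. c * \<phi> z) z = c * d1 \<phi> z"
      by (simp add: z d1_def)
  qed
  show "dom_fun \<Omega> (\<lambda>z. c * \<phi> z)"
    using assms unfolding dom_fun_def d by (auto intro: sq_integrable_cmult test_fun_cmult)
qed

lemma D1_I: "dom_fun \<Omega> \<phi> \<Longrightarrow> (abs_l2 \<phi>, abs_l2 (d1 \<phi>)) \<in> D1 \<Omega>"
  by (auto simp: D1_def)

lemma dom_fun_sq_integrable: "dom_fun \<Omega> \<phi> \<Longrightarrow> sq_integrable \<phi>" "dom_fun \<Omega> \<phi> \<Longrightarrow> sq_integrable (d1 \<phi>)"
  by (simp_all add: dom_fun_def)

lemma D1_E:
  assumes "(f, f') \<in> D1 \<Omega>"
  obtains \<phi> where "dom_fun \<Omega> \<phi>" "f = abs_l2 \<phi>" "f' = abs_l2 (d1 \<phi>)"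
  using assms by (auto simp: D1_def)

lemma D1_add:
  assumes "(f, f') \<in> D1 \<Omega>" "(g, g') \<in> D1 \<Omega>"
  shows "(f + g, f' + g') \<in> D1 \<Omega>"
proof -
  from assms(1) obtain \<phi> where f: "dom_fun \<Omega> \<phi>" "f = abs_l2 \<phi>" "f' = abs_l2 (d1 \<phi>)"
    by (rule D1_E)
  from assms(2) obtain \<psi> where g: "dom_fun \<Omega> \<psi>" "g = abs_l2 \<psi>" "g' = abs_l2 (d1 \<psi>)"
    by (rule D1_E)
  show ?thesis
    using D1_I[OF dom_fun_add(1)[OF f(1) g(1)]] by (simp add: dom_fun_add(2)[OF f(1) g(1)] f g abs_l2_add dom_fun_sq_integrable[OF f(1)] dom_fun_sq_integrable[OF g(1)])
qed

lemma D1_scaleC: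
  assumes "(f, f') \<in> D1 \<Omega>"
  shows "(c *\<^sub>C f, c *\<^sub>C f') \<in> D1 \<Omega>"
proof -
  from assms obtain \<phi> where f: "dom_fun \<Omega> \<phi>" "f = abs_l2 \<phi>" "f' = abs_l2 (d1 \<phi>)"
    by (rule D1_E)
  show ?thesis
    using D1_I[OF dom_fun_cmult(1)[OF f(1), of c]] by (simp add: dom_fun_cmult(2)[OF f(1)] f abs_l2_scaleC dom_fun_sq_integrable[OF f(1)])
qed

lemma D1_zero: "(0, 0) \<in> D1 \<Omega>"
proof -
  have d: "d1 (\<lambda>z. 0) = (\<lambda>z :: real \<times> 'a. 0 :: complex)" by (auto simp: d1_def)
  have "test_fun (\<lambda>x. 0)"
    by (rule test_funI[of "\<lambda>n x. 0" _ "1/3" "2/3"]) auto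
  then have "dom_fun \<Omega> (\<lambda>z. 0)"
    by (simp add: dom_fun_def d sq_integrable_zero)
  from D1_I[OF this] show ?thesis by (simp add: d abs_l2_zero)
qed

lemma D1_in_L2:
  assumes "(f, f') \<in> D1 \<Omega>"
  shows "f \<in> L2 (cyl \<Omega>)" "f' \<in> L2 (cyl \<Omega>)"
proof -
  from assms obtain \<phi> where f: "dom_fun \<Omega> \<phi>" "f = abs_l2 \<phi>" "f' = abs_l2 (d1 \<phi>)"
    by (rule D1_E)
  have out: "\<phi> z = 0 \<and> d1 \<phi> z = 0" if "z \<notin> cyl \<Omega>" for z
  proof -
    obtain x y where z: "z = (x, y)" by (cases z)
    show ?thesis
    proof (cases "y \<in> \<Omega>")
      case True
      then have x: "x \<notin> {0<..<1}" using that z by auto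
      obtain a b where "0 < a" "a < b" "b < 1"
        "\<And>x. x \<notin> {a<..<b} \<Longrightarrow> \<phi> (x, y) = 0" "\<And>x. x \<notin> {a<..<b} \<Longrightarrow> d1 \<phi> (x, y) = 0"
        using dom_fun_slice[OF f(1)] by metis
      then show ?thesis using x z by force
    next
      case False
      then have "\<phi> (x, y) = 0" for x using f(1) by (simp add: dom_fun_def)
      then show ?thesis by (simp add: z d1_def)
    qed
  qed
  then show "f \<in> L2 (cyl \<Omega>)" "f' \<in> L2 (cyl \<Omega>)"
    unfolding f using dom_fun_sq_integrable[OF f(1)] by (auto intro!: abs_l2_in_L2)
qed

text \<open>Supplies the elements of D on which weak equations are tested: a real test function
  times an arbitrary element of \<open>L2 \<Omega>\<close>.\<close>

lemma D1_tens:
  assumes \<Omega>: "\<Omega> \<in> sets lebesgue" and u: "rtest u" "\<And>x. (u has_real_derivative u' x) (at x)"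
    and k: "k \<in> L2 \<Omega>"
  shows "(tens u k, tens u' k) \<in> D1 \<Omega>"
proof -
  obtain k' where k': "sq_integrable k'" "abs_l2 k' = k" "\<And>y. y \<notin> \<Omega> \<Longrightarrow> k' y = 0"
    using L2_rep_vanishing[OF \<Omega> k] by blast
  obtain w where "rtest w" "\<And>x. (u has_real_derivative w x) (at x)" using rtest_deriv[OF u(1)] by metis
  then have u': "rtest u'" using u(2) DERIV_unique by (metis ext)
  \<comment> \<open>A test function vanishes off (0,1) anyway, so the cutoff built into
    \<open>tens\<close> leaves it unchanged and preserves smoothness of the slices.\<close>
  have cut: "unit_cut v x = of_real (v x)" if v: "rtest v" for v x
  proof -
    obtain a b where "0 < a" "b < 1" "\<And>x. x \<notin> {a..b} \<Longrightarrow> v x = 0" using v unfolding rtest_def by metis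
    then show ?thesis by (force simp: unit_cut_def)
  qed
  define \<phi> where "\<phi> = (\<lambda>(x, y). complex_of_real (u x) * k' y)"
  have d: "d1 \<phi> = (\<lambda>(x, y). complex_of_real (u' x) * k' y)"
  proof -
    have "((\<lambda>t. complex_of_real (u t) * k' y) has_vector_derivative complex_of_real (u' x) * k' y) (at x)" for x y
      by (intro has_vector_derivative_mult_left has_vector_derivative_of_real)
         (use u(2) in \<open>simp add: has_real_derivative_iff_has_vector_derivative\<close>)
    then show ?thesis by (auto simp: d1_def \<phi>_def intro!: vector_derivative_at)
  qed
  have sq: "sq_integrable (\<lambda>(x, y). complex_of_real (v x) * k' y)" if "rtest v" for v
    using sq_integrable_tens[OF rtest_bounded_meas[OF that] k'(1)] by (simp add: cut[OF that])
  have eq: "tens v k = abs_l2 (\<lambda>(x, y). complex_of_real (v x) * k' y)" if "rtest v" for v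
    using tens_abs_l2[OF rtest_bounded_meas[OF that] k'(1)] by (simp add: cut[OF that] k'(2))
  have "dom_fun \<Omega> \<phi>"
    unfolding dom_fun_def d using sq[OF u(1)] sq[OF u'] k'(3) test_fun_rtest[OF u(1)]
    by (auto simp: \<phi>_def)
  from D1_I[OF this, unfolded d] show ?thesis unfolding eq[OF u(1)] eq[OF u'] by (simp add: \<phi>_def)
qed

text \<open>Integration by parts in x for each fixed y. The slice of \<open>\<phi>\<close> vanishes
  near 0 and near 1, so there is no boundary term and \<open>G\<close> is asked to be differentiable
  only inside (0,1).\<close>

lemma Green_slices:
  assumes \<phi>: "dom_fun \<Omega> \<phi>" and G: "sq_integrable G" "sq_integrable G'"
    and deriv: "\<And>x y. x \<in> {0<..<1} \<Longrightarrow> ((\<lambda>t. G (t, y)) has_vector_derivative G' (x, y)) (at x)"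
    and cont: "\<And>y. continuous_on {0<..<1} (\<lambda>x. G' (x, y))"
  shows "cinner (abs_l2 (d1 \<phi>)) (abs_l2 G) + cinner (abs_l2 \<phi>) (abs_l2 G') = 0"
proof -
  note sq = dom_fun_sq_integrable[OF \<phi>]
  define F where "F z = cnj (d1 \<phi> z) * G z + cnj (\<phi> z) * G' z" for z
  have i: "integrable lebesgue (\<lambda>z. cnj (d1 \<phi> z) * G z)" "integrable lebesgue (\<lambda>z. cnj (\<phi> z) * G' z)"
    by (intro sq_integrable_cnj_mult sq G)+
  have "(\<integral>z. F z \<partial>lebesgue) = 0"
  proof (rule integral_lebesgue_eq_0_slices)
    show "integrable lebesgue F" unfolding F_def using i by simp
    fix y
    obtain a b where ab: "0 < a" "a < b" "b < 1"
      "\<And>x. x \<notin> {a<..<b} \<Longrightarrow> \<phi> (x, y) = 0" "\<And>x. x \<notin> {a<..<b} \<Longrightarrow> d1 \<phi> (x, y) = 0"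
      "continuous_on UNIV (\<lambda>x. d1 \<phi> (x, y))"
      using dom_fun_slice[OF \<phi>] by metis
    have sub: "{a..b} \<subseteq> {0<..<1}" using ab by auto
    have cphi: "continuous_on UNIV (\<lambda>x. \<phi> (x, y))"
      by (intro continuous_at_imp_continuous_on ballI has_vector_derivative_continuous[OF dom_fun_deriv[OF \<phi>]])
    have cG: "continuous_on {a..b} (\<lambda>x. G (x, y))"
      using sub by (intro continuous_at_imp_continuous_on ballI has_vector_derivative_continuous[OF deriv]) auto
    have "has_bochner_integral lborel (\<lambda>x. indicator {a..b} x *\<^sub>R F (x, y))
       (cnj (\<phi> (b, y)) * G (b, y) - cnj (\<phi> (a, y)) * G (a, y))"
    proof (rule has_bochner_integral_FTC_Icc)
      fix x assume "a \<le> x" "x \<le> b"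
      then have "((\<lambda>t. cnj (\<phi> (t, y)) * G (t, y)) has_vector_derivative
          cnj (\<phi> (x, y)) * G' (x, y) + cnj (d1 \<phi> (x, y)) * G (x, y)) (at x)"
        using sub by (intro has_vector_derivative_mult has_vector_derivative_cnj dom_fun_deriv[OF \<phi>] deriv) auto
      then show "((\<lambda>t. cnj (\<phi> (t, y)) * G (t, y)) has_vector_derivative F (x, y)) (at x within {a..b})"
        unfolding F_def by (simp add: add.commute has_vector_derivative_at_within)
    next
      show "continuous_on {a..b} (\<lambda>x. F (x, y))"
        unfolding F_def
        by (intro continuous_intros cG continuous_on_subset[OF cont sub] continuous_on_subset[OF cphi subset_UNIV]
            continuous_on_subset[OF ab(6) subset_UNIV])
    qed (use ab in auto)
    \<comment> \<open>The interval \<open>{a..b}\<close> depends on y; since the integrand is 0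
      outside it, the slice integral can be taken over the whole line, uniformly in y.\<close>
    moreover have "indicator {a..b} x *\<^sub>R F (x, y) = F (x, y)" for x
      using ab by (auto simp: F_def indicator_def)
    ultimately show "has_bochner_integral lborel (\<lambda>x. F (x, y)) 0"
      using ab by simp
  qed
  then show ?thesis
    using i unfolding F_def by (simp add: cinner_abs_l2 sq G)
qed

lemma D1_skew:
  assumes "(f, f') \<in> D1 \<Omega>" "(g, g') \<in> D1 \<Omega>"
  shows "cinner f' g + cinner f g' = 0"
proof -
  from assms(1) obtain \<phi> where f: "dom_fun \<Omega> \<phi>" "f = abs_l2 \<phi>" "f' = abs_l2 (d1 \<phi>)"
    by (rule D1_E)
  from assms(2) obtain \<psi> where g: "dom_fun \<Omega> \<psi>" "g = abs_l2 \<psi>" "g' = abs_l2 (d1 \<psi>)"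
    by (rule D1_E)
  have "continuous_on UNIV (\<lambda>x. d1 \<psi> (x, y))" for y using dom_fun_slice[OF g(1)] by metis
  then show ?thesis unfolding f g
    by (intro Green_slices[OF f(1) dom_fun_sq_integrable[OF g(1)]] dom_fun_deriv[OF g(1)]) (auto intro: continuous_on_subset)
qed

text \<open>The boundary terms are killed by \<open>f\<close> alone, so \<open>v\<close> may be an
  exponential. This is how exponential tensors enter the annihilator of
  \<open>D1 \<Omega>\<close>.\<close>

lemma D1_tens_skew:
  assumes f: "(f, f') \<in> D1 \<Omega>" and v: "\<And>x. (v has_real_derivative v' x) (at x)" "continuous_on UNIV v'"
  shows "cinner f' (tens v h) + cinner f (tens v' h) = 0"
proof -
  from f obtain \<phi> where f: "dom_fun \<Omega> \<phi>" "f = abs_l2 \<phi>" "f' = abs_l2 (d1 \<phi>)"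
    by (rule D1_E)
  have "continuous_on UNIV v" by (intro continuous_at_imp_continuous_on ballI DERIV_isCont[OF v(1)])
  then have b: "bounded_meas v" "bounded_meas v'" using v(2) by (auto intro: bounded_meas_continuous)
  show ?thesis unfolding f tens_eq
  proof (rule Green_slices[OF f(1)])
    show "sq_integrable (\<lambda>(x, y). unit_cut v x * rep_l2 h y)" "sq_integrable (\<lambda>(x, y). unit_cut v' x * rep_l2 h y)"
      by (intro sq_integrable_tens_rep b)+
    fix y and x :: real assume x: "x \<in> {0<..<1}"
    have "((\<lambda>t. complex_of_real (v t) * rep_l2 h y) has_vector_derivative complex_of_real (v' x) * rep_l2 h y) (at x)"
      by (intro has_vector_derivative_mult_left has_vector_derivative_of_real)
         (use v in \<open>simp add: has_real_derivative_iff_has_vector_derivative\<close>)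
    then have "((\<lambda>t. unit_cut v t * rep_l2 h y) has_vector_derivative complex_of_real (v' x) * rep_l2 h y) (at x)"
      by (rule has_vector_derivative_transform_within_open[of _ _ _ "{0<..<1}"]) (use x in \<open>auto simp: unit_cut_def\<close>)
    then show "((\<lambda>t. case (t, y) of (x, y) \<Rightarrow> unit_cut v x * rep_l2 h y) has_vector_derivative
        (case (x, y) of (x, y) \<Rightarrow> unit_cut v' x * rep_l2 h y)) (at x)"
      using x by (simp add: unit_cut_def)
  next
    fix y
    have "continuous_on {0<..<1} (\<lambda>x. complex_of_real (v' x) * rep_l2 h y)"
      by (intro continuous_intros continuous_on_subset[OF v(2)]) auto
    then show "continuous_on {0<..<1} (\<lambda>x. case (x, y) of (x, y) \<Rightarrow> unit_cut v' x * rep_l2 h y)"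
      by (rule continuous_on_eq) (auto simp: unit_cut_def)
  qed
qed

section \<open>Convergence of elementary tensors in the first factor\<close>

lemma unit_integral_tendsto:
  assumes "\<And>n. bounded_meas (u n)" "bounded_meas v"
    and "\<And>x. x \<in> {0<..<1} \<Longrightarrow> (\<lambda>n. u n x) \<longlonglongrightarrow> v x"
    and "\<And>n x. x \<in> {0<..<1} \<Longrightarrow> \<bar>u n x\<bar> \<le> B"
  shows "(\<lambda>n. LINT x:{0<..<1}|lborel. u n x) \<longlonglongrightarrow> (LINT x:{0<..<1}|lborel. v x)"
  unfolding set_lebesgue_integral_def
proof (rule integral_dominated_convergence)
  show "integrable lborel (\<lambda>x::real. indicator {0<..<1} x * B)"
    by (auto intro!: integrable_mult_left integrable_real_indicator)
  show "AE x in lborel. (\<lambda>n. indicator {0<..<1} x *\<^sub>R u n x) \<longlonglongrightarrow> indicator {0<..<1} x *\<^sub>R v x"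
    using assms(3) by (auto intro!: AE_I2 simp: indicator_def)
  show "AE x in lborel. norm (indicator {0<..<1} x *\<^sub>R u n x) \<le> indicator {0<..<1} x * B" for n
    using assms(4) by (auto intro!: AE_I2 simp: indicator_def)
  show "(\<lambda>x. indicator {0<..<1} x *\<^sub>R v x) \<in> borel_measurable lborel"
    using assms(2) by (auto simp: bounded_meas_def intro!: borel_measurable_scaleR borel_measurable_indicator)
  show "(\<lambda>x. indicator {0<..<1} x *\<^sub>R u n x) \<in> borel_measurable lborel" for n
    using assms(1)[of n] by (auto simp: bounded_meas_def intro!: borel_measurable_scaleR borel_measurable_indicator)
qed

lemma tens_fun_diff:
  assumes "bounded_meas u" "bounded_meas v" "bounded_meas (\<lambda>x. u x - v x)"
  shows "tens (\<lambda>x. u x - v x) h = tens u h - tens v h"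
  using tens_fun_add[OF assms(2,3), of h] assms by simp

lemma bounded_meas_diff:
  assumes "bounded_meas u" "bounded_meas v"
  shows "bounded_meas (\<lambda>x. u x - v x)"
proof -
  from assms obtain B C where "\<And>x. x \<in> {0<..<1} \<Longrightarrow> \<bar>u x\<bar> \<le> B" "\<And>x. x \<in> {0<..<1} \<Longrightarrow> \<bar>v x\<bar> \<le> C"
    unfolding bounded_meas_def by blast
  then have "\<forall>x\<in>{0<..<1}. \<bar>u x - v x\<bar> \<le> B + C" by (smt (verit))
  moreover have "(\<lambda>x. u x - v x) \<in> borel_measurable borel" using assms by (auto simp: bounded_meas_def)
  ultimately show ?thesis unfolding bounded_meas_def by blast
qed

text \<open>By \<open>norm_tens\<close> the squared distance is a one-variable integral times the
  squared norm of \<open>k\<close>, so dominated convergence on (0,1) is enough. The bound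
  \<open>B\<close> passes to the limit \<open>v\<close>, whence the dominating constant
  \<open>(2 * B)\<^sup>2\<close>.\<close>

lemma tens_tendsto:
  assumes u: "\<And>n. bounded_meas (u n)" "bounded_meas v"
    and lim: "\<And>x. x \<in> {0<..<1} \<Longrightarrow> (\<lambda>n. u n x) \<longlonglongrightarrow> v x"
    and B: "\<And>n x. x \<in> {0<..<1} \<Longrightarrow> \<bar>u n x\<bar> \<le> B"
  shows "(\<lambda>n. tens (u n) k) \<longlonglongrightarrow> tens v k"
proof -
  have d: "bounded_meas (\<lambda>x. u n x - v x)" for n by (intro bounded_meas_diff u)
  have le: "(u n x - v x)\<^sup>2 \<le> (2 * B)\<^sup>2" if x: "x \<in> {0<..<1}" for n x
  proof -
    have "\<bar>v x\<bar> \<le> B"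
      using LIMSEQ_le_const2[OF tendsto_rabs[OF lim[OF x]]] B[OF x] by blast
    then have "\<bar>u n x - v x\<bar> \<le> 2 * B" using B[OF x, of n] by linarith
    then show ?thesis by (rule power2_le_iff_abs_le[THEN iffD2, rotated]) (use B[OF x, of n] in linarith)
  qed
  have "(\<lambda>n. LINT x:{0<..<1}|lborel. (u n x - v x)\<^sup>2) \<longlonglongrightarrow> (LINT x:{0<..<1::real}|lborel. 0)"
  proof (rule unit_integral_tendsto[where u = "\<lambda>n x. (u n x - v x)\<^sup>2" and v = "\<lambda>_. 0" and B = "(2 * B)\<^sup>2"])
    show "bounded_meas (\<lambda>x. (u n x - v x)\<^sup>2)" for n
      unfolding power2_eq_square by (intro bounded_meas_mult d)
    show "bounded_meas (\<lambda>_. 0)" by (intro bounded_meas_continuous continuous_intros)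
    fix x :: real assume x: "x \<in> {0<..<1}"
    have "(\<lambda>n. (u n x - v x)\<^sup>2) \<longlonglongrightarrow> (v x - v x)\<^sup>2" by (intro tendsto_intros lim x)
    then show "(\<lambda>n. (u n x - v x)\<^sup>2) \<longlonglongrightarrow> 0" by simp
  qed (use le in auto)
  then have "(\<lambda>n. (LINT x:{0<..<1}|lborel. (u n x - v x)\<^sup>2) * (norm k)\<^sup>2) \<longlonglongrightarrow> 0 * (norm k)\<^sup>2"
    by (intro tendsto_mult tendsto_const) (simp add: set_lebesgue_integral_def)
  then have "(\<lambda>n. (norm (tens (u n) k - tens v k))\<^sup>2) \<longlonglongrightarrow> 0"
    by (simp add: norm_tens[OF d] tens_fun_diff[OF u(1) u(2) d, symmetric])
  then have "(\<lambda>n. sqrt ((norm (tens (u n) k - tens v k))\<^sup>2)) \<longlonglongrightarrow> sqrt 0"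
    by (rule tendsto_real_sqrt)
  then show ?thesis by (simp add: tendsto_norm_zero_iff LIM_zero_iff)
qed

lemma bounded_meas_indicator: "bounded_meas (indicator {a<..<b})"
  by (auto simp: bounded_meas_def indicator_def intro!: exI[of _ 1])

lemma tens_bump_seq_tendsto:
  assumes "bounded_meas v"
  shows "(\<lambda>n. tens (\<lambda>x. v x * bump_seq a b n x) k) \<longlonglongrightarrow> tens (\<lambda>x. v x * indicator {a<..<b} x) k"
proof -
  from assms obtain B where B: "\<And>x. x \<in> {0<..<1} \<Longrightarrow> \<bar>v x\<bar> \<le> B" unfolding bounded_meas_def by blast
  show ?thesis
  proof (rule tens_tendsto[where B = "B * 1"])
    fix n x assume x: "x \<in> {0<..<1::real}"
    show "\<bar>v x * bump_seq a b n x\<bar> \<le> B * 1"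
      unfolding abs_mult using B[OF x] by (intro mult_mono abs_bump_seq_le) auto
  qed (auto intro!: bounded_meas_mult assms bounded_meas_indicator rtest_bounded_meas[OF rtest_bump_seq] tendsto_intros bump_seq_tendsto)
qed

section \<open>Density and the deficiency spaces\<close>

lemma cinner_eq_0_sym: "cinner f g = 0 \<Longrightarrow> cinner g f = 0"
  using cinner_commute[of g f] by simp

lemma Int_stable_box: "Int_stable (range (\<lambda>(a, b). box a b :: 'a::euclidean_space set))"
proof (rule Int_stableI)
  fix A B :: "'a set" assume "A \<in> range (\<lambda>(a, b). box a b)" "B \<in> range (\<lambda>(a, b). box a b)"
  then obtain a b c d where "A = box a b" "B = box c d" by auto
  then show "A \<inter> B \<in> range (\<lambda>(a, b). box a b)" by (auto simp: box_Int_box)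
qed

text \<open>Boxes are stable under intersection and generate the Borel sets, so by Dynkin's argument
  all integrals over Borel sets vanish. Real and imaginary part then have the same set integrals as
  the function 0.\<close>

lemma integral_boxes_eq_0_imp_AE:
  fixes F :: "'a::euclidean_space \<Rightarrow> complex"
  assumes F: "integrable lborel F" and boxes: "\<And>a b. (LINT x:box a b|lborel. F x) = 0"
  shows "AE x in lborel. F x = 0"
proof -
  have [measurable]: "F \<in> borel_measurable borel" using F by auto
  have si: "set_integrable lborel A F" if "A \<in> sets borel" for A
    using F that unfolding set_integrable_def by (intro integrable_mult_indicator) auto
  \<comment> \<open>The complement step of Dynkin's argument needs the integral over the whole
    space, which is the limit over an increasing sequence of boxes.\<close>
  have univ: "(LINT x|lborel. F x) = 0"
  proof -
    define A where "A i = box (- (real i *\<^sub>R One)) (real i *\<^sub>R One :: 'a)" for i :: nat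
    have inc: "incseq A"
      unfolding A_def incseq_def by (intro allI impI subset_box_imp) (auto simp: inner_minus_left)
    have "(\<lambda>i. LINT x:A i|lborel. F x) \<longlonglongrightarrow> (LINT x:(\<Union>i. A i)|lborel. F x)"
      by (rule set_integral_cont_up[OF _ inc]) (simp_all add: A_def si borel_open open_UN)
    moreover have "(\<Union>i. A i) = UNIV"
      unfolding A_def by (rule UN_box_eq_UNIV)
    ultimately have "(\<lambda>i. 0) \<longlonglongrightarrow> (LINT x:UNIV|lborel. F x)"
      using boxes by (simp add: A_def)
    then show ?thesis by (simp add: LIMSEQ_const_iff set_lebesgue_integral_def)
  qed
  have int0: "(LINT x:A|lborel. F x) = 0" if "A \<in> sets borel" for A
  proof -
    have pow: "range (\<lambda>(a, b). box a b :: 'a set) \<subseteq> Pow UNIV" by simp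
    have "A \<in> sigma_sets UNIV (range (\<lambda>(a, b). box a b :: 'a set))"
      using that unfolding borel_eq_box by simp
    from Int_stable_box pow this show ?thesis
    proof (induction rule: sigma_sets_induct_disjoint)
      case (compl A)
      then have A: "A \<in> sets borel" unfolding borel_eq_box by simp
      have "(LINT x:A|lborel. F x) + (LINT x:UNIV - A|lborel. F x) = (LINT x:UNIV|lborel. F x)"
        using set_integral_Un[of A "UNIV - A" lborel F] A si by auto
      then show ?case using compl univ by (simp add: set_lebesgue_integral_def)
    next
      case (union A)
      then have A: "A i \<in> sets borel" for i unfolding borel_eq_box by auto
      have "(LINT x:(\<Union>i. A i)|lborel. F x) = (\<Sum>i. LINT x:A i|lborel. F x)"
        using union A by (intro lebesgue_integral_countable_add si) (auto simp: disjoint_family_on_def)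
      then show ?case using union by simp
    qed (auto simp: boxes, simp add: set_lebesgue_integral_def)
  qed
  have "AE x in lborel. Re (F x) = 0" "AE x in lborel. Im (F x) = 0"
  proof -
    have int: "integrable lborel (\<lambda>x. indicator A x *\<^sub>R F x)" "(\<integral>x. indicator A x *\<^sub>R F x \<partial>lborel) = 0"
      if "A \<in> sets borel" for A
      using si[OF that] int0[OF that] by (auto simp: set_integrable_def set_lebesgue_integral_def)
    have "(\<integral>x. Re (indicator A x *\<^sub>R F x) \<partial>lborel) = 0" "(\<integral>x. Im (indicator A x *\<^sub>R F x) \<partial>lborel) = 0"
      if "A \<in> sets borel" for A
      using integral_Re[OF int(1)[OF that]] integral_Im[OF int(1)[OF that]] int(2)[OF that] by simp_all
    then have "(LINT x:A|lborel. Re (F x)) = 0" "(LINT x:A|lborel. Im (F x)) = 0" if "A \<in> sets borel" for A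
      using that by (simp_all add: set_lebesgue_integral_def)
    then show "AE x in lborel. Re (F x) = 0" "AE x in lborel. Im (F x) = 0"
      using density_unique_real[of lborel "\<lambda>x. Re (F x)" "\<lambda>x. 0"]
        density_unique_real[of lborel "\<lambda>x. Im (F x)" "\<lambda>x. 0"] F
      by (auto simp: set_lebesgue_integral_def)
  qed
  then show ?thesis by eventually_elim (simp add: complex_eq_iff)
qed

text \<open>Bumps approximate indicators of intervals, so \<open>F\<close> is orthogonal to the
  indicator of an interval times \<Omega> intersected with a box, and hence has integral 0 over
  every box. Finite measure enters twice: these indicators are square integrable, and
  \<open>F\<close> itself becomes integrable.\<close>

lemma orthogonal_to_tests_eq_0:
  assumes \<Omega>: "\<Omega> \<in> sets lebesgue" "emeasure lebesgue \<Omega> < \<infinity>"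
    and F: "F \<in> L2 (cyl \<Omega>)"
    and orth: "\<And>u k. rtest u \<Longrightarrow> k \<in> L2 \<Omega> \<Longrightarrow> cinner (tens u k) F = 0"
  shows "F = 0"
proof -
  have one: "bounded_meas (\<lambda>x. 1)" by (intro bounded_meas_continuous continuous_intros)
  have 1: "cinner (tens (indicator {a<..<b}) k) F = 0" if k: "k \<in> L2 \<Omega>" for a b k
  proof -
    have "(\<lambda>n. tens (bump_seq a b n) k) \<longlonglongrightarrow> tens (indicator {a<..<b}) k"
      using tens_bump_seq_tendsto[OF one, of a b k] by simp
    then have "(\<lambda>n. cinner (tens (bump_seq a b n) k) F) \<longlonglongrightarrow> cinner (tens (indicator {a<..<b}) k) F"
      by (intro tendsto_intros)
    then show ?thesis
      using orth[OF rtest_bump_seq k] by (simp add: LIMSEQ_const_iff)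
  qed
  have indL2: "sq_integrable (\<lambda>y. complex_of_real (indicator (\<Omega> \<inter> B) y))" if "B \<in> sets borel" for B
  proof -
    have m: "\<Omega> \<inter> B \<in> sets lebesgue" using \<Omega>(1) that by auto
    have "emeasure lebesgue (\<Omega> \<inter> B) < \<infinity>"
      using emeasure_mono[of "\<Omega> \<inter> B" \<Omega> lebesgue] \<Omega> by (auto intro: le_less_trans)
    then have "integrable lebesgue (indicator (\<Omega> \<inter> B) :: 'a \<Rightarrow> real)"
      using m by (simp add: integrable_real_indicator)
    moreover have "(cmod (complex_of_real (indicator (\<Omega> \<inter> B) y)))\<^sup>2 = indicator (\<Omega> \<inter> B) y" for y
      by (simp add: indicator_def)
    ultimately show ?thesis unfolding sq_integrable_def
      using m by (auto intro!: borel_measurable_of_real borel_measurable_indicator)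
  qed
  define G where "G = rep_l2 F"
  have G: "sq_integrable G" unfolding G_def by (rule sq_integrable_rep)
  have G0: "AE z in lebesgue. z \<notin> cyl \<Omega> \<longrightarrow> G z = 0" using F by (simp add: L2_def G_def)
  have Gm: "G \<in> borel_measurable lebesgue" using G by (simp add: sq_integrable_def)
  have Gi: "integrable lebesgue G"
  proof -
    \<comment> \<open>The indicator of the cylinder: \<open>F\<close> is integrable as a product of
      two square integrable functions.\<close>
    let ?c = "\<lambda>(x, y). unit_cut (\<lambda>x. 1) x * complex_of_real (indicator (\<Omega> \<inter> UNIV) y)"
    have c: "sq_integrable ?c" by (intro sq_integrable_tens one indL2) simp
    have "AE z in lebesgue. cnj (?c z) * G z = G z"
      using G0 by eventually_elim (auto simp: unit_cut_def indicator_def)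
    then show ?thesis
      using sq_integrable_cnj_mult[OF c G] integrable_cong_AE[OF borel_measurable_integrable[OF sq_integrable_cnj_mult[OF c G]] Gm]
      by simp
  qed
  obtain g where gm: "g \<in> borel_measurable borel" and g: "AE z in lebesgue. G z = g z"
    using lebesgue_ex_borel_complex[OF Gm] by blast
  have gm': "g \<in> borel_measurable lborel" using gm by simp
  have gi: "integrable lborel g"
    using integrable_cong_AE[OF Gm measurable_completion[OF gm'] g] Gi by (simp add: integrable_completion[OF gm'])
  have "AE z in lborel. g z = 0"
  proof (rule integral_boxes_eq_0_imp_AE[OF gi])
    fix p q :: "real \<times> 'a"
    obtain a l b r where pq: "p = (a, l)" "q = (b, r)" by (cases p, cases q)
    have box: "box p q = {a<..<b} \<times> box l r"
      unfolding pq by (auto simp: box_def Basis_prod_def)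
    let ?k = "\<lambda>y. complex_of_real (indicator (\<Omega> \<inter> box l r) y)"
    have k: "sq_integrable ?k" by (rule indL2) simp
    have "abs_l2 ?k \<in> L2 \<Omega>" by (rule abs_l2_in_L2[OF k]) simp
    from 1[OF this, of a b] have "0 = cinner (tens (indicator {a<..<b}) (abs_l2 ?k)) (abs_l2 G)"
      by (simp add: G_def abs_rep_l2)
    also have "\<dots> = (\<integral>z. cnj (case z of (x, y) \<Rightarrow> unit_cut (indicator {a<..<b}) x * ?k y) * G z \<partial>lebesgue)"
      unfolding tens_abs_l2[OF bounded_meas_indicator k] by (intro cinner_abs_l2 sq_integrable_tens bounded_meas_indicator k G)
    also have "\<dots> = (\<integral>z. indicator (box p q) z *\<^sub>R g z \<partial>lebesgue)"
    proof (rule integral_cong_AE)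
      show "(\<lambda>z. cnj (case z of (x, y) \<Rightarrow> unit_cut (indicator {a<..<b}) x * ?k y) * G z) \<in> borel_measurable lebesgue"
        by (intro borel_measurable_integrable sq_integrable_cnj_mult sq_integrable_tens bounded_meas_indicator k G)
      show "(\<lambda>z. indicator (box p q) z *\<^sub>R g z) \<in> borel_measurable lebesgue"
        by (intro measurable_completion) (use gm in simp)
      show "AE z in lebesgue. cnj (case z of (x, y) \<Rightarrow> unit_cut (indicator {a<..<b}) x * ?k y) * G z
          = indicator (box p q) z *\<^sub>R g z"
        using g G0 by eventually_elim (auto simp: unit_cut_def indicator_def box split: if_splits)
    qed
    also have "\<dots> = (LINT z:box p q|lborel. g z)"
      unfolding set_lebesgue_integral_def by (intro integral_completion) (use gm in simp)
    finally show "(LINT z:box p q|lborel. g z) = 0" by simp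
  qed
  then have "AE z in lebesgue. G z = 0"
    using g unfolding AE_lebesgue_iff by eventually_elim simp
  then have "AE z in lebesgue. rep_l2 F z = rep_l2 0 z"
    using rep_l2_zero_AE unfolding G_def by eventually_elim simp
  then show ?thesis by (rule l2_eqI)
qed

lemma csubspace_Domain_D1: "csubspace (Domain (D1 \<Omega>))"
  unfolding csubspace_def using D1_zero D1_add D1_scaleC by blast

lemma Domain_D1_dense:
  assumes \<Omega>: "\<Omega> \<in> sets lebesgue" "emeasure lebesgue \<Omega> < \<infinity>"
  shows "L2 (cyl \<Omega>) \<subseteq> closure (Domain (D1 \<Omega>))"
proof
  fix f assume f: "f \<in> L2 (cyl \<Omega>)"
  have cl: "closure (Domain (D1 \<Omega>)) \<subseteq> L2 (cyl \<Omega>)"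
    by (intro closure_minimal closed_L2 cyl_sets_lebesgue \<Omega>(1)) (auto dest: D1_in_L2)
  obtain p where p: "p \<in> closure (Domain (D1 \<Omega>))" "\<And>s. s \<in> closure (Domain (D1 \<Omega>)) \<Longrightarrow> cinner (f - p) s = 0"
    using csubspace_proj_exists[OF csubspace_closure[OF csubspace_Domain_D1] closed_closure] by metis
  have "f - p = 0"
  proof (rule orthogonal_to_tests_eq_0[OF \<Omega>])
    show "f - p \<in> L2 (cyl \<Omega>)" by (rule csubspace_diff[OF csubspace_L2 f subsetD[OF cl p(1)]])
    fix u and k :: "'a l2" assume u: "rtest u" and k: "k \<in> L2 \<Omega>"
    obtain u' where "\<And>x. (u has_real_derivative u' x) (at x)" using rtest_deriv[OF u] by metis
    from D1_tens[OF \<Omega>(1) u this k] have "tens u k \<in> closure (Domain (D1 \<Omega>))"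
      by (intro subsetD[OF closure_subset] DomainI)
    then show "cinner (tens u k) (f - p) = 0" by (rule cinner_eq_0_sym[OF p(2)])
  qed
  then show "f \<in> closure (Domain (D1 \<Omega>))" using p by simp
qed

section \<open>Weak solutions of g' = -s g\<close>

lemma continuous_bounded_meas_exp: "bounded_meas (\<lambda>x. exp (c * x))"
  by (intro bounded_meas_continuous continuous_intros)

lemma set_integrable_bounded_meas:
  assumes "bounded_meas v"
  shows "set_integrable lborel {0<..<1} v"
proof -
  have "integrable lborel (\<lambda>x. Re (unit_cut v x))"
    by (intro integrable_Re unit_cut_integrable assms)
  then show ?thesis by (simp add: unit_cut_eq set_integrable_def)
qed

lemma unit_integral_exp_pos: "(LINT x:{0<..<1::real}|lborel. exp (c * x)) > 0"
proof -
  have m: "exp (- \<bar>c\<bar>) \<le> exp (c * x)" if "x \<in> {0<..<1}" for x :: real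
  proof -
    have "\<bar>c * x\<bar> \<le> \<bar>c\<bar>" using that by (simp add: abs_mult mult_left_le)
    then show ?thesis by simp
  qed
  have "0 < (LINT x:{0<..<1::real}|lborel. exp (- \<bar>c\<bar>))"
    by (simp add: set_lebesgue_integral_def)
  also have "\<dots> \<le> (LINT x:{0<..<1::real}|lborel. exp (c * x))"
  proof (rule set_integral_mono[OF _ _ m])
    show "set_integrable lborel {0<..<1::real} (\<lambda>x. exp (- \<bar>c\<bar>))"
      by (simp add: set_integrable_def integrable_mult_left integrable_real_indicator)
    show "set_integrable lborel {0<..<1::real} (\<lambda>x. exp (c * x))"
      by (rule set_integrable_bounded_meas[OF continuous_bounded_meas_exp])
  qed auto
  finally show ?thesis .
qed

lemma norm_tens_sqrt:
  assumes "bounded_meas u"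
  shows "norm (tens u h) = sqrt (LINT x:{0<..<1}|lborel. (u x)\<^sup>2) * norm h"
proof -
  have "norm (tens u h) = sqrt ((LINT x:{0<..<1}|lborel. (u x)\<^sup>2) * (norm h)\<^sup>2)"
    using norm_tens[OF assms, of h] by (metis norm_ge_zero real_sqrt_unique)
  then show ?thesis by (simp add: real_sqrt_mult)
qed

lemma bounded_linear_tens:
  assumes "bounded_meas u"
  shows "bounded_linear (tens u)"
  by (rule bounded_linear_intro[of _ "sqrt (LINT x:{0<..<1}|lborel. (u x)\<^sup>2)"])
     (simp_all add: tens_add[OF assms] scaleR_eq_scaleC tens_scaleC[OF assms] norm_tens_sqrt[OF assms])

text \<open>\<open>tens u\<close> multiplies all norms by the same positive constant, so it maps a
  complete space onto a complete one. Closedness is what permits projecting onto the expected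
  solutions.\<close>

lemma closed_tens_image:
  assumes \<Omega>: "\<Omega> \<in> sets lebesgue" and u: "bounded_meas u" "(LINT x:{0<..<1}|lborel. (u x)\<^sup>2) > 0"
  shows "closed (tens u ` L2 \<Omega>)"
proof (rule complete_imp_closed, rule complete_isometric_image)
  show "0 < sqrt (LINT x:{0<..<1}|lborel. (u x)\<^sup>2)" using u(2) by simp
  show "bounded_linear (tens u)" by (rule bounded_linear_tens[OF u(1)])
qed (auto simp: complete_eq_closed closed_L2[OF \<Omega>] csubspace_imp_subspace[OF csubspace_L2] norm_tens_sqrt[OF u(1)])

lemma csubspace_tens_image: "bounded_meas u \<Longrightarrow> csubspace (tens u ` L2 \<Omega>)"
  using csubspace_L2[of \<Omega>] unfolding csubspace_def
  by (auto simp flip: tens_add tens_scaleC intro!: image_eqI[of 0 _ 0])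

text \<open>The hypothesis says that g' = -s g weakly. Instead of being constructed by integration,
  \<open>h\<close> is read off the projection of \<open>g\<close> onto the tensors with
  \<open>E\<close>; it remains to see that the remainder \<open>r\<close> is 0. Conjugating by
  \<open>P\<close>, the inverse of \<open>E\<close>, turns d/dx - s into d/dx, so \<open>r\<close>
  pairs to 0 with \<open>P x * w x\<close> whenever \<open>w\<close> is the derivative of a test
  function, that is, has integral 0.\<close>

lemma deficiency_space:
  assumes \<Omega>: "\<Omega> \<in> sets lebesgue" "emeasure lebesgue \<Omega> < \<infinity>"
    and g: "g \<in> L2 (cyl \<Omega>)"
    and orth: "\<And>f f'. (f, f') \<in> D1 \<Omega> \<Longrightarrow> cinner (f' - complex_of_real s *\<^sub>C f) g = 0"
  obtains h where "h \<in> L2 \<Omega>" "g = tens (\<lambda>x. exp (- s * x)) h"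
proof -
  define E where "E x = exp (- s * x)" for x :: real
  define P where "P x = exp (s * x)" for x :: real
  have PE: "P x * E x = 1" for x by (simp add: P_def E_def flip: exp_add)
  have bE: "bounded_meas E" and bP: "bounded_meas P"
    using continuous_bounded_meas_exp[of "- s"] continuous_bounded_meas_exp[of s]
    by (simp_all add: E_def[abs_def] P_def[abs_def])
  have sE: "rsmooth E" and sP: "rsmooth P"
    using rsmooth_exp[of "- s"] rsmooth_exp[of s] by (simp_all add: E_def[abs_def] P_def[abs_def])
  have E2: "(LINT x:{0<..<1}|lborel. (E x)\<^sup>2) > 0"
  proof -
    have "(E x)\<^sup>2 = exp ((- 2 * s) * x)" for x
      by (simp add: E_def power2_eq_square flip: exp_add)
    then show ?thesis using unit_integral_exp_pos[of "- 2 * s"] by simp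
  qed
  from csubspace_proj_exists[OF csubspace_tens_image[OF bE] closed_tens_image[OF \<Omega>(1) bE E2]]
  obtain p where p: "p \<in> tens E ` L2 \<Omega>" "\<And>q. q \<in> tens E ` L2 \<Omega> \<Longrightarrow> cinner (g - p) q = 0" by metis
  then obtain h where h: "h \<in> L2 \<Omega>" "p = tens E h" by auto
  define r where "r = g - p"
  have rE: "cinner (tens E k) r = 0" if "k \<in> L2 \<Omega>" for k
    unfolding r_def using that by (intro cinner_eq_0_sym[OF p(2)] imageI)
  \<comment> \<open>The tensors with \<open>E\<close> satisfy the weak equation themselves, so
    \<open>r\<close> inherits it from \<open>g\<close>.\<close>
  have rD: "cinner (f' - complex_of_real s *\<^sub>C f) r = 0" if f: "(f, f') \<in> D1 \<Omega>" for f f'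
  proof -
    have "cinner f' (tens E h) + cinner f (tens (\<lambda>x. - s * E x) h) = 0"
    proof (rule D1_tens_skew[OF f])
      show "(E has_real_derivative - s * E x) (at x)" for x
        unfolding E_def by (auto intro!: derivative_eq_intros)
      show "continuous_on UNIV (\<lambda>x. - s * E x)" unfolding E_def by (intro continuous_intros)
    qed
    then have "cinner (f' - complex_of_real s *\<^sub>C f) (tens E h) = 0"
      using tens_fun_cmult[OF bE, of "- s" h] by (simp add: cinner_simps)
    then show ?thesis using orth[OF f] by (simp add: r_def h(2) cinner_diff_right)
  qed
  \<comment> \<open>With \<open>u\<close> a primitive of \<open>w\<close>, Leibniz's rule gives (P
    u)' - s P u = P w, so the weak equation tested on P u is the claim.\<close>
  have zero: "cinner (tens (\<lambda>x. P x * w x) k) r = 0"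
    if w: "rtest w" "(LINT x:{0<..<1}|lborel. w x) = 0" and k: "k \<in> L2 \<Omega>" for w k
  proof -
    obtain u where u: "rtest u" "\<And>x. (u has_real_derivative w x) (at x)"
      using rtest_antideriv[OF w] by metis
    have bu: "bounded_meas (\<lambda>x. P x * u x)" and bw: "bounded_meas (\<lambda>x. P x * w x)"
      by (intro bounded_meas_mult bP rtest_bounded_meas u w)+
    have sum: "bounded_meas (\<lambda>x. s * (P x * u x) + P x * w x)"
      using bounded_meas_diff[OF bounded_meas_mult[OF bounded_meas_continuous[of "\<lambda>_. s"] bu]
          bounded_meas_mult[OF bounded_meas_continuous[of "\<lambda>_. -1"] bw]] by simp
    have "(tens (\<lambda>x. P x * u x) k, tens (\<lambda>x. s * (P x * u x) + P x * w x) k) \<in> D1 \<Omega>"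
    proof (rule D1_tens[OF \<Omega>(1) rtest_mult[OF sP u(1)] _ k])
      fix x
      have "(P has_real_derivative s * P x) (at x)"
        unfolding P_def by (auto intro!: derivative_eq_intros)
      from DERIV_mult[OF this u(2)]
      show "((\<lambda>x. P x * u x) has_real_derivative s * (P x * u x) + P x * w x) (at x)"
        by (simp add: algebra_simps)
    qed
    from rD[OF this] show ?thesis
      using tens_fun_add[OF bounded_meas_mult[OF bounded_meas_continuous[of "\<lambda>_. s"] bu] bw, of k] sum
        tens_fun_cmult[OF bu, of s k] by simp
  qed
  have all: "cinner (tens (\<lambda>x. P x * u x) k) r = 0" if u: "rtest u" and k: "k \<in> L2 \<Omega>" for u k
  proof -
    \<comment> \<open>\<open>L\<close> is proportional to \<open>I\<close> on test functions; letting \<open>v n\<close> tend to \<open>\<lambda>x. exp (- 2 * s * x)\<close>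
      turns \<open>L\<close> into the pairing of \<open>r\<close> with \<open>tens E k\<close>, which vanishes, so the constant is \<open>0\<close>.\<close>
    define I where "I v = (LINT x:{0<..<1}|lborel. v x)" for v :: "real \<Rightarrow> real"
    define L where "L v = cinner (tens (\<lambda>x. P x * v x) k) r" for v
    have int: "set_integrable lborel {0<..<1} v" if "rtest v" for v
      by (rule set_integrable_bounded_meas[OF rtest_bounded_meas[OF that]])
    have ratio: "of_real (I v) * L u = of_real (I u) * L v" if v: "rtest v" for v
    proof -
      \<comment> \<open>The combination of \<open>u\<close> and \<open>v\<close> whose integral is
        0.\<close>
      define w where "w x = I v * u x + (- I u) * v x" for x
      have w: "rtest w" unfolding w_def
        by (intro rtest_add rtest_mult rsmooth_const u v)
      have "I w = 0"
        using int[OF u] int[OF v] unfolding w_def I_def by (simp add: set_integral_add set_integral_mult_right)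
      from zero[OF w this[unfolded I_def] k] have "cinner (tens (\<lambda>x. P x * w x) k) r = 0" .
      moreover have "tens (\<lambda>x. P x * w x) k
          = of_real (I v) *\<^sub>C tens (\<lambda>x. P x * u x) k + of_real (- I u) *\<^sub>C tens (\<lambda>x. P x * v x) k"
      proof -
        have b: "bounded_meas (\<lambda>x. P x * u x)" "bounded_meas (\<lambda>x. P x * v x)"
          by (intro bounded_meas_mult bP rtest_bounded_meas u v)+
        have b': "bounded_meas (\<lambda>x. I v * (P x * u x))" "bounded_meas (\<lambda>x. - I u * (P x * v x))"
          by (intro bounded_meas_mult b bounded_meas_continuous continuous_intros)+
        have "(\<lambda>x. P x * w x) = (\<lambda>x. I v * (P x * u x) + (- I u) * (P x * v x))"
          by (simp add: w_def algebra_simps)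
        moreover have "bounded_meas (\<lambda>x. P x * w x)" by (intro bounded_meas_mult bP rtest_bounded_meas w)
        ultimately show ?thesis
          using tens_fun_add[OF b', of k] tens_fun_cmult[OF b(1), of "I v" k] tens_fun_cmult[OF b(2), of "- I u" k]
          by simp
      qed
      ultimately show ?thesis by (simp add: L_def cinner_simps)
    qed
    define v where "v n x = (E x * E x) * bump_seq 0 1 n x" for n x
    have v: "rtest (v n)" for n
      unfolding v_def by (intro rtest_mult rsmooth_mult sE rtest_bump_seq)
    have "(\<lambda>n. L (v n)) \<longlonglongrightarrow> cinner (tens (\<lambda>x. E x * indicator {0<..<1} x) k) r"
    proof -
      have "(\<lambda>x. P x * v n x) = (\<lambda>x. E x * bump_seq 0 1 n x)" for n
        using PE by (auto simp: v_def fun_eq_iff mult.assoc[symmetric])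
      then show ?thesis unfolding L_def
        using tens_bump_seq_tendsto[OF bE, of 0 1 k] by (auto intro!: tendsto_cinner)
    qed
    moreover have "tens (\<lambda>x. E x * indicator {0<..<1} x) k = tens E k"
      unfolding tens_def by (rule arg_cong[where f = abs_l2]) auto
    ultimately have L: "(\<lambda>n. L (v n)) \<longlonglongrightarrow> 0" using rE[OF k] by simp
    have "(\<lambda>n. I (v n)) \<longlonglongrightarrow> I (\<lambda>x. E x * E x)"
      unfolding I_def
    proof (rule unit_integral_tendsto)
      show "bounded_meas (v n)" for n by (rule rtest_bounded_meas[OF v])
      show "bounded_meas (\<lambda>x. E x * E x)" by (intro bounded_meas_mult bE)
      show "(\<lambda>n. v n x) \<longlonglongrightarrow> E x * E x" if "x \<in> {0<..<1}" for x
        using tendsto_mult[OF tendsto_const bump_seq_tendsto[OF that, of 0 1], of "E x * E x"] that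
        by (simp add: v_def)
      show "\<bar>v n x\<bar> \<le> (exp \<bar>s\<bar> * exp \<bar>s\<bar>) * 1" if x: "x \<in> {0<..<1}" for n x
      proof -
        have "\<bar>s * x\<bar> \<le> \<bar>s\<bar>" using x by (simp add: abs_mult mult_left_le)
        then have "E x \<le> exp \<bar>s\<bar>" "0 \<le> E x" by (auto simp: E_def)
        then show ?thesis unfolding v_def abs_mult by (intro mult_mono abs_bump_seq_le) auto
      qed
    qed
    then have "(\<lambda>n. of_real (I (v n)) * L u) \<longlonglongrightarrow> of_real (I (\<lambda>x. E x * E x)) * L u"
      by (intro tendsto_intros)
    moreover have "(\<lambda>n. of_real (I u) * L (v n)) \<longlonglongrightarrow> of_real (I u) * 0"
      by (intro tendsto_intros L)
    ultimately have "of_real (I (\<lambda>x. E x * E x)) * L u = 0"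
      unfolding ratio[OF v] using LIMSEQ_unique by fastforce
    then show ?thesis using E2 by (simp add: I_def L_def power2_eq_square)
  qed
  have "r = 0"
  proof (rule orthogonal_to_tests_eq_0[OF \<Omega>])
    show "r \<in> L2 (cyl \<Omega>)"
      unfolding r_def h(2) by (intro csubspace_diff csubspace_L2 g tens_in_L2 bE h)
    fix u and k :: "'a l2" assume u: "rtest u" and k: "k \<in> L2 \<Omega>"
    have "(\<lambda>x. P x * (E x * u x)) = u" using PE by (simp add: fun_eq_iff flip: mult.assoc)
    then show "cinner (tens u k) r = 0"
      using all[OF rtest_mult[OF sE u] k] by simp
  qed
  then show thesis using that[OF h(1)] h(2) by (simp add: r_def E_def[abs_def])
qed

section \<open>Skew-adjoint graphs\<close>

text \<open>\<open>operator_graph\<close> stripped of the ambient space and of single-valuedness: it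
  must also fit annihilators, which may be multivalued, and the relation between h and k.\<close>

definition lin_graph :: "('a::euclidean_space l2 \<times> 'a l2) set \<Rightarrow> bool" where
  "lin_graph G \<longleftrightarrow> (0, 0) \<in> G \<and>
     (\<forall>f f' g g'. (f, f') \<in> G \<longrightarrow> (g, g') \<in> G \<longrightarrow> (f + g, f' + g') \<in> G) \<and>
     (\<forall>c f f'. (f, f') \<in> G \<longrightarrow> (c *\<^sub>C f, c *\<^sub>C f') \<in> G)"

lemma lin_graph_add: "lin_graph G \<Longrightarrow> (f, f') \<in> G \<Longrightarrow> (g, g') \<in> G \<Longrightarrow> (f + g, f' + g') \<in> G"
  and lin_graph_scaleC: "lin_graph G \<Longrightarrow> (f, f') \<in> G \<Longrightarrow> (c *\<^sub>C f, c *\<^sub>C f') \<in> G"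
  and lin_graph_zero: "lin_graph G \<Longrightarrow> (0, 0) \<in> G"
  unfolding lin_graph_def by blast+

lemma lin_graph_diff:
  assumes "lin_graph G" "(f, f') \<in> G" "(g, g') \<in> G"
  shows "(f - g, f' - g') \<in> G"
  using lin_graph_add[OF assms(1,2) lin_graph_scaleC[OF assms(1,3), of "- 1"]]
  by (simp add: scaleC_minus_one)

definition bform :: "'a::euclidean_space l2 \<times> 'a l2 \<Rightarrow> 'a l2 \<times> 'a l2 \<Rightarrow> complex" where
  "bform X Y = cinner (fst X) (snd Y) + cinner (snd X) (fst Y)"

definition skew_adj ::
    "'a::euclidean_space l2 set \<Rightarrow> ('a l2 \<times> 'a l2) set \<Rightarrow> ('a l2 \<times> 'a l2) set" where
  "skew_adj K G = {X. fst X \<in> K \<and> snd X \<in> K \<and> (\<forall>Y\<in>G. bform X Y = 0)}"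

lemma bform_add_left: "bform (X + Y) Z = bform X Z + bform Y Z"
  and bform_add_right: "bform Z (X + Y) = bform Z X + bform Z Y"
  by (simp_all add: bform_def cinner_simps)

lemma bform_commute: "bform X Y = cnj (bform Y X)"
  unfolding bform_def using cinner_commute[of "fst X" "snd Y"] cinner_commute[of "snd X" "fst Y"] by simp

lemma bform_eq_0_sym: "bform X Y = 0 \<Longrightarrow> bform Y X = 0"
  using bform_commute[of Y X] by simp

lemma closed_bform_left: "closed {X. bform X Y = 0}"
  unfolding bform_def by (intro closed_Collect_eq continuous_intros)

lemma closed_skew_adj:
  assumes "closed K"
  shows "closed (skew_adj K G)"
proof -
  have "skew_adj K G = K \<times> K \<inter> (\<Inter>Y\<in>G. {X. bform X Y = 0})"
    unfolding skew_adj_def by (auto simp: mem_Times_iff)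
  then show ?thesis
    using assms closed_bform_left by (auto intro!: closed_Int closed_Times closed_INT)
qed

lemma lin_graph_skew_adj:
  assumes "csubspace K"
  shows "lin_graph (skew_adj K G)"
proof -
  have "bform (0, 0) Y = 0" for Y :: "'a l2 \<times> 'a l2" by (simp add: bform_def)
  moreover have "bform (f + g, f' + g') Y = bform (f, f') Y + bform (g, g') Y" for f f' g g' and Y :: "'a l2 \<times> 'a l2"
    by (simp add: bform_def cinner_simps)
  moreover have "bform (c *\<^sub>C f, c *\<^sub>C f') Y = cnj c * bform (f, f') Y" for c f f' and Y :: "'a l2 \<times> 'a l2"
    by (simp add: bform_def cinner_simps distrib_left)
  ultimately show ?thesis
    using assms unfolding lin_graph_def skew_adj_def csubspace_def by simp
qed

lemma skew_adj_antimono: "G \<subseteq> G' \<Longrightarrow> skew_adj K G' \<subseteq> skew_adj K G"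
  unfolding skew_adj_def by blast

text \<open>Pairing \<open>(f, a)\<close> and \<open>(f, b)\<close> with an arbitrary element
  \<open>(g, g')\<close> of the graph shows that \<open>a - b\<close> is orthogonal to the domain,
  which is dense.\<close>

lemma single_valued_skew:
  assumes K: "csubspace K" "K \<subseteq> closure (Domain G)" and G: "G \<subseteq> skew_adj K G"
  shows "single_valued G"
proof (rule single_valuedI)
  fix f a b assume ab: "(f, a) \<in> G" "(f, b) \<in> G"
  then have "a - b \<in> K" using G K(1) unfolding skew_adj_def by (force intro: csubspace_diff)
  then have "a - b \<in> closure (Domain G)" using K(2) by blast
  moreover have "closure (Domain G) \<subseteq> {g. cinner g (a - b) = 0}"
  proof (rule closure_minimal)
    show "closed {g. cinner g (a - b) = 0}" by (intro closed_Collect_eq continuous_intros)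
    show "Domain G \<subseteq> {g. cinner g (a - b) = 0}"
    proof
      fix g assume "g \<in> Domain G"
      then obtain g' where "(g, g') \<in> G" by blast
      then have "bform (g, g') (f, a) = 0" "bform (g, g') (f, b) = 0"
        using G ab unfolding skew_adj_def by blast+
      then have "cinner g a = cinner g b" by (simp add: bform_def) (metis add_right_cancel)
      then show "g \<in> {g. cinner g (a - b) = 0}" by (simp add: cinner_simps)
    qed
  qed
  ultimately show "a = b" by force
qed

section \<open>Passage between H and B = iH\<close>

definition mul_i :: "'a::euclidean_space l2 \<times> 'a l2 \<Rightarrow> 'a l2 \<times> 'a l2" where
  "mul_i X = (fst X, \<i> *\<^sub>C snd X)"

definition div_i :: "'a::euclidean_space l2 \<times> 'a l2 \<Rightarrow> 'a l2 \<times> 'a l2" where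
  "div_i X = (fst X, (1 / \<i>) *\<^sub>C snd X)"

lemma mul_div_i [simp]: "mul_i (div_i X) = X" and div_mul_i [simp]: "div_i (mul_i X) = X"
  by (simp_all add: mul_i_def div_i_def)

lemma mem_div_i_image: "X \<in> div_i ` G \<longleftrightarrow> mul_i X \<in> G"
  by (metis div_mul_i image_iff mul_div_i)

lemma mul_i_div_i_image [simp]: "mul_i ` div_i ` G = G" and div_i_mul_i_image [simp]: "div_i ` mul_i ` G = G"
  by (simp_all add: image_image)

lemma Domain_div_i [simp]: "Domain (div_i ` G) = Domain G"
  by (force simp: div_i_def Domain_fst)

lemma continuous_on_div_i: "continuous_on S div_i" and continuous_on_mul_i: "continuous_on S mul_i"
  unfolding div_i_def mul_i_def by (intro continuous_intros)+

lemma closed_div_i_image: "closed G \<Longrightarrow> closed (div_i ` G)"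
proof -
  assume "closed G"
  moreover have "div_i ` G = mul_i -` G" using mem_div_i_image by blast
  ultimately show ?thesis using closed_vimage[OF _ continuous_on_mul_i] by metis
qed

text \<open>For \<open>X = (g, g')\<close> the form \<open>bform (mul_i X) (f, f')\<close> is i
  times the difference of the two sides of the adjoint relation for \<open>X\<close> and
  \<open>div_i (f, f')\<close>.\<close>

lemma adjoint_graph_div_i:
  assumes K: "csubspace K"
  shows "adjoint_graph K (div_i ` B) = div_i ` skew_adj K B"
proof -
  have "X \<in> adjoint_graph K (div_i ` B) \<longleftrightarrow> mul_i X \<in> skew_adj K B" for X
  proof -
    obtain g g' where X: "X = (g, g')" by (cases X)
    have mem: "g' \<in> K \<longleftrightarrow> \<i> *\<^sub>C g' \<in> K"
    proof
      assume "\<i> *\<^sub>C g' \<in> K"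
      then have "(- \<i>) *\<^sub>C \<i> *\<^sub>C g' \<in> K" using K unfolding csubspace_def by blast
      then show "g' \<in> K" by simp
    qed (use K in \<open>simp add: csubspace_def\<close>)
    have eq: "cinner g ((1 / \<i>) *\<^sub>C f') = cinner g' f \<longleftrightarrow> bform (mul_i X) (f, f') = 0" for f f'
    proof -
      have "bform (mul_i X) (f, f') = \<i> * (cinner g ((1 / \<i>) *\<^sub>C f') - cinner g' f)"
        by (simp add: X mul_i_def bform_def cinner_simps algebra_simps)
      then show ?thesis by simp
    qed
    have "X \<in> adjoint_graph K (div_i ` B) \<longleftrightarrow>
        g \<in> K \<and> g' \<in> K \<and> (\<forall>(f, f')\<in>B. cinner g ((1 / \<i>) *\<^sub>C f') = cinner g' f)"
      unfolding adjoint_graph_def X by (auto simp: div_i_def)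
    also have "\<dots> \<longleftrightarrow> mul_i X \<in> skew_adj K B"
      unfolding skew_adj_def eq using mem by (auto simp: mul_i_def X)
    finally show ?thesis .
  qed
  then show ?thesis using mem_div_i_image by blast
qed

lemma operator_graph_div_i:
  assumes K: "csubspace K" and B: "lin_graph B" "B \<subseteq> skew_adj K B" "K \<subseteq> closure (Domain B)"
  shows "operator_graph K (div_i ` B)"
proof -
  have "single_valued B" by (rule single_valued_skew[OF K B(3,2)])
  then have "single_valued (div_i ` B)"
    by (fastforce simp: single_valued_def div_i_def)
  moreover have "div_i ` B \<subseteq> K \<times> K"
    using B(2) K unfolding skew_adj_def by (auto simp: div_i_def csubspace_def)
  moreover have "(0, 0) \<in> div_i ` B"
    using lin_graph_zero[OF B(1)] by (simp add: mem_div_i_image mul_i_def)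
  moreover have "(f + g, f' + g') \<in> div_i ` B" if "(f, f') \<in> div_i ` B" "(g, g') \<in> div_i ` B" for f f' g g'
    using that lin_graph_add[OF B(1)] by (auto simp: mem_div_i_image mul_i_def scaleC_add_right)
  moreover have "(c *\<^sub>C f, c *\<^sub>C f') \<in> div_i ` B" if "(f, f') \<in> div_i ` B" for f f' c
    using that lin_graph_scaleC[OF B(1), of f "\<i> *\<^sub>C f'" c] by (simp add: mem_div_i_image mul_i_def mult.commute)
  ultimately show ?thesis unfolding operator_graph_def by blast
qed

lemma self_adjoint_div_i:
  assumes K: "csubspace K" and B: "skew_adj K B = B" "K \<subseteq> closure (Domain B)"
  shows "self_adjoint_op K (div_i ` B)"
proof -
  have "lin_graph B" using lin_graph_skew_adj[OF K, of B] B(1) by simp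
  then show ?thesis
    unfolding self_adjoint_op_def densely_defined_def
    using operator_graph_div_i[OF K _ _ B(2)] B adjoint_graph_div_i[OF K, of B] by simp
qed

lemma skew_adj_mul_i:
  assumes K: "csubspace K" and H: "self_adjoint_op K H"
  shows "skew_adj K (mul_i ` H) = mul_i ` H"
proof -
  have "div_i ` skew_adj K (mul_i ` H) = H"
    using adjoint_graph_div_i[OF K, of "mul_i ` H"] H by (simp add: self_adjoint_op_def)
  then show ?thesis using mul_i_div_i_image by metis
qed

lemma S_op_eq: "S_op \<Omega> = div_i ` D1 \<Omega>"
  unfolding S_op_def div_i_def by force

text \<open>Maximality makes the domain closed, since limits of compatible pairs are compatible. If
  p is the projection of h onto the domain, the pair \<open>(h - p, 0)\<close> is compatible with
  all of \<open>L\<close>, hence belongs to it, and isometry forces h = p.\<close>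

lemma maximal_isometric_relation_total:
  assumes N: "csubspace N" "closed N" and L: "L \<subseteq> N \<times> N" "lin_graph L"
    and iso: "\<And>h k h' k'. (h, k) \<in> L \<Longrightarrow> (h', k') \<in> L \<Longrightarrow> cinner h h' = cinner k k'"
    and max: "\<And>h k. h \<in> N \<Longrightarrow> k \<in> N \<Longrightarrow>
      (\<And>h' k'. (h', k') \<in> L \<Longrightarrow> cinner h h' = cinner k k') \<Longrightarrow> (h, k) \<in> L"
  shows "Domain L = N"
proof
  show "Domain L \<subseteq> N" using L(1) by blast
  have sub: "csubspace (Domain L)"
    unfolding csubspace_def
    using lin_graph_zero[OF L(2)] lin_graph_add[OF L(2)] lin_graph_scaleC[OF L(2)] by blast
  have norm: "norm k = norm h" if "(h, k) \<in> L" for h k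
    using iso[OF that that] by (simp add: cinner_self power2_eq_iff_nonneg flip: of_real_power)
  have cl: "closed (Domain L)"
    unfolding closed_sequential_limits
  proof (intro allI impI, elim conjE)
    fix a l assume a: "\<forall>n. a n \<in> Domain L" and al: "a \<longlonglongrightarrow> l"
    then obtain b where b: "\<And>n. (a n, b n) \<in> L" unfolding Domain_iff by metis
    have "dist (b m) (b n) = dist (a m) (a n)" for m n
      using norm[OF lin_graph_diff[OF L(2) b b], of m n] by (simp add: dist_norm)
    then have "Cauchy b" using LIMSEQ_imp_Cauchy[OF al] by (simp add: Cauchy_def)
    then obtain m where bm: "b \<longlonglongrightarrow> m" using Cauchy_convergent convergentD by blast
    have "(l, m) \<in> L"
    proof (rule max)
      show "l \<in> N" using N(2) al a L(1) unfolding closed_sequential_limits by blast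
      show "m \<in> N" using N(2) bm b L(1) unfolding closed_sequential_limits by blast
      fix h' k' assume hk: "(h', k') \<in> L"
      have "(\<lambda>n. cinner (a n) h') \<longlonglongrightarrow> cinner l h'" "(\<lambda>n. cinner (b n) k') \<longlonglongrightarrow> cinner m k'"
        by (intro tendsto_intros al bm)+
      then show "cinner l h' = cinner m k'" using iso[OF b hk] LIMSEQ_unique by simp
    qed
    then show "l \<in> Domain L" by blast
  qed
  show "N \<subseteq> Domain L"
  proof
    fix h assume h: "h \<in> N"
    obtain p where p: "p \<in> Domain L" "\<And>s. s \<in> Domain L \<Longrightarrow> cinner (h - p) s = 0"
      using csubspace_proj_exists[OF sub cl] by metis
    have "(h - p, 0) \<in> L"
    proof (rule max)
      show "h - p \<in> N" using N(1) h p(1) L(1) by (intro csubspace_diff) auto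
      show "0 \<in> N" using N(1) by (simp add: csubspace_def)
    qed (use p(2) in auto)
    from norm[OF this] show "h \<in> Domain L" using p(1) by simp
  qed
qed

section \<open>Defect elements and the annihilator of the minimal graph\<close>

abbreviation tens_plus :: "'b::euclidean_space l2 \<Rightarrow> (real \<times> 'b) l2" where
  "tens_plus \<equiv> tens exp"

abbreviation tens_minus :: "'b::euclidean_space l2 \<Rightarrow> (real \<times> 'b) l2" where
  "tens_minus \<equiv> tens (\<lambda>x. exp (1 - x))"

lemma bounded_meas_exp: "bounded_meas exp"
  by (intro bounded_meas_continuous continuous_intros)

lemma bounded_meas_exp': "bounded_meas (\<lambda>x. exp (1 - x))"
  by (intro bounded_meas_continuous continuous_intros)

definition defect :: "'b::euclidean_space l2 \<Rightarrow> 'b l2 \<Rightarrow> (real \<times> 'b) l2 \<times> (real \<times> 'b) l2" where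
  "defect h k = (tens_plus h + tens_minus k, tens_plus h - tens_minus k)"

lemma defect_add: "defect (h + h') (k + k') = defect h k + defect h' k'"
  by (simp add: defect_def tens_add bounded_meas_exp bounded_meas_exp')

lemma defect_scaleC: "defect (c *\<^sub>C h) (c *\<^sub>C k) = (c *\<^sub>C fst (defect h k), c *\<^sub>C snd (defect h k))"
  by (simp add: defect_def tens_scaleC bounded_meas_exp bounded_meas_exp' scaleC_add_right scaleC_diff_right)

lemma defect_zero [simp]: "defect 0 0 = 0"
  by (simp add: defect_def bounded_meas_exp bounded_meas_exp' zero_prod_def)

lemma unit_integral_exp_sq:
  "(LINT x:{0<..<1}|lborel. exp x * exp x) = (exp 2 - 1) / (2::real)"
  "(LINT x:{0<..<1}|lborel. exp (1 - x) * exp (1 - x)) = (exp 2 - 1) / (2::real)"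
proof -
  have *: "(LINT x:{0<..<1}|lborel. f x) = F 1 - F 0"
    if "\<And>x. (F has_real_derivative f x) (at x)" "continuous_on {0..1} f" for f F :: "real \<Rightarrow> real"
  proof -
    have "(LBINT x=ereal 0..ereal 1. f x) = F 1 - F 0"
      using that by (intro interval_integral_FTC_finite)
        (auto simp flip: has_real_derivative_iff_has_vector_derivative intro: has_field_derivative_at_within)
    then show ?thesis unfolding interval_lebesgue_integral_def einterval_eq by simp
  qed
  have "(LINT x:{0<..<1}|lborel. exp x * exp x) = exp (2 * 1) / 2 - exp (2 * 0) / (2::real)"
    by (rule *) (auto intro!: derivative_eq_intros continuous_intros simp flip: exp_add)
  then show "(LINT x:{0<..<1}|lborel. exp x * exp x) = (exp 2 - 1) / (2::real)" by simp
  have "(LINT x:{0<..<1}|lborel. exp (1 - x) * exp (1 - x))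
      = - exp (2 - 2 * 1) / 2 - (- exp (2 - 2 * 0) / (2::real))"
    by (rule *) (auto intro!: derivative_eq_intros continuous_intros simp flip: exp_add)
  then show "(LINT x:{0<..<1}|lborel. exp (1 - x) * exp (1 - x)) = (exp 2 - 1) / (2::real)" by simp
qed

text \<open>The mixed pairings of the two exponentials cancel between the two halves of the form;
  what remains is twice the common integral (e^2 - 1)/2.\<close>

lemma bform_defect:
  "bform (defect h k) (defect h' k') = complex_of_real (exp 2 - 1) * (cinner h h' - cinner k k')"
proof -
  note b = bounded_meas_exp bounded_meas_exp'
  have "bform (defect h k) (defect h' k') = 2 * cinner (tens_plus h) (tens_plus h') - 2 * cinner (tens_minus k) (tens_minus k')"
    by (simp add: bform_def defect_def cinner_simps)
  also have "\<dots> = complex_of_real (exp 2 - 1) * (cinner h h' - cinner k k')"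
    unfolding cinner_tens[OF b(1) b(1)] cinner_tens[OF b(2) b(2)] unit_integral_exp_sq
    by (simp add: field_simps)
  finally show ?thesis .
qed

lemma bform_defect_eq_0_iff: "bform (defect h k) (defect h' k') = 0 \<longleftrightarrow> cinner h h' = cinner k k'"
proof -
  have "exp 2 - 1 \<noteq> (0::real)" by simp
  then show ?thesis unfolding bform_defect by (simp del: exp_eq_one_iff flip: of_real_eq_0_iff)
qed

lemma lin_graph_D1: "lin_graph (D1 \<Omega>)"
  unfolding lin_graph_def using D1_zero D1_add D1_scaleC by blast

lemma D1_subset_skew_adj: "D1 \<Omega> \<subseteq> skew_adj (L2 (cyl \<Omega>)) (D1 \<Omega>)"
proof
  fix X assume X: "X \<in> D1 \<Omega>"
  obtain f f' where f: "X = (f, f')" by (cases X)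
  have "bform X Y = 0" if "Y \<in> D1 \<Omega>" for Y
    using D1_skew[of f f' \<Omega> "fst Y" "snd Y"] X that by (simp add: f bform_def add.commute)
  then show "X \<in> skew_adj (L2 (cyl \<Omega>)) (D1 \<Omega>)"
    using X D1_in_L2[of f f' \<Omega>] by (simp add: skew_adj_def f)
qed

lemma defect_in_skew_adj:
  assumes "h \<in> L2 \<Omega>" "k \<in> L2 \<Omega>"
  shows "defect h k \<in> skew_adj (L2 (cyl \<Omega>)) (D1 \<Omega>)"
proof -
  note b = bounded_meas_exp bounded_meas_exp'
  have 1: "tens_plus h \<in> L2 (cyl \<Omega>)" "tens_minus k \<in> L2 (cyl \<Omega>)"
    by (intro tens_in_L2 b assms)+
  have "bform (defect h k) Y = 0" if Y: "Y \<in> D1 \<Omega>" for Y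
  proof -
    obtain f f' where f: "Y = (f, f')" by (cases Y)
    have d: "(f, f') \<in> D1 \<Omega>" using Y f by simp
    have "cinner f' (tens_plus h) + cinner f (tens_plus h) = 0"
      by (rule D1_tens_skew[OF d]) (auto intro!: derivative_eq_intros continuous_intros)
    moreover have "cinner f' (tens_minus k) + cinner f (tens (\<lambda>x. (- 1) * exp (1 - x)) k) = 0"
      by (rule D1_tens_skew[OF d]) (auto intro!: derivative_eq_intros continuous_intros)
    then have "cinner f' (tens_minus k) - cinner f (tens_minus k) = 0"
      unfolding tens_fun_cmult[OF b(2)] by (simp add: cinner_simps)
    ultimately have "bform Y (defect h k) = 0"
      by (simp add: f bform_def defect_def cinner_simps algebra_simps)
    then show ?thesis by (rule bform_eq_0_sym)
  qed
  then show ?thesis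
    using 1 csubspace_L2[of "cyl \<Omega>"] csubspace_diff[OF csubspace_L2 1]
    by (simp add: skew_adj_def defect_def csubspace_def)
qed

lemma bform_closure_D1:
  assumes "X \<in> closure (D1 \<Omega>)" "Y \<in> skew_adj (L2 (cyl \<Omega>)) (D1 \<Omega>)"
  shows "bform X Y = 0"
proof -
  have "D1 \<Omega> \<subseteq> {X. bform X Y = 0}"
    using assms(2) unfolding skew_adj_def by (auto intro: bform_eq_0_sym)
  then have "closure (D1 \<Omega>) \<subseteq> {X. bform X Y = 0}"
    by (intro closure_minimal closed_bform_left)
  then show ?thesis using assms(1) by blast
qed

lemma closure_D1_subset_skew_adj:
  assumes "\<Omega> \<in> sets lebesgue"
  shows "closure (D1 \<Omega>) \<subseteq> skew_adj (L2 (cyl \<Omega>)) (D1 \<Omega>)"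
  by (intro closure_minimal D1_subset_skew_adj closed_skew_adj closed_L2 cyl_sets_lebesgue assms)

text \<open>The real counterpart of \<open>csubspace_closure\<close>, for subsets of the product of
  two copies of \<open>l2\<close>.\<close>

lemma subspace_closure:
  fixes S :: "'a::real_normed_vector set"
  assumes "subspace S"
  shows "subspace (closure S)"
  unfolding subspace_def
proof (intro conjI ballI allI)
  show "0 \<in> closure S" using subspace_0[OF assms] closure_subset by blast
next
  fix x y assume xy: "x \<in> closure S" "y \<in> closure S"
  obtain a b where "\<And>n. a n \<in> S" "a \<longlonglongrightarrow> x" "\<And>n. b n \<in> S" "b \<longlonglongrightarrow> y"
    using xy unfolding closure_sequential by metis
  then show "x + y \<in> closure S" unfolding closure_sequential
    by (intro exI[of _ "\<lambda>n. a n + b n"]) (auto intro: subspace_add[OF assms] tendsto_add)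
next
  fix c :: real and x assume x: "x \<in> closure S"
  obtain a where "\<And>n. a n \<in> S" "a \<longlonglongrightarrow> x" using x unfolding closure_sequential by metis
  then show "c *\<^sub>R x \<in> closure S" unfolding closure_sequential
    by (intro exI[of _ "\<lambda>n. c *\<^sub>R a n"]) (auto intro: subspace_mul[OF assms] tendsto_scaleR)
qed

text \<open>Von Neumann's decomposition. The remainder (g, g') of the projection satisfies two
  relations on \<open>D1 \<Omega>\<close>: the form vanishes, and so does the inner product of
  pairs. Their sum and difference decouple into one weak equation for g + g' and one for g -
  g'.\<close>

lemma skew_adj_D1_decomp:
  assumes \<Omega>: "\<Omega> \<in> sets lebesgue" "emeasure lebesgue \<Omega> < \<infinity>"
    and X: "X \<in> skew_adj (L2 (cyl \<Omega>)) (D1 \<Omega>)"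
  obtains \<phi> h k where "\<phi> \<in> closure (D1 \<Omega>)" "h \<in> L2 \<Omega>" "k \<in> L2 \<Omega>" "X = \<phi> + defect h k"
proof -
  let ?K = "L2 (cyl \<Omega>)"
  have "subspace (D1 \<Omega>)"
    unfolding subspace_def using lin_graph_D1[of \<Omega>]
    by (auto simp: lin_graph_def zero_prod_def scaleR_prod_def plus_prod_def scaleR_eq_scaleC)
  then have "subspace (closure (D1 \<Omega>))" by (rule subspace_closure)
  from subspace_proj_exists[OF this closed_closure]
  obtain p where p: "p \<in> closure (D1 \<Omega>)" "\<And>s. s \<in> closure (D1 \<Omega>) \<Longrightarrow> inner (X - p) s = 0" by metis
  obtain g g' where g: "X - p = (g, g')" by (cases "X - p")
  have "p \<in> skew_adj ?K (D1 \<Omega>)" using closure_D1_subset_skew_adj[OF \<Omega>(1)] p(1) by blast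
  then have "(fst X - fst p, snd X - snd p) \<in> skew_adj ?K (D1 \<Omega>)"
    using X by (intro lin_graph_diff[OF lin_graph_skew_adj[OF csubspace_L2]]) simp_all
  then have gX: "(g, g') \<in> skew_adj ?K (D1 \<Omega>)" using g by (simp add: minus_prod_def)
  then have gK: "g \<in> ?K" "g' \<in> ?K" by (simp_all add: skew_adj_def)
  have gM: "cinner g f' + cinner g' f = 0" if "(f, f') \<in> D1 \<Omega>" for f f'
  proof -
    have "bform (g, g') (f, f') = 0" using gX that unfolding skew_adj_def by blast
    then show ?thesis by (simp add: bform_def)
  qed
  have orth: "cinner g f + cinner g' f' = 0" if f: "(f, f') \<in> D1 \<Omega>" for f f'
  proof -
    \<comment> \<open>The projection took place in the real Hilbert space of pairs; applying the
      real statement also to i times the pair gives the imaginary part.\<close>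
    have re: "Re (cinner g f + cinner g' f') = 0" if f: "(f, f') \<in> D1 \<Omega>" for f f'
      using p(2)[OF subsetD[OF closure_subset f]] unfolding g by (simp add: inner_prod_def inner_l2_def)
    from re[OF f] re[OF D1_scaleC[OF f, of "\<i>"]] show ?thesis
      by (simp add: cinner_simps complex_eq_iff)
  qed
  obtain h where h: "h \<in> L2 \<Omega>" "g + g' = tens (\<lambda>x. exp (- (- 1) * x)) h"
  proof (rule deficiency_space[OF \<Omega>, of "g + g'" "- 1"])
    show "g + g' \<in> ?K" using gK csubspace_L2 unfolding csubspace_def by blast
    fix f f' assume f: "(f, f') \<in> D1 \<Omega>"
    have "cinner (g + g') (f' - complex_of_real (- 1) *\<^sub>C f)
        = (cinner g f' + cinner g' f) + (cinner g f + cinner g' f')"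
      by (simp add: cinner_simps algebra_simps)
    then have "cinner (g + g') (f' - complex_of_real (- 1) *\<^sub>C f) = 0" using gM[OF f] orth[OF f] by simp
    then show "cinner (f' - complex_of_real (- 1) *\<^sub>C f) (g + g') = 0" by (rule cinner_eq_0_sym)
  qed
  obtain k where k: "k \<in> L2 \<Omega>" "g - g' = tens (\<lambda>x. exp (- 1 * x)) k"
  proof (rule deficiency_space[OF \<Omega>, of "g - g'" 1])
    show "g - g' \<in> ?K" by (rule csubspace_diff[OF csubspace_L2 gK])
    fix f f' assume f: "(f, f') \<in> D1 \<Omega>"
    have "cinner (g - g') (f' - complex_of_real 1 *\<^sub>C f)
        = (cinner g f' + cinner g' f) - (cinner g f + cinner g' f')"
      by (simp add: cinner_simps algebra_simps)
    then have "cinner (g - g') (f' - complex_of_real 1 *\<^sub>C f) = 0" using gM[OF f] orth[OF f] by simp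
    then show "cinner (f' - complex_of_real 1 *\<^sub>C f) (g - g') = 0" by (rule cinner_eq_0_sym)
  qed
  define h1 where "h1 = (1/2) *\<^sub>C h"
  \<comment> \<open>\<open>deficiency_space\<close> delivers e^(-x) = e^(-1) e^(1-x), whence the
    factor \<open>exp (- 1)\<close>; the halves recover g and g' from their sum and
    difference.\<close>
  define k1 where "k1 = of_real (exp (- 1)) *\<^sub>C (1/2) *\<^sub>C k"
  have hk: "h1 \<in> L2 \<Omega>" "k1 \<in> L2 \<Omega>"
    using csubspace_L2[of \<Omega>] h(1) k(1) unfolding csubspace_def h1_def k1_def by blast+
  have half: "(1/2) *\<^sub>C f + (1/2) *\<^sub>C f = f" for f :: "(real \<times> 'a) l2"
    using scaleC_add_left[of "1/2" "1/2" f] by simp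
  have "tens_plus h1 = (1/2) *\<^sub>C (g + g')"
    using h(2) by (simp add: h1_def tens_scaleC bounded_meas_exp)
  moreover have "tens_minus k1 = (1/2) *\<^sub>C (g - g')"
  proof -
    have "(\<lambda>x::real. exp (- 1 * x)) = (\<lambda>x. exp (- 1) * exp (1 - x))" by (simp flip: exp_add)
    then have "g - g' = of_real (exp (- 1)) *\<^sub>C tens_minus k"
      using k(2) tens_fun_cmult[OF bounded_meas_exp', of "exp (- 1)" k] by simp
    then show ?thesis by (simp add: k1_def tens_scaleC bounded_meas_exp' mult.commute)
  qed
  moreover have "(1/2) *\<^sub>C (g + g') + (1/2) *\<^sub>C (g - g') = g" "(1/2) *\<^sub>C (g + g') - (1/2) *\<^sub>C (g - g') = g'"
    using half[of g] half[of g'] by (simp_all add: scaleC_add_right scaleC_diff_right algebra_simps)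
  ultimately have "X - p = defect h1 k1" by (simp add: g defect_def)
  then show thesis by (intro that[OF p(1) hk]) (simp add: algebra_simps)
qed

section \<open>Extensions and unitary operators\<close>

lemma bounded_op_in: "bounded_op K T \<Longrightarrow> f \<in> K \<Longrightarrow> T f \<in> K"
  and bounded_op_add: "bounded_op K T \<Longrightarrow> f \<in> K \<Longrightarrow> g \<in> K \<Longrightarrow> T (f + g) = T f + T g"
  and bounded_op_scaleC: "bounded_op K T \<Longrightarrow> f \<in> K \<Longrightarrow> T (c *\<^sub>C f) = c *\<^sub>C T f"
  unfolding bounded_op_def by blast+

lemma csubspace_scaleC: "csubspace K \<Longrightarrow> f \<in> K \<Longrightarrow> c *\<^sub>C f \<in> K"
  and csubspace_add: "csubspace K \<Longrightarrow> f \<in> K \<Longrightarrow> g \<in> K \<Longrightarrow> f + g \<in> K"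
  and csubspace_zero: "csubspace K \<Longrightarrow> 0 \<in> K"
  unfolding csubspace_def by blast+

lemma csubspace_scaleR: "csubspace K \<Longrightarrow> f \<in> K \<Longrightarrow> r *\<^sub>R f \<in> K"
  by (simp add: scaleR_eq_scaleC csubspace_scaleC)

lemma bounded_op_scaleR: "bounded_op K T \<Longrightarrow> f \<in> K \<Longrightarrow> T (r *\<^sub>R f) = r *\<^sub>R T f"
  by (simp add: scaleR_eq_scaleC bounded_op_scaleC)

lemma bounded_op_diff:
  assumes "bounded_op K T" "csubspace K" "f \<in> K" "g \<in> K"
  shows "T (f - g) = T f - T g"
  using bounded_op_add[OF assms(1,3) csubspace_scaleC[OF assms(2,4), of "- 1"]]
    bounded_op_scaleC[OF assms(1,4), of "- 1"]
  by (simp add: scaleC_minus_one)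

lemma bounded_op_zero: "bounded_op K T \<Longrightarrow> csubspace K \<Longrightarrow> T 0 = 0"
  using bounded_op_diff[of K T 0 0] csubspace_zero[of K] by simp

lemma bounded_op_compose:
  assumes "bounded_op K S" "bounded_op K T"
  shows "bounded_op K (S \<circ> T)"
proof -
  obtain A where A: "\<And>f. f \<in> K \<Longrightarrow> norm (S f) \<le> A * norm f"
    using assms(1) unfolding bounded_op_def by blast
  obtain B where B: "\<And>f. f \<in> K \<Longrightarrow> norm (T f) \<le> B * norm f"
    using assms(2) unfolding bounded_op_def by blast
  have "norm (S (T f)) \<le> (\<bar>A\<bar> * \<bar>B\<bar>) * norm f" if f: "f \<in> K" for f
  proof -
    have "norm (S (T f)) \<le> A * norm (T f)" by (rule A[OF bounded_op_in[OF assms(2) f]])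
    also have "\<dots> \<le> \<bar>A\<bar> * norm (T f)" by (intro mult_right_mono) auto
    also have "\<dots> \<le> \<bar>A\<bar> * (\<bar>B\<bar> * norm f)"
      using B[OF f] by (intro mult_left_mono) (auto intro: order_trans[OF _ mult_right_mono[OF abs_ge_self]])
    finally show ?thesis by (simp add: mult.assoc)
  qed
  then show ?thesis
    using assms unfolding bounded_op_def by (auto intro!: exI[of _ "\<bar>A\<bar> * \<bar>B\<bar>"])
qed

lemma bounded_op_lin_comb:
  assumes K: "csubspace K" and T: "bounded_op K T"
  shows "bounded_op K (\<lambda>h. a *\<^sub>R h + b *\<^sub>R T h)"
proof -
  obtain B where B: "\<And>f. f \<in> K \<Longrightarrow> norm (T f) \<le> B * norm f" using T unfolding bounded_op_def by blast
  have "norm (a *\<^sub>R f + b *\<^sub>R T f) \<le> (\<bar>a\<bar> + \<bar>b\<bar> * B) * norm f" if f: "f \<in> K" for f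
  proof -
    have "norm (a *\<^sub>R f + b *\<^sub>R T f) \<le> \<bar>a\<bar> * norm f + \<bar>b\<bar> * norm (T f)"
      by (metis norm_scaleR norm_triangle_ineq)
    also have "\<dots> \<le> \<bar>a\<bar> * norm f + \<bar>b\<bar> * (B * norm f)"
      by (intro add_left_mono mult_left_mono B f) auto
    finally show ?thesis by (simp add: algebra_simps)
  qed
  moreover have "a *\<^sub>R (f + g) + b *\<^sub>R T (f + g) = (a *\<^sub>R f + b *\<^sub>R T f) + (a *\<^sub>R g + b *\<^sub>R T g)"
    if "f \<in> K" "g \<in> K" for f g
    using bounded_op_add[OF T that] by (simp add: scaleR_add_right)
  moreover have "a *\<^sub>R c *\<^sub>C f + b *\<^sub>R T (c *\<^sub>C f) = c *\<^sub>C (a *\<^sub>R f + b *\<^sub>R T f)" if "f \<in> K" for c f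
    using bounded_op_scaleC[OF T that] by (simp add: scaleR_eq_scaleC scaleC_add_right mult.commute)
  moreover have "a *\<^sub>R f + b *\<^sub>R T f \<in> K" if "f \<in> K" for f
    using that by (intro csubspace_add[OF K] csubspace_scaleR[OF K] bounded_op_in[OF T])
  ultimately show ?thesis unfolding bounded_op_def by blast
qed

lemma invertible_opI:
  assumes K: "csubspace K" and T: "bounded_op K T" and surj: "\<And>g. g \<in> K \<Longrightarrow> \<exists>f\<in>K. T f = g"
    and c: "c > 0" "\<And>f. f \<in> K \<Longrightarrow> c * norm f \<le> norm (T f)"
  shows "invertible_op K T"
proof -
  have inj: "inj_on T K"
  proof (rule inj_onI)
    fix f g assume fg: "f \<in> K" "g \<in> K" "T f = T g"
    then have "c * norm (f - g) \<le> 0"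
      using c(2)[OF csubspace_diff[OF K fg(1,2)]] bounded_op_diff[OF T K fg(1,2)] by simp
    then show "f = g" using c(1) by (simp add: mult_le_0_iff)
  qed
  have bij: "bij_betw T K K"
    unfolding bij_betw_def using inj surj bounded_op_in[OF T] by (auto simp: image_iff)
  have inv: "inv_into K T g \<in> K" "T (inv_into K T g) = g" if "g \<in> K" for g
    using bij that by (auto simp: bij_betw_def inv_into_into f_inv_into_f)
  have eqI: "inv_into K T g = f" if "f \<in> K" "T f = g" for f g
    using inv_into_f_f[OF inj that(1)] that(2) by simp
  have "bounded_op K (inv_into K T)"
    unfolding bounded_op_def
  proof (intro conjI ballI allI exI)
    fix f g assume fg: "f \<in> K" "g \<in> K"
    show "inv_into K T (f + g) = inv_into K T f + inv_into K T g"
      using fg inv bounded_op_add[OF T] by (intro eqI csubspace_add K) auto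
  next
    fix c f assume f: "f \<in> K"
    show "inv_into K T (c *\<^sub>C f) = c *\<^sub>C inv_into K T f"
      using f inv bounded_op_scaleC[OF T] by (intro eqI csubspace_scaleC K) auto
  next
    fix f assume f: "f \<in> K"
    show "inv_into K T f \<in> K" using inv f by blast
    show "norm (inv_into K T f) \<le> (1 / c) * norm f"
      using c(2)[OF inv(1)[OF f]] inv(2)[OF f] c(1) by (simp add: field_simps)
  qed
  then show ?thesis using T bij by (simp add: invertible_op_def)
qed

lemma unitary_cinner: "unitary_op K V \<Longrightarrow> f \<in> K \<Longrightarrow> g \<in> K \<Longrightarrow> cinner (V f) (V g) = cinner f g"
  and unitary_bounded: "unitary_op K V \<Longrightarrow> bounded_op K V"
  and unitary_in: "unitary_op K V \<Longrightarrow> f \<in> K \<Longrightarrow> V f \<in> K"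
  unfolding unitary_op_def bounded_op_def by blast+

lemma unitary_surj: "unitary_op K V \<Longrightarrow> g \<in> K \<Longrightarrow> \<exists>f\<in>K. V f = g"
  unfolding unitary_op_def by (metis imageE)

lemma unitary_norm:
  assumes "unitary_op K V" "f \<in> K"
  shows "norm (V f) = norm f"
  using unitary_cinner[OF assms assms(2)] by (simp add: cinner_self power2_eq_iff_nonneg flip: of_real_power)

text \<open>The graph of a unitary operator is a maximal isometric relation: by surjectivity
  \<open>k - V h\<close> is itself a value \<open>V d\<close>, and testing with \<open>d\<close>
  makes it orthogonal to itself.\<close>

lemma unitary_eqI:
  assumes V: "unitary_op K V" and K: "csubspace K" and h: "h \<in> K" "k \<in> K"
    and eq: "\<And>h'. h' \<in> K \<Longrightarrow> cinner h h' = cinner k (V h')"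
  shows "k = V h"
proof -
  obtain d where d: "d \<in> K" "V d = k - V h"
    using unitary_surj[OF V csubspace_diff[OF K h(2) unitary_in[OF V h(1)]]] by blast
  have "cinner (k - V h) (V d) = 0"
    using eq[OF d(1)] unitary_cinner[OF V h(1) d(1)] by (simp add: cinner_simps)
  then show ?thesis by (simp add: d(2))
qed

text \<open>The graph of i H_V. The closure is taken only in the part coming from D, so the
  annihilator can be computed before closedness of the sum is known; closedness is then a
  consequence.\<close>

definition ext_graph ::
    "'b::euclidean_space set \<Rightarrow> ('b l2 \<Rightarrow> 'b l2) \<Rightarrow> ((real \<times> 'b) l2 \<times> (real \<times> 'b) l2) set" where
  "ext_graph \<Omega> V = {\<phi> + defect h (V h) | \<phi> h. \<phi> \<in> closure (D1 \<Omega>) \<and> h \<in> L2 \<Omega>}"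

definition core_graph ::
    "'b::euclidean_space set \<Rightarrow> ('b l2 \<Rightarrow> 'b l2) \<Rightarrow> ((real \<times> 'b) l2 \<times> (real \<times> 'b) l2) set" where
  "core_graph \<Omega> V = {\<phi> + defect h (V h) | \<phi> h. \<phi> \<in> D1 \<Omega> \<and> h \<in> L2 \<Omega>}"

lemma core_graph_subset: "core_graph \<Omega> V \<subseteq> ext_graph \<Omega> V"
  unfolding core_graph_def ext_graph_def using closure_subset by blast

lemma bform_closure_D1_defect:
  assumes "\<Omega> \<in> sets lebesgue" "\<phi> \<in> closure (D1 \<Omega>)" "\<psi> \<in> closure (D1 \<Omega>)"
    "h \<in> L2 \<Omega>" "k \<in> L2 \<Omega>" "h' \<in> L2 \<Omega>" "k' \<in> L2 \<Omega>"
  shows "bform (\<phi> + defect h k) (\<psi> + defect h' k') = bform (defect h k) (defect h' k')"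
proof -
  have "bform \<phi> \<psi> = 0" "bform \<phi> (defect h' k') = 0"
    using assms closure_D1_subset_skew_adj[OF assms(1)] defect_in_skew_adj
    by (blast intro: bform_closure_D1)+
  moreover have "bform (defect h k) \<psi> = 0"
    using bform_closure_D1[OF assms(3) defect_in_skew_adj[OF assms(4,5)]] by (rule bform_eq_0_sym)
  ultimately show ?thesis by (simp add: bform_add_left bform_add_right)
qed

lemma zero_in_closure_D1: "0 \<in> closure (D1 \<Omega>)"
  using D1_zero[of \<Omega>] closure_subset by (force simp: zero_prod_def)

lemma D1_subset_ext_graph:
  assumes V: "unitary_op (L2 \<Omega>) V"
  shows "D1 \<Omega> \<subseteq> ext_graph \<Omega> V"
proof
  fix X assume "X \<in> D1 \<Omega>"
  moreover have "X = X + defect 0 (V 0)"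
    by (simp add: bounded_op_zero[OF unitary_bounded[OF V] csubspace_L2])
  ultimately show "X \<in> ext_graph \<Omega> V"
    unfolding ext_graph_def using closure_subset csubspace_zero[OF csubspace_L2] by blast
qed

text \<open>An annihilating element also annihilates \<open>D1 \<Omega>\<close>, hence is decomposed
  with some pair h, k; testing it on \<open>defect h' (V h')\<close> gives the isometry relation
  with the graph of \<open>V\<close>, which forces k = V h.\<close>

lemma skew_adj_ext_graph:
  assumes \<Omega>: "\<Omega> \<in> sets lebesgue" "emeasure lebesgue \<Omega> < \<infinity>" and V: "unitary_op (L2 \<Omega>) V"
  shows "skew_adj (L2 (cyl \<Omega>)) (ext_graph \<Omega> V) = ext_graph \<Omega> V"
proof
  let ?K = "L2 (cyl \<Omega>)"
  show "skew_adj ?K (ext_graph \<Omega> V) \<subseteq> ext_graph \<Omega> V"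
  proof
    fix X assume X: "X \<in> skew_adj ?K (ext_graph \<Omega> V)"
    have "X \<in> skew_adj ?K (D1 \<Omega>)" using X skew_adj_antimono[OF D1_subset_ext_graph[OF V]] by blast
    then obtain \<phi> h k where \<phi>: "\<phi> \<in> closure (D1 \<Omega>)" "h \<in> L2 \<Omega>" "k \<in> L2 \<Omega>" "X = \<phi> + defect h k"
      by (rule skew_adj_D1_decomp[OF \<Omega>])
    have "k = V h"
    proof (rule unitary_eqI[OF V csubspace_L2 \<phi>(2,3)])
      fix h' assume h': "h' \<in> L2 \<Omega>"
      note 0 = zero_in_closure_D1[of \<Omega>]
      have "0 + defect h' (V h') \<in> ext_graph \<Omega> V" unfolding ext_graph_def using 0 h' by blast
      then have "bform X (0 + defect h' (V h')) = 0" using X unfolding skew_adj_def by blast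
      then show "cinner h h' = cinner k (V h')"
        using bform_closure_D1_defect[OF \<Omega>(1) \<phi>(1) 0 \<phi>(2,3) h' unitary_in[OF V h']]
        by (simp add: \<phi>(4) bform_defect_eq_0_iff)
    qed
    then show "X \<in> ext_graph \<Omega> V" unfolding ext_graph_def using \<phi> by blast
  qed
  show "ext_graph \<Omega> V \<subseteq> skew_adj ?K (ext_graph \<Omega> V)"
  proof
    fix X assume "X \<in> ext_graph \<Omega> V"
    then obtain \<phi> h where X: "X = \<phi> + defect h (V h)" "\<phi> \<in> closure (D1 \<Omega>)" "h \<in> L2 \<Omega>"
      unfolding ext_graph_def by blast
    have "\<phi> \<in> skew_adj ?K (D1 \<Omega>)" using X(2) closure_D1_subset_skew_adj[OF \<Omega>(1)] by blast
    moreover have "defect h (V h) \<in> skew_adj ?K (D1 \<Omega>)"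
      by (intro defect_in_skew_adj X unitary_in[OF V])
    ultimately have "fst X \<in> ?K \<and> snd X \<in> ?K"
      unfolding X(1) skew_adj_def by (auto intro: csubspace_add[OF csubspace_L2])
    moreover have "bform X Y = 0" if Y': "Y \<in> ext_graph \<Omega> V" for Y
    proof -
      obtain \<psi> h' where Y: "Y = \<psi> + defect h' (V h')" "\<psi> \<in> closure (D1 \<Omega>)" "h' \<in> L2 \<Omega>"
        using Y' unfolding ext_graph_def by blast
      show ?thesis
        unfolding X(1) Y(1)
        using bform_closure_D1_defect[OF \<Omega>(1) X(2) Y(2) X(3) unitary_in[OF V X(3)] Y(3) unitary_in[OF V Y(3)]]
          unitary_cinner[OF V X(3) Y(3)] by (simp add: bform_defect_eq_0_iff)
    qed
    ultimately show "X \<in> skew_adj ?K (ext_graph \<Omega> V)" unfolding skew_adj_def by blast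
  qed
qed

lemma ext_graph_subset_closure: "ext_graph \<Omega> V \<subseteq> closure (core_graph \<Omega> V)"
proof
  fix X assume "X \<in> ext_graph \<Omega> V"
  then obtain \<phi> h where X: "X = \<phi> + defect h (V h)" "\<phi> \<in> closure (D1 \<Omega>)" "h \<in> L2 \<Omega>"
    unfolding ext_graph_def by blast
  have "(\<lambda>\<psi>. \<psi> + defect h (V h)) ` closure (D1 \<Omega>) \<subseteq> closure (core_graph \<Omega> V)"
  proof (rule image_closure_subset)
    show "(\<lambda>\<psi>. \<psi> + defect h (V h)) ` D1 \<Omega> \<subseteq> closure (core_graph \<Omega> V)"
      unfolding core_graph_def using X(3) by (intro order_trans[OF _ closure_subset]) blast
  qed (intro continuous_intros, simp)
  then show "X \<in> closure (core_graph \<Omega> V)" using X by blast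
qed

lemma closure_div_i_core_graph:
  assumes "\<Omega> \<in> sets lebesgue" "emeasure lebesgue \<Omega> < \<infinity>" "unitary_op (L2 \<Omega>) V"
  shows "closure (div_i ` core_graph \<Omega> V) = div_i ` ext_graph \<Omega> V"
proof
  have "closed (ext_graph \<Omega> V)"
    using closed_skew_adj[OF closed_L2[OF cyl_sets_lebesgue[OF assms(1)]], of "ext_graph \<Omega> V"]
    by (simp add: skew_adj_ext_graph[OF assms])
  then show "closure (div_i ` core_graph \<Omega> V) \<subseteq> div_i ` ext_graph \<Omega> V"
    by (intro closure_minimal closed_div_i_image image_mono core_graph_subset)
  have "div_i ` closure (core_graph \<Omega> V) \<subseteq> closure (div_i ` core_graph \<Omega> V)"
    by (rule image_closure_subset[OF continuous_on_div_i closed_closure closure_subset])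
  then show "div_i ` ext_graph \<Omega> V \<subseteq> closure (div_i ` core_graph \<Omega> V)"
    using ext_graph_subset_closure by blast
qed

lemma core_elem_eq: "(\<phi>, \<phi>') + defect h (V h)
    = (core_elem V \<phi> h, \<phi>' + tens exp h - tens (\<lambda>x. exp (1 - x)) (V h))"
  by (simp add: core_elem_def defect_def)

lemma core_dom_eq: "core_dom \<Omega> V = Domain (core_graph \<Omega> V)"
proof
  show "core_dom \<Omega> V \<subseteq> Domain (core_graph \<Omega> V)"
    unfolding core_dom_def core_graph_def using core_elem_eq[of _ _ _ V] by (auto 0 4 simp: Domain_iff)
  show "Domain (core_graph \<Omega> V) \<subseteq> core_dom \<Omega> V"
  proof
    fix f assume "f \<in> Domain (core_graph \<Omega> V)"
    then obtain f' \<phi> \<phi>' h where "(f, f') = (\<phi>, \<phi>') + defect h (V h)" "(\<phi>, \<phi>') \<in> D1 \<Omega>" "h \<in> L2 \<Omega>"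
      unfolding core_graph_def by auto
    then show "f \<in> core_dom \<Omega> V" unfolding core_dom_def core_elem_eq by auto
  qed
qed

lemma csubspace_core_dom:
  assumes V: "unitary_op (L2 \<Omega>) V"
  shows "csubspace (core_dom \<Omega> V)"
proof -
  note b = bounded_meas_exp bounded_meas_exp'
  note Vb = unitary_bounded[OF V]
  note D = csubspace_Domain_D1[of \<Omega>] and N = csubspace_L2[of \<Omega>]
  show ?thesis
    unfolding csubspace_def
  proof (intro conjI ballI allI)
    have "0 = core_elem V 0 0"
      by (simp add: core_elem_def b bounded_op_zero[OF Vb csubspace_L2])
    then show "0 \<in> core_dom \<Omega> V"
      unfolding core_dom_def using csubspace_zero[OF D] csubspace_zero[OF N] by blast
  next
    fix f g assume "f \<in> core_dom \<Omega> V" "g \<in> core_dom \<Omega> V"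
    then obtain \<phi> h \<psi> k where f: "f = core_elem V \<phi> h" "\<phi> \<in> Domain (D1 \<Omega>)" "h \<in> L2 \<Omega>"
      and g: "g = core_elem V \<psi> k" "\<psi> \<in> Domain (D1 \<Omega>)" "k \<in> L2 \<Omega>"
      unfolding core_dom_def by blast
    have "f + g = core_elem V (\<phi> + \<psi>) (h + k)"
      using bounded_op_add[OF Vb f(3) g(3)] by (simp add: f g core_elem_def tens_add b)
    then show "f + g \<in> core_dom \<Omega> V"
      unfolding core_dom_def using csubspace_add[OF D f(2) g(2)] csubspace_add[OF N f(3) g(3)] by blast
  next
    fix c f assume "f \<in> core_dom \<Omega> V"
    then obtain \<phi> h where f: "f = core_elem V \<phi> h" "\<phi> \<in> Domain (D1 \<Omega>)" "h \<in> L2 \<Omega>"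
      unfolding core_dom_def by blast
    have "c *\<^sub>C f = core_elem V (c *\<^sub>C \<phi>) (c *\<^sub>C h)"
      using bounded_op_scaleC[OF Vb f(3)] by (simp add: f core_elem_def tens_scaleC scaleC_add_right b)
    then show "c *\<^sub>C f \<in> core_dom \<Omega> V"
      unfolding core_dom_def using csubspace_scaleC[OF D f(2)] csubspace_scaleC[OF N f(3)] by blast
  qed
qed

lemma action_iff:
  "(\<forall>(\<phi>, \<phi>')\<in>D1 \<Omega>. \<forall>h\<in>L2 \<Omega>. \<exists>g. (core_elem V \<phi> h, g) \<in> H \<and>
        \<i> *\<^sub>C g = \<phi>' + tens exp h - tens (\<lambda>x. exp (1 - x)) (V h)) \<longleftrightarrow> div_i ` core_graph \<Omega> V \<subseteq> H"
  (is "?L \<longleftrightarrow> ?R")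
proof -
  have eq: "(\<exists>g. (f, g) \<in> H \<and> \<i> *\<^sub>C g = f') \<longleftrightarrow> div_i (f, f') \<in> H" for f f' :: "(real \<times> 'a) l2"
  proof
    assume "\<exists>g. (f, g) \<in> H \<and> \<i> *\<^sub>C g = f'"
    then show "div_i (f, f') \<in> H" by (auto simp: div_i_def)
  next
    assume "div_i (f, f') \<in> H"
    then show "\<exists>g. (f, g) \<in> H \<and> \<i> *\<^sub>C g = f'"
      by (intro exI[of _ "(1 / \<i>) *\<^sub>C f'"]) (auto simp: div_i_def)
  qed
  have "?L \<longleftrightarrow> (\<forall>X\<in>D1 \<Omega>. \<forall>h\<in>L2 \<Omega>. div_i (X + defect h (V h)) \<in> H)"
    unfolding eq by (auto simp: core_elem_eq split_beta)
  also have "\<dots> \<longleftrightarrow> ?R" unfolding core_graph_def by blast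
  finally show ?thesis .
qed

text \<open>Single-valuedness leaves no room for other values of \<open>H\<close> over the core
  domain. The restriction whose closure appears in \<open>is_core\<close> thereby becomes explicit,
  which makes the extension unique.\<close>

lemma core_part:
  assumes "single_valued H" "div_i ` core_graph \<Omega> V \<subseteq> H"
  shows "H \<inter> core_dom \<Omega> V \<times> UNIV = div_i ` core_graph \<Omega> V"
proof
  show "div_i ` core_graph \<Omega> V \<subseteq> H \<inter> core_dom \<Omega> V \<times> UNIV"
    using assms(2) unfolding core_dom_eq by (auto simp: div_i_def)
  show "H \<inter> core_dom \<Omega> V \<times> UNIV \<subseteq> div_i ` core_graph \<Omega> V"
  proof
    fix X assume X: "X \<in> H \<inter> core_dom \<Omega> V \<times> UNIV"
    then have "fst X \<in> Domain (div_i ` core_graph \<Omega> V)" unfolding core_dom_eq by auto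
    then obtain g where g: "(fst X, g) \<in> div_i ` core_graph \<Omega> V" by blast
    then have "(fst X, g) \<in> H" using assms(2) by blast
    then have "g = snd X" using X assms(1) by (metis IntD1 prod.collapse single_valuedD)
    then show "X \<in> div_i ` core_graph \<Omega> V" using g by simp
  qed
qed

lemma is_extension_ext_graph:
  assumes \<Omega>: "\<Omega> \<in> sets lebesgue" "emeasure lebesgue \<Omega> < \<infinity>" and V: "unitary_op (L2 \<Omega>) V"
  shows "is_extension \<Omega> V (div_i ` ext_graph \<Omega> V)"
proof -
  let ?H = "div_i ` ext_graph \<Omega> V"
  note D1 = D1_subset_ext_graph[OF V]
  have "closure (Domain (D1 \<Omega>)) \<subseteq> closure (Domain (ext_graph \<Omega> V))"
    using D1 by (intro closure_mono) blast
  then have sa: "self_adjoint_op (L2 (cyl \<Omega>)) ?H"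
    using Domain_D1_dense[OF \<Omega>] by (intro self_adjoint_div_i csubspace_L2 skew_adj_ext_graph[OF \<Omega> V]) blast
  have sub: "div_i ` core_graph \<Omega> V \<subseteq> ?H" by (intro image_mono core_graph_subset)
  have sv: "single_valued ?H" using sa by (simp add: self_adjoint_op_def operator_graph_def)
  have "is_core (core_dom \<Omega> V) ?H"
    unfolding is_core_def core_part[OF sv sub] closure_div_i_core_graph[OF \<Omega> V] Domain_div_i
    using csubspace_core_dom[OF V] core_graph_subset[of \<Omega> V] by (auto simp: core_dom_eq)
  then show ?thesis
    unfolding is_extension_def action_iff S_op_eq using sa sub D1 by blast
qed

lemma is_extension_unique:
  assumes \<Omega>: "\<Omega> \<in> sets lebesgue" "emeasure lebesgue \<Omega> < \<infinity>" and V: "unitary_op (L2 \<Omega>) V"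
    and H: "is_extension \<Omega> V H"
  shows "H = div_i ` ext_graph \<Omega> V"
proof -
  have sub: "div_i ` core_graph \<Omega> V \<subseteq> H" and "single_valued H" "is_core (core_dom \<Omega> V) H"
    using H unfolding is_extension_def action_iff self_adjoint_op_def operator_graph_def by blast+
  then have "H = closure (div_i ` core_graph \<Omega> V)"
    unfolding is_core_def using core_part[OF _ sub] by simp
  then show ?thesis by (simp add: closure_div_i_core_graph[OF \<Omega> V])
qed

text \<open>The defect elements of \<open>V\<close> and \<open>V'\<close> lie in one graph, and this
  graph annihilates itself; that couples \<open>V'\<close> isometrically with
  \<open>V\<close>.\<close>

lemma ext_graph_determines_unitary:
  assumes \<Omega>: "\<Omega> \<in> sets lebesgue" "emeasure lebesgue \<Omega> < \<infinity>"
    and V: "unitary_op (L2 \<Omega>) V" "unitary_op (L2 \<Omega>) V'"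
    and eq: "ext_graph \<Omega> V = ext_graph \<Omega> V'" and h: "h \<in> L2 \<Omega>"
  shows "V' h = V h"
proof (rule unitary_eqI[OF V(1) csubspace_L2 h unitary_in[OF V(2) h]])
  fix h' assume h': "h' \<in> L2 \<Omega>"
  note 0 = zero_in_closure_D1[of \<Omega>]
  have "0 + defect h (V' h) \<in> ext_graph \<Omega> V'" "0 + defect h' (V h') \<in> ext_graph \<Omega> V"
    unfolding ext_graph_def using 0 h h' by blast+
  then have "bform (defect h (V' h)) (defect h' (V h')) = 0"
    using skew_adj_ext_graph[OF \<Omega> V(1)] eq unfolding skew_adj_def by auto
  then show "cinner h h' = cinner (V' h) (V h')" by (simp add: bform_defect_eq_0_iff)
qed

text \<open>\<open>B\<close> lies between the closure of \<open>D1 \<Omega>\<close> and the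
  annihilator, so it is determined by the defect elements it contains. Being its own annihilator
  makes the relation \<open>L\<close> of their parameters isometric (one inclusion) and maximal (the
  other).\<close>

lemma self_adjoint_extension_eq_ext_graph:
  assumes \<Omega>: "\<Omega> \<in> sets lebesgue" "emeasure lebesgue \<Omega> < \<infinity>"
    and H: "self_adjoint_op (L2 (cyl \<Omega>)) H" "S_op \<Omega> \<subseteq> H"
  obtains V where "unitary_op (L2 \<Omega>) V" "H = div_i ` ext_graph \<Omega> V"
proof -
  let ?K = "L2 (cyl \<Omega>)" and ?N = "L2 \<Omega>"
  define B where "B = mul_i ` H"
  have HB: "H = div_i ` B" by (simp add: B_def)
  have BB: "skew_adj ?K B = B" unfolding B_def by (rule skew_adj_mul_i[OF csubspace_L2 H(1)])
  have lin: "lin_graph B" using lin_graph_skew_adj[OF csubspace_L2, of "cyl \<Omega>" B] BB by simp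
  have DB: "D1 \<Omega> \<subseteq> B"
    using H(2) unfolding S_op_eq B_def by (metis image_mono mul_i_div_i_image)
  have "closed B"
    using closed_skew_adj[OF closed_L2[OF cyl_sets_lebesgue[OF \<Omega>(1)]], of B] BB by simp
  then have cDB: "closure (D1 \<Omega>) \<subseteq> B" using DB by (intro closure_minimal)
  have Badd: "X + Y \<in> B" if "X \<in> B" "Y \<in> B" for X Y
    using lin_graph_add[OF lin, of "fst X" "snd X" "fst Y" "snd Y"] that by (simp add: plus_prod_def)
  have Bdiff: "X - Y \<in> B" if "X \<in> B" "Y \<in> B" for X Y
    using lin_graph_diff[OF lin, of "fst X" "snd X" "fst Y" "snd Y"] that by (simp add: minus_prod_def)
  define L where "L = {(h, k). h \<in> ?N \<and> k \<in> ?N \<and> defect h k \<in> B}"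
  have decomp: "\<exists>\<phi> h k. \<phi> \<in> closure (D1 \<Omega>) \<and> (h, k) \<in> L \<and> X = \<phi> + defect h k" if X: "X \<in> B" for X
  proof -
    have "X \<in> skew_adj ?K (D1 \<Omega>)" using X BB skew_adj_antimono[OF DB] by blast
    then obtain \<phi> h k where \<phi>: "\<phi> \<in> closure (D1 \<Omega>)" "h \<in> ?N" "k \<in> ?N" "X = \<phi> + defect h k"
      by (rule skew_adj_D1_decomp[OF \<Omega>])
    have "X - \<phi> \<in> B" using X \<phi>(1) cDB Bdiff by blast
    then have "(h, k) \<in> L" using \<phi> by (simp add: L_def)
    then show ?thesis using \<phi> by blast
  qed
  have iso: "cinner h h' = cinner k k'" if "(h, k) \<in> L" "(h', k') \<in> L" for h k h' k'
  proof -
    have "bform (defect h k) (defect h' k') = 0"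
      using that BB unfolding L_def skew_adj_def by blast
    then show ?thesis by (simp add: bform_defect_eq_0_iff)
  qed
  have max: "(h, k) \<in> L"
    if h: "h \<in> ?N" "k \<in> ?N" and eq: "\<And>h' k'. (h', k') \<in> L \<Longrightarrow> cinner h h' = cinner k k'" for h k
  proof -
    have "bform (defect h k) Y = 0" if Y: "Y \<in> B" for Y
    proof -
      obtain \<phi> h' k' where \<phi>: "\<phi> \<in> closure (D1 \<Omega>)" "(h', k') \<in> L" "Y = \<phi> + defect h' k'"
        using decomp[OF Y] by blast
      have "bform (defect h k) \<phi> = 0"
        using bform_closure_D1[OF \<phi>(1) defect_in_skew_adj[OF h]] by (rule bform_eq_0_sym)
      then show ?thesis using eq[OF \<phi>(2)] by (simp add: \<phi>(3) bform_add_right bform_defect_eq_0_iff)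
    qed
    moreover have "fst (defect h k) \<in> ?K \<and> snd (defect h k) \<in> ?K"
      using defect_in_skew_adj[OF h] by (simp add: skew_adj_def)
    ultimately show ?thesis using h BB unfolding L_def skew_adj_def by blast
  qed
  have Llin: "lin_graph L"
    unfolding lin_graph_def
  proof (intro conjI allI impI)
    show "(0, 0) \<in> L" using lin_graph_zero[OF lin] csubspace_zero[OF csubspace_L2] by (simp add: L_def zero_prod_def)
  next
    fix f f' g g' assume "(f, f') \<in> L" "(g, g') \<in> L"
    then show "(f + g, f' + g') \<in> L"
      using csubspace_add[OF csubspace_L2] Badd by (auto simp: L_def defect_add)
  next
    fix c f f' assume "(f, f') \<in> L"
    then show "(c *\<^sub>C f, c *\<^sub>C f') \<in> L"
      using csubspace_scaleC[OF csubspace_L2] lin_graph_scaleC[OF lin, of "fst (defect f f')" "snd (defect f f')" c]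
      by (auto simp: L_def defect_scaleC)
  qed
  have Lsub: "L \<subseteq> ?N \<times> ?N" by (auto simp: L_def)
  have dom: "Domain L = ?N"
    by (rule maximal_isometric_relation_total[OF csubspace_L2 closed_L2[OF \<Omega>(1)] Lsub Llin iso max])
  \<comment> \<open>Isometry and maximality are symmetric in the two components; totality of the
    converse relation is surjectivity of \<open>V\<close>.\<close>
  have ran: "Domain (L\<inverse>) = ?N"
  proof (rule maximal_isometric_relation_total[OF csubspace_L2 closed_L2[OF \<Omega>(1)]])
    show "L\<inverse> \<subseteq> ?N \<times> ?N" using Lsub by blast
    show "lin_graph (L\<inverse>)" using Llin unfolding lin_graph_def by blast
    show "cinner h h' = cinner k k'" if "(h, k) \<in> L\<inverse>" "(h', k') \<in> L\<inverse>" for h k h' k'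
      using iso that by fastforce
    show "(h, k) \<in> L\<inverse>" if "h \<in> ?N" "k \<in> ?N" "\<And>h' k'. (h', k') \<in> L\<inverse> \<Longrightarrow> cinner h h' = cinner k k'" for h k
      using max[of k h] that by fastforce
  qed
  have uniq: "k = k'" if "(h, k) \<in> L" "(h, k') \<in> L" for h k k'
  proof -
    have "(0, k - k') \<in> L" using lin_graph_diff[OF Llin that] by simp
    from iso[OF this this] show ?thesis by simp
  qed
  obtain V where V: "\<And>h. h \<in> ?N \<Longrightarrow> (h, V h) \<in> L" using dom unfolding set_eq_iff Domain_iff by metis
  have VL: "k = V h" "h \<in> ?N" if "(h, k) \<in> L" for h k
    using that Lsub uniq V by blast+
  have Vn: "V h \<in> ?N" if "h \<in> ?N" for h using V[OF that] Lsub by blast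
  have bnd: "norm (V h) \<le> 1 * norm h" if "h \<in> ?N" for h
    using iso[OF V[OF that] V[OF that]] by (simp add: cinner_self power2_eq_iff_nonneg flip: of_real_power)
  have "bounded_op ?N V"
    unfolding bounded_op_def
  proof (intro conjI ballI allI)
    show "\<exists>B. \<forall>f\<in>?N. norm (V f) \<le> B * norm f" using bnd by blast
    show "V f \<in> ?N" if "f \<in> ?N" for f using Vn[OF that] .
    show "V (f + g) = V f + V g" if "f \<in> ?N" "g \<in> ?N" for f g
      using VL(1)[OF lin_graph_add[OF Llin V[OF that(1)] V[OF that(2)]]] by simp
    show "V (c *\<^sub>C f) = c *\<^sub>C V f" if "f \<in> ?N" for c f
      using VL(1)[OF lin_graph_scaleC[OF Llin V[OF that]]] by simp
  qed
  moreover have "V ` ?N = ?N"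
  proof
    show "V ` ?N \<subseteq> ?N" using Vn by blast
    show "?N \<subseteq> V ` ?N" using ran VL by blast
  qed
  ultimately have unit: "unitary_op ?N V"
    unfolding unitary_op_def using iso[OF V V] by simp
  have "B = ext_graph \<Omega> V"
  proof
    show "B \<subseteq> ext_graph \<Omega> V" unfolding ext_graph_def using decomp VL by blast
    show "ext_graph \<Omega> V \<subseteq> B"
    proof
      fix X assume "X \<in> ext_graph \<Omega> V"
      then obtain \<phi> h where X: "X = \<phi> + defect h (V h)" "\<phi> \<in> closure (D1 \<Omega>)" "h \<in> ?N"
        unfolding ext_graph_def by blast
      have "defect h (V h) \<in> B" using V[OF X(3)] by (simp add: L_def)
      then show "X \<in> B" unfolding X(1) using X(2) cDB by (blast intro: Badd)
    qed
  qed
  then show thesis using that[OF unit] HB by simp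
qed

lemma symmetric_S_op:
  assumes \<Omega>: "\<Omega> \<in> sets lebesgue" "emeasure lebesgue \<Omega> < \<infinity>"
  shows "symmetric_op (L2 (cyl \<Omega>)) (S_op \<Omega>)"
  unfolding symmetric_op_def densely_defined_def S_op_eq Domain_div_i adjoint_graph_div_i[OF csubspace_L2]
  using operator_graph_div_i[OF csubspace_L2 lin_graph_D1 D1_subset_skew_adj Domain_D1_dense[OF \<Omega>]]
    Domain_D1_dense[OF \<Omega>] D1_subset_skew_adj by (auto intro: image_mono)

section \<open>Boundary values\<close>

lemma bounded_op_I_plus:
  assumes "csubspace K" "bounded_op K T"
  shows "bounded_op K (\<lambda>h. h + b *\<^sub>R T h)" "bounded_op K (\<lambda>h. a *\<^sub>R h + T h)" "bounded_op K (\<lambda>h. h - b *\<^sub>R T h)"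
  using bounded_op_lin_comb[OF assms, of 1 b] bounded_op_lin_comb[OF assms, of a 1]
    bounded_op_lin_comb[OF assms, of 1 "- b"] by simp_all

lemma unitary_norm_I_plus_ge:
  assumes "unitary_op K V" "h \<in> K"
  shows "(exp 1 - 1) * norm h \<le> norm (h + exp 1 *\<^sub>R V h)"
proof -
  have "norm (exp 1 *\<^sub>R V h) \<le> norm (h + exp 1 *\<^sub>R V h) + norm h"
    using norm_triangle_ineq4[of "h + exp 1 *\<^sub>R V h" h] by simp
  then show ?thesis using unitary_norm[OF assms] by (simp add: algebra_simps)
qed

text \<open>Solving for the other occurrence of h, the equation says that h is the image under the
  inverse of V of e^(-1)(g - h), a fixed point of a contraction with factor e^(-1).\<close>

lemma unitary_I_plus_surj:
  assumes K: "csubspace K" "closed K" and V: "unitary_op K V" and g: "g \<in> K"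
  shows "\<exists>h\<in>K. h + exp 1 *\<^sub>R V h = g"
proof -
  obtain R where R: "\<And>f. f \<in> K \<Longrightarrow> R f \<in> K \<and> V (R f) = f" using unitary_surj[OF V] by metis
  define T where "T h = R (exp (- 1) *\<^sub>R (g - h))" for h
  have arg: "exp (- 1) *\<^sub>R (g - h) \<in> K" if "h \<in> K" for h
    by (intro csubspace_scaleR[OF K(1)] csubspace_diff[OF K(1)] g that)
  have "\<exists>!h\<in>K. T h = h"
  proof (rule Banach_fix)
    show "complete K" using K(2) by (simp add: complete_eq_closed)
    show "K \<noteq> {}" using g by blast
    show "0 \<le> exp (- 1 :: real)" "exp (- 1 :: real) < 1" by simp_all
    show "T ` K \<subseteq> K" using R arg by (auto simp: T_def)
    show "dist (T x) (T y) \<le> exp (- 1) * dist x y" if "x \<in> K" "y \<in> K" for x y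
    proof -
      have "norm (T x - T y) = norm (V (T x - T y))"
        using R arg that by (intro unitary_norm[OF V, symmetric] csubspace_diff[OF K(1)]) (auto simp: T_def)
      also have "V (T x - T y) = V (T x) - V (T y)"
        using R arg that by (intro bounded_op_diff[OF unitary_bounded[OF V] K(1)]) (auto simp: T_def)
      also have "\<dots> = exp (- 1) *\<^sub>R (y - x)"
        using R arg that by (simp add: T_def algebra_simps)
      finally show ?thesis by (simp add: dist_norm norm_minus_commute)
    qed
  qed
  then obtain h where h: "h \<in> K" "T h = h" by blast
  then have "V h = exp (- 1) *\<^sub>R (g - h)" using R[OF arg[OF h(1)]] by (simp add: T_def)
  then have "exp 1 *\<^sub>R V h = g - h" by (simp flip: exp_add)
  then show ?thesis using h(1) by (intro bexI[of _ h]) auto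
qed

lemma invertible_I_plus:
  assumes "csubspace K" "closed K" "unitary_op K V"
  shows "invertible_op K (\<lambda>h. h + exp 1 *\<^sub>R V h)"
proof (rule invertible_opI[OF assms(1)])
  show "0 < exp 1 - (1::real)" by simp
qed (use assms unitary_norm_I_plus_ge unitary_I_plus_surj in
      \<open>auto intro: bounded_op_I_plus unitary_bounded\<close>)

text \<open>Both squared norms equal (e^2 + 1)|h|^2 + 2e Re<h, Vh>. This is why the transform W is
  isometric.\<close>

lemma unitary_norm_swap:
  assumes V: "unitary_op K V" and h: "h \<in> K"
  shows "norm (exp 1 *\<^sub>R h + V h) = norm (h + exp 1 *\<^sub>R V h)"
proof -
  have "inner (V h) (V h) = inner h h" using unitary_cinner[OF V h h] by (simp add: inner_l2_def)
  then have "(norm (exp 1 *\<^sub>R h + V h))\<^sup>2 = (norm (h + exp 1 *\<^sub>R V h))\<^sup>2"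
    by (simp add: power2_norm_eq_inner inner_add_left inner_add_right inner_commute[of "V h" h])
  then show ?thesis by (simp add: power2_eq_iff_nonneg)
qed

lemma W_op_apply:
  assumes "\<Omega> \<in> sets lebesgue" "unitary_op (L2 \<Omega>) V" "h \<in> L2 \<Omega>"
  shows "W_op \<Omega> V (h + exp 1 *\<^sub>R V h) = exp 1 *\<^sub>R h + V h"
proof -
  have "inj_on (\<lambda>h. h + exp 1 *\<^sub>R V h) (L2 \<Omega>)"
    using invertible_I_plus[OF csubspace_L2 closed_L2[OF assms(1)] assms(2)]
    by (simp add: invertible_op_def bij_betw_def)
  from inv_into_f_f[OF this assms(3)] show ?thesis by (simp add: W_op_def)
qed

lemma bounded_op_W_op:
  assumes "\<Omega> \<in> sets lebesgue" "unitary_op (L2 \<Omega>) V"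
  shows "bounded_op (L2 \<Omega>) (W_op \<Omega> V)"
  unfolding W_op_def
  using invertible_I_plus[OF csubspace_L2 closed_L2[OF assms(1)] assms(2)]
  by (intro bounded_op_compose bounded_op_I_plus(2) csubspace_L2 unitary_bounded[OF assms(2)])
     (simp add: invertible_op_def)

lemma W_op_isometric:
  assumes \<Omega>: "\<Omega> \<in> sets lebesgue" and V: "unitary_op (L2 \<Omega>) V" and g: "g \<in> L2 \<Omega>"
  shows "norm (W_op \<Omega> V g) = norm g"
proof -
  obtain h where h: "h \<in> L2 \<Omega>" "h + exp 1 *\<^sub>R V h = g"
    using unitary_I_plus_surj[OF csubspace_L2 closed_L2[OF \<Omega>] V g] by blast
  show ?thesis using W_op_apply[OF \<Omega> V h(1)] unitary_norm_swap[OF V h(1)] h(2) by simp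
qed

text \<open>The terms in \<open>V h\<close> cancel, so in the parametrisation by (I + eV)h the
  operator I - eW returns a nonzero multiple of h. Surjectivity of I - eW follows.\<close>

lemma I_minus_W_op_apply:
  assumes "\<Omega> \<in> sets lebesgue" "unitary_op (L2 \<Omega>) V" "h \<in> L2 \<Omega>"
  shows "(h + exp 1 *\<^sub>R V h) - exp 1 *\<^sub>R W_op \<Omega> V (h + exp 1 *\<^sub>R V h) = (1 - exp 2) *\<^sub>R h"
  unfolding W_op_apply[OF assms] by (simp add: algebra_simps flip: exp_add)

lemma invertible_I_minus_W_op:
  assumes \<Omega>: "\<Omega> \<in> sets lebesgue" and V: "unitary_op (L2 \<Omega>) V"
  shows "invertible_op (L2 \<Omega>) (\<lambda>h. h - exp 1 *\<^sub>R W_op \<Omega> V h)"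
proof (rule invertible_opI[OF csubspace_L2])
  note surj = unitary_I_plus_surj[OF csubspace_L2 closed_L2[OF \<Omega>] V]
  have e: "exp 2 > (1::real)" by simp
  show "bounded_op (L2 \<Omega>) (\<lambda>h. h - exp 1 *\<^sub>R W_op \<Omega> V h)"
    by (intro bounded_op_I_plus csubspace_L2 bounded_op_W_op \<Omega> V)
  show "0 < exp 1 - (1::real)" by simp
  fix g assume g: "g \<in> L2 \<Omega>"
  show "\<exists>f\<in>L2 \<Omega>. f - exp 1 *\<^sub>R W_op \<Omega> V f = g"
  proof -
    define h where "h = (1 / (1 - exp 2)) *\<^sub>R g"
    have h: "h \<in> L2 \<Omega>" unfolding h_def by (intro csubspace_scaleR csubspace_L2 g)
    have "(1 - exp 2) *\<^sub>R h = g" using e by (simp add: h_def)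
    moreover have "h + exp 1 *\<^sub>R V h \<in> L2 \<Omega>"
      by (intro csubspace_add[OF csubspace_L2] csubspace_scaleR[OF csubspace_L2] h unitary_in[OF V])
    ultimately show ?thesis using I_minus_W_op_apply[OF \<Omega> V h] by metis
  qed
  show "(exp 1 - 1) * norm g \<le> norm (g - exp 1 *\<^sub>R W_op \<Omega> V g)"
  proof -
    have "exp 1 * norm g - norm g \<le> norm (exp 1 *\<^sub>R W_op \<Omega> V g - g)"
      using norm_triangle_ineq2[of "exp 1 *\<^sub>R W_op \<Omega> V g" g] W_op_isometric[OF \<Omega> V g] by simp
    then show ?thesis by (simp add: algebra_simps norm_minus_commute)
  qed
qed

text \<open>With g = (I + eV)h, both (I - eW)Vg and (W - eI)g equal (1 - e^2)Vh; injectivity of I -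
  eW then identifies Vg as the preimage.\<close>

lemma V_op_W_op:
  assumes \<Omega>: "\<Omega> \<in> sets lebesgue" and V: "unitary_op (L2 \<Omega>) V" and g: "g \<in> L2 \<Omega>"
  shows "V_op \<Omega> (W_op \<Omega> V) g = V g"
proof -
  note K = csubspace_L2[of \<Omega>] and Vb = unitary_bounded[OF V]
  obtain h where h: "h \<in> L2 \<Omega>" "h + exp 1 *\<^sub>R V h = g"
    using unitary_I_plus_surj[OF K closed_L2[OF \<Omega>] V g] by blast
  have Vh: "V h \<in> L2 \<Omega>" by (rule unitary_in[OF V h(1)])
  have "V g = V h + exp 1 *\<^sub>R V (V h)"
    using bounded_op_add[OF Vb h(1) csubspace_scaleR[OF K Vh, of "exp 1"]] bounded_op_scaleR[OF Vb Vh, of "exp 1"]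
    unfolding h(2) by simp
  then have 1: "V g - exp 1 *\<^sub>R W_op \<Omega> V (V g) = (1 - exp 2) *\<^sub>R V h"
    using I_minus_W_op_apply[OF \<Omega> V Vh] by simp
  have 2: "W_op \<Omega> V g - exp 1 *\<^sub>R g = (1 - exp 2) *\<^sub>R V h"
    using W_op_apply[OF \<Omega> V h(1)] by (simp add: h(2)[symmetric] algebra_simps flip: exp_add)
  have "inj_on (\<lambda>h. h - exp 1 *\<^sub>R W_op \<Omega> V h) (L2 \<Omega>)"
    using invertible_I_minus_W_op[OF \<Omega> V] by (simp add: invertible_op_def bij_betw_def)
  from inv_into_f_f[OF this unitary_in[OF V g]] show ?thesis
    unfolding V_op_def by (simp add: 1 2)
qed

text \<open>A subset of full measure of (0,1) meets every subinterval, so its closure contains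
  [0,1], end points included.\<close>

lemma continuous_AE_zero:
  fixes d :: "real \<Rightarrow> 'a::real_normed_vector"
  assumes cont: "continuous_on {0..1} d" and ae: "AE x in lebesgue. x \<in> {0<..<1} \<longrightarrow> d x = 0"
    and c: "c \<in> {0..1}"
  shows "d c = 0"
proof -
  define Z where "Z = {x \<in> {0<..<1}. d x = 0}"
  have hit: "\<exists>x\<in>Z. a < x \<and> x < b" if ab: "0 \<le> a" "a < b" "b \<le> 1" for a b
  proof (rule ccontr)
    assume "\<not> (\<exists>x\<in>Z. a < x \<and> x < b)"
    then have *: "d x \<noteq> 0" if "x \<in> {a<..<b}" for x using that ab by (auto simp: Z_def)
    have "AE x in lborel. x \<notin> {a<..<b}"
      using ae unfolding AE_lebesgue_iff by eventually_elim (use * ab in auto)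
    then have "emeasure lborel {a<..<b} = 0"
      by (subst (asm) AE_iff_measurable[of "{a<..<b}"]) auto
    then show False using ab by simp
  qed
  have "c \<in> closure Z"
    unfolding closure_approachable
  proof (intro allI impI)
    fix e :: real assume e: "0 < e"
    have "0 \<le> max 0 (c - e)" "max 0 (c - e) < min 1 (c + e)" "min 1 (c + e) \<le> 1" using e c by auto
    from hit[OF this] obtain x where "x \<in> Z" "max 0 (c - e) < x" "x < min 1 (c + e)" by blast
    then show "\<exists>y\<in>Z. dist y c < e" by (intro bexI[of _ x]) (simp_all add: dist_real_def abs_less_iff)
  qed
  moreover have "closure Z \<subseteq> {0..1}" by (intro closure_minimal) (auto simp: Z_def)
  moreover from this have "continuous_on (closure Z) d" by (rule continuous_on_subset[OF cont])
  moreover have "d x = 0" if "x \<in> Z" for x using that by (simp add: Z_def)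
  ultimately show ?thesis using continuous_constant_on_closure[of Z d 0 c] by metis
qed

text \<open>\<open>has_trace\<close> quantifies existentially over representatives. Two of them
  agree almost everywhere on almost every slice, and continuity in x carries the agreement to the
  point \<open>c\<close>.\<close>

lemma has_trace_unique:
  assumes g: "has_trace \<Omega> f c g" and g': "has_trace \<Omega> f c g'" and c: "c \<in> {0..1}"
  shows "g = g'"
proof -
  obtain F where F: "AE z in lebesgue. z \<in> cyl \<Omega> \<longrightarrow> F z = rep_l2 f z"
    "AE y in lebesgue. y \<in> \<Omega> \<longrightarrow> continuous_on {0..1} (\<lambda>x. F (x, y)) \<and> F (c, y) = rep_l2 g y"
    using g unfolding has_trace_def by blast
  obtain G where G: "AE z in lebesgue. z \<in> cyl \<Omega> \<longrightarrow> G z = rep_l2 f z"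
    "AE y in lebesgue. y \<in> \<Omega> \<longrightarrow> continuous_on {0..1} (\<lambda>x. G (x, y)) \<and> G (c, y) = rep_l2 g' y"
    using g' unfolding has_trace_def by blast
  have "AE z in lebesgue. z \<in> cyl \<Omega> \<longrightarrow> F z - G z = 0"
    using F(1) G(1) by eventually_elim auto
  then have "AE y in lebesgue. AE x in lebesgue. (x, y) \<in> cyl \<Omega> \<longrightarrow> F (x, y) - G (x, y) = 0"
    by (rule AE_slices)
  then have on: "AE y in lebesgue. y \<in> \<Omega> \<longrightarrow> rep_l2 g y = rep_l2 g' y"
    using F(2) G(2)
  proof eventually_elim
    case (elim y)
    show ?case
    proof
      assume y: "y \<in> \<Omega>"
      have "F (c, y) - G (c, y) = 0"
      proof (rule continuous_AE_zero[OF _ _ c, of "\<lambda>x. F (x, y) - G (x, y)"])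
        show "continuous_on {0..1} (\<lambda>x. F (x, y) - G (x, y))"
          using elim y by (intro continuous_on_diff) auto
        show "AE x in lebesgue. x \<in> {0<..<1} \<longrightarrow> F (x, y) - G (x, y) = 0"
          using elim(1) y by simp
      qed
      then show "rep_l2 g y = rep_l2 g' y" using elim y by simp
    qed
  qed
  have "AE y in lebesgue. y \<notin> \<Omega> \<longrightarrow> rep_l2 g y = 0" "AE y in lebesgue. y \<notin> \<Omega> \<longrightarrow> rep_l2 g' y = 0"
    using g g' by (auto simp: has_trace_def L2_def)
  with on have "AE y in lebesgue. rep_l2 g y = rep_l2 g' y"
    by eventually_elim auto
  then show ?thesis by (rule l2_eqI)
qed

lemma has_trace_core_elem:
  assumes \<phi>: "\<phi> \<in> Domain (D1 \<Omega>)" and h: "h \<in> L2 \<Omega>" "V h \<in> L2 \<Omega>"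
  shows "has_trace \<Omega> (core_elem V \<phi> h) 0 (h + exp 1 *\<^sub>R V h)"
    and "has_trace \<Omega> (core_elem V \<phi> h) 1 (exp 1 *\<^sub>R h + V h)"
proof -
  note b = bounded_meas_exp bounded_meas_exp'
  obtain \<psi> where \<psi>: "dom_fun \<Omega> \<psi>" "\<phi> = abs_l2 \<psi>" "sq_integrable \<psi>"
    using \<phi> by (auto simp: D1_def dom_fun_def)
  \<comment> \<open>Unlike in \<open>tens\<close>, the exponentials are not cut off here, so that
    the slices are continuous up to 0 and 1 and have the right values there.\<close>
  define F where "F z = \<psi> z + of_real (exp (fst z)) * rep_l2 h (snd z) + of_real (exp (1 - fst z)) * rep_l2 (V h) (snd z)" for z
  have 1: "AE z in lebesgue. z \<in> cyl \<Omega> \<longrightarrow> F z = rep_l2 (core_elem V \<phi> h) z"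
    using rep_abs_l2_AE[OF \<psi>(3)] rep_tens_AE[OF b(1), of h] rep_tens_AE[OF b(2), of "V h"]
      rep_l2_add_AE[of "\<phi> + tens exp h" "tens (\<lambda>x. exp (1 - x)) (V h)"] rep_l2_add_AE[of \<phi> "tens exp h"]
    unfolding \<psi>(2)[symmetric] by eventually_elim (auto simp: F_def core_elem_def unit_cut_def)
  have cont: "continuous_on {0..1} (\<lambda>x. F (x, y))" for y
  proof -
    have "continuous_on {0..1} (\<lambda>x. \<psi> (x, y))"
      by (intro continuous_at_imp_continuous_on ballI has_vector_derivative_continuous[OF dom_fun_deriv[OF \<psi>(1)]])
    then show ?thesis unfolding F_def by (intro continuous_intros) auto
  qed
  have "\<psi> (0, y) = 0 \<and> \<psi> (1, y) = 0" for y
  proof -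
    obtain a b where "0 < a" "a < b" "b < 1" "\<And>x. x \<notin> {a<..<b} \<Longrightarrow> \<psi> (x, y) = 0"
      using dom_fun_slice[OF \<psi>(1)] by metis
    then show ?thesis by simp
  qed
  then have F01: "F (0, y) = rep_l2 h y + of_real (exp 1) * rep_l2 (V h) y"
    "F (1, y) = of_real (exp 1) * rep_l2 h y + rep_l2 (V h) y" for y
    by (simp_all add: F_def)
  have K: "h + exp 1 *\<^sub>R V h \<in> L2 \<Omega>" "exp 1 *\<^sub>R h + V h \<in> L2 \<Omega>"
    by (intro csubspace_add[OF csubspace_L2] csubspace_scaleR[OF csubspace_L2] h)+
  have "AE y in lebesgue. F (0, y) = rep_l2 (h + exp 1 *\<^sub>R V h) y"
    using rep_l2_add_AE[of h "exp 1 *\<^sub>R V h"] rep_l2_scaleC_AE[of "of_real (exp 1)" "V h"]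
    unfolding F01 scaleR_eq_scaleC by eventually_elim simp
  then show "has_trace \<Omega> (core_elem V \<phi> h) 0 (h + exp 1 *\<^sub>R V h)"
    unfolding has_trace_def using K(1) 1 cont
    by (intro conjI exI[of _ F]) (auto elim: eventually_mono)
  have "AE y in lebesgue. F (1, y) = rep_l2 (exp 1 *\<^sub>R h + V h) y"
    using rep_l2_add_AE[of "exp 1 *\<^sub>R h" "V h"] rep_l2_scaleC_AE[of "of_real (exp 1)" h]
    unfolding F01 scaleR_eq_scaleC by eventually_elim simp
  then show "has_trace \<Omega> (core_elem V \<phi> h) 1 (exp 1 *\<^sub>R h + V h)"
    unfolding has_trace_def using K(2) 1 cont
    by (intro conjI exI[of _ F]) (auto elim: eventually_mono)
qed

lemma boundary_condition_core_dom:
  assumes \<Omega>: "\<Omega> \<in> sets lebesgue" and V: "unitary_op (L2 \<Omega>) V" and f: "f \<in> core_dom \<Omega> V"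
  shows "boundary_condition \<Omega> (U_op \<Omega> V) f"
proof -
  obtain \<phi> h where f: "f = core_elem V \<phi> h" "\<phi> \<in> Domain (D1 \<Omega>)" "h \<in> L2 \<Omega>"
    using f unfolding core_dom_def by blast
  show ?thesis
    unfolding boundary_condition_def U_op_def f(1)
    using has_trace_core_elem[where V = V, OF f(2,3) unitary_in[OF V f(3)]] W_op_apply[OF \<Omega> V f(3)]
    by (intro exI[of _ "h + exp 1 *\<^sub>R V h"]) simp
qed

text \<open>Core elements without a part from D suffice. Their traces must be (I + eV)k and (eI +
  V)k for some k, which gives two linear relations between h - k and V'h - Vk with determinant 1 -
  e^2, so both differences vanish.\<close>

lemma boundary_condition_determines_unitary:
  assumes \<Omega>: "\<Omega> \<in> sets lebesgue" and V: "unitary_op (L2 \<Omega>) V" and V': "unitary_op (L2 \<Omega>) V'"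
    and bc: "\<And>f. f \<in> core_dom \<Omega> V' \<Longrightarrow> boundary_condition \<Omega> (U_op \<Omega> V) f" and h: "h \<in> L2 \<Omega>"
  shows "V' h = V h"
proof -
  have 0: "0 \<in> Domain (D1 \<Omega>)" using D1_zero by blast
  let ?f = "core_elem V' 0 h"
  have "?f \<in> core_dom \<Omega> V'" unfolding core_dom_def using 0 h by blast
  from bc[OF this] obtain g where g: "has_trace \<Omega> ?f 0 g" "has_trace \<Omega> ?f 1 (W_op \<Omega> V g)"
    unfolding boundary_condition_def U_op_def by blast
  note t = has_trace_core_elem[where V = V', OF 0 h unitary_in[OF V' h]]
  have eq: "g = h + exp 1 *\<^sub>R V' h" "W_op \<Omega> V g = exp 1 *\<^sub>R h + V' h"
    using has_trace_unique[OF g(1) t(1)] has_trace_unique[OF g(2) t(2)] by simp_all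
  have "g \<in> L2 \<Omega>" using g(1) by (simp add: has_trace_def)
  then obtain k where k: "k \<in> L2 \<Omega>" "k + exp 1 *\<^sub>R V k = g"
    using unitary_I_plus_surj[OF csubspace_L2 closed_L2[OF \<Omega>] V] by blast
  define a where "a = h - k"
  define b where "b = V' h - V k"
  have a: "a = - (exp 1 *\<^sub>R b)" using eq(1) k(2) by (simp add: a_def b_def algebra_simps)
  have "exp 1 *\<^sub>R a + b = 0"
    using eq(2) W_op_apply[OF \<Omega> V k(1)] k(2) by (simp add: a_def b_def algebra_simps)
  then have "(1 - exp 2) *\<^sub>R b = 0"
    unfolding a by (simp add: algebra_simps flip: exp_add)
  then have "b = 0" by simp
  then show ?thesis using a by (simp add: a_def b_def)
qed

text \<open>Operators are total functions on \<open>l2\<close> whose values off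
  \<open>L2 \<Omega>\<close> are arbitrary; uniqueness of V is therefore expressed as agreement on
  \<open>L2 \<Omega>\<close>.\<close>

theorem theorem4p1:
  fixes \<Omega> :: "(real ^ 'n) set"
  assumes "\<Omega> \<in> sets lebesgue"
    and "0 < emeasure lebesgue \<Omega>"
    and "emeasure lebesgue \<Omega> < \<infinity>"
  shows "symmetric_op (L2 (cyl \<Omega>)) (S_op \<Omega>)
    \<and> (\<forall>V. unitary_op (L2 \<Omega>) V \<longrightarrow> (\<exists>!H. is_extension \<Omega> V H))
    \<and> (\<forall>H. self_adjoint_op (L2 (cyl \<Omega>)) H \<and> S_op \<Omega> \<subseteq> H \<longrightarrow>
          (\<exists>V. unitary_op (L2 \<Omega>) V \<and> is_extension \<Omega> V H \<and>
             (\<forall>V'. unitary_op (L2 \<Omega>) V' \<and> is_extension \<Omega> V' H \<longrightarrow>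
                (\<forall>h\<in>L2 \<Omega>. V' h = V h))))
    \<and> (\<forall>V. unitary_op (L2 \<Omega>) V \<longrightarrow>
          invertible_op (L2 \<Omega>) (\<lambda>h. h + exp 1 *\<^sub>R V h)
        \<and> partial_isometry_op (L2 \<Omega>) (U_op \<Omega> V)
        \<and> (\<forall>f\<in>core_dom \<Omega> V. boundary_condition \<Omega> (U_op \<Omega> V) f)
        \<and> (\<forall>V'. unitary_op (L2 \<Omega>) V' \<and>
              (\<forall>f\<in>core_dom \<Omega> V'. boundary_condition \<Omega> (U_op \<Omega> V) f) \<longrightarrow>
                (\<forall>h\<in>L2 \<Omega>. V' h = V h))
        \<and> invertible_op (L2 \<Omega>) (\<lambda>h. h - exp 1 *\<^sub>R W_op \<Omega> V h)
        \<and> (\<forall>h\<in>L2 \<Omega>. V_op \<Omega> (W_op \<Omega> V) h = V h))"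
proof (intro conjI allI impI ballI; (elim conjE)?)
  note \<Omega> = assms(1,3)
  show "symmetric_op (L2 (cyl \<Omega>)) (S_op \<Omega>)" by (rule symmetric_S_op[OF \<Omega>])
  show "\<exists>!H. is_extension \<Omega> V H" if "unitary_op (L2 \<Omega>) V" for V
    using is_extension_ext_graph[OF \<Omega> that] is_extension_unique[OF \<Omega> that] by blast
  show "\<exists>V. unitary_op (L2 \<Omega>) V \<and> is_extension \<Omega> V H \<and>
      (\<forall>V'. unitary_op (L2 \<Omega>) V' \<and> is_extension \<Omega> V' H \<longrightarrow> (\<forall>h\<in>L2 \<Omega>. V' h = V h))"
    if H: "self_adjoint_op (L2 (cyl \<Omega>)) H" "S_op \<Omega> \<subseteq> H" for H
  proof -
    obtain V where V: "unitary_op (L2 \<Omega>) V" "H = div_i ` ext_graph \<Omega> V"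
      by (rule self_adjoint_extension_eq_ext_graph[OF \<Omega> H])
    have "V' h = V h" if V': "unitary_op (L2 \<Omega>) V'" "is_extension \<Omega> V' H" and h: "h \<in> L2 \<Omega>" for V' h
    proof (rule ext_graph_determines_unitary[OF \<Omega> V(1) V'(1) _ h])
      show "ext_graph \<Omega> V = ext_graph \<Omega> V'"
        using is_extension_unique[OF \<Omega> V'] V(2) mul_i_div_i_image by metis
    qed
    then show ?thesis using V is_extension_ext_graph[OF \<Omega> V(1)] by blast
  qed
  fix V assume V: "unitary_op (L2 \<Omega>) V"
  show "invertible_op (L2 \<Omega>) (\<lambda>h. h + exp 1 *\<^sub>R V h)"
    by (rule invertible_I_plus[OF csubspace_L2 closed_L2[OF \<Omega>(1)] V])
  \<comment> \<open>\<open>W_op \<Omega> V\<close> preserves all norms on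
    \<open>L2 \<Omega>\<close>, in particular those of vectors orthogonal to its kernel.\<close>
  show "partial_isometry_op (L2 \<Omega>) (U_op \<Omega> V)"
    using bounded_op_W_op[OF \<Omega>(1) V] W_op_isometric[OF \<Omega>(1) V]
    by (simp add: partial_isometry_op_def U_op_def)
  show "boundary_condition \<Omega> (U_op \<Omega> V) f" if "f \<in> core_dom \<Omega> V" for f
    by (rule boundary_condition_core_dom[OF \<Omega>(1) V that])
  show "V' h = V h" if "unitary_op (L2 \<Omega>) V'"
    "\<forall>f\<in>core_dom \<Omega> V'. boundary_condition \<Omega> (U_op \<Omega> V) f" "h \<in> L2 \<Omega>" for V' h
    using boundary_condition_determines_unitary[OF \<Omega>(1) V that(1) _ that(3)] that(2) by blast
  show "invertible_op (L2 \<Omega>) (\<lambda>h. h - exp 1 *\<^sub>R W_op \<Omega> V h)"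
    by (rule invertible_I_minus_W_op[OF \<Omega>(1) V])
  show "V_op \<Omega> (W_op \<Omega> V) h = V h" if "h \<in> L2 \<Omega>" for h
    by (rule V_op_W_op[OF \<Omega>(1) V that])
qed

end
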